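(* For each $k\ge 1$ there exists a polynomial-time algorithm that, given a QCSP instance $(\phi,\mathbf{B})$ with $\mathbf{B}$ finite, decides whether $(\phi,\mathbf{B})$ is $k$-judge-consistent.
   Context: Multi-sorted relational first-order logic: structures $\mathbf{B}$ have sort universes $B_s$ and relations $R^{\mathbf{B}}$; variables have sorts $s(v)$; a "map $f:V\to B$" sends each $v\in V$ into $B_{s(v)}$; $f\upharpoonright U$ is restriction and $f[y\to b]$ the extension mapping $y$ to $b$. A qc-formula is built from atoms, conjunction (arbitrary finite arity), $\forall,\exists$; $\mathrm{free}(\phi)$ denotes free variables; a QCSP instance $(\phi,\mathbf{B})$ is a qc-sentence with a structure of the same signature. $I_\phi$ has one index per subformula occurrence of $\phi$, $\phi(i)$ is the subformula at $i$, parent/child refer to the syntax tree. A judgement is $(i,V,F)$ with $i\in I_\phi$, $V\subseteq\mathrm{free}(\phi(i))$, $F$ a set of maps $V\to B$ (exactly one map $\emptyset\to B$ exists); empty if $F=\emptyset$; width $|V|$. $F_1\Join F_2=\{f:U_1\cup U_2\to B: f\upharpoonright U_1\in F_1, f\upharpoonright U_2\in F_2\}$; for $y\in U$, $\epsilon_yF=\{f:U\setminus\{y\}\to B: f[y\to b]\in F$ for all $b\in B_{s(y)}\}$. A judgement proof is a finite sequence of judgements each of one of the types: (atom) $(i,\{v_1,\dots,v_k\},F)$ with $\phi(i)=R(v_1,\dots,v_k)$, $F=\{f:(f(v_1),\dots,f(v_k))\in R^{\mathbf{B}}\}$; (projection) $(i,U,F\upharpoonright U)$ from previous $(i,V,F)$,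 $U\subseteq V$; (join) $(i,U_1\cup U_2,F_1\Join F_2)$ from previous $(i,U_1,F_1),(i,U_2,F_2)$; (upward flow) $(i,V,F)$ from previous $(j,V,F)$, $i$ parent of $j$; ($\forall$-elimination) $(i,V\setminus\{y\},\epsilon_yF)$ from previous $(j,V,F)$, $y\in V$, $\phi(i)=\forall y\,\phi(j)$, $i$ parent of $j$; (downward flow) $(j,V,F)$ from previous $(i,V,F)$, $i$ parent of $j$. Width of a proof = maximum width of its judgements. $(\phi,\mathbf{B})$ is $k$-judge-consistent if no judgement proof of width at most $k$ contains an empty judgement. *)

theory Defs
  imports Main "HOL-Computational_Algebra.Polynomial"
begin

section \<open>Multi-sorted relational structures and qc-formulas\<close>

record ('s, 'r) signature =
  sorts :: "'s set"
  symbols :: "'r set"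
  arity :: "'r \<Rightarrow> 's list"

record ('s, 'r, 'b) struct = "('s, 'r) signature" +
  univ :: "'s \<Rightarrow> 'b set"
  rel :: "'r \<Rightarrow> 'b list set"

text \<open>A variable carries its sort: the sort of \<open>v\<close> is \<open>snd v\<close>.\<close>

type_synonym ('v, 's) var = "'v \<times> 's"

abbreviation sort_of :: "('v, 's) var \<Rightarrow> 's" where
  "sort_of \<equiv> snd"

datatype ('v, 's, 'r) qc =
    Atom 'r "('v, 's) var list"
  | Conj "('v, 's, 'r) qc list"
  | Forall "('v, 's) var" "('v, 's, 'r) qc"
  | Exists "('v, 's) var" "('v, 's, 'r) qc"

primrec free :: "('v, 's, 'r) qc \<Rightarrow> ('v, 's) var set" where
  "free (Atom R vs) = set vs"
| "free (Conj \<psi>s) = \<Union> (set (map free \<psi>s))"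
| "free (Forall y \<psi>) = free \<psi> - {y}"
| "free (Exists y \<psi>) = free \<psi> - {y}"

primrec well_sorted :: "('s, 'r, 'm) signature_scheme \<Rightarrow> ('v, 's, 'r) qc \<Rightarrow> bool" where
  "well_sorted \<Sigma> (Atom R vs) \<longleftrightarrow> R \<in> symbols \<Sigma> \<and> map sort_of vs = arity \<Sigma> R"
| "well_sorted \<Sigma> (Conj \<psi>s) \<longleftrightarrow> list_all id (map (well_sorted \<Sigma>) \<psi>s)"
| "well_sorted \<Sigma> (Forall y \<psi>) \<longleftrightarrow> sort_of y \<in> sorts \<Sigma> \<and> well_sorted \<Sigma> \<psi>"
| "well_sorted \<Sigma> (Exists y \<psi>) \<longleftrightarrow> sort_of y \<in> sorts \<Sigma> \<and> well_sorted \<Sigma> \<psi>"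

definition is_signature :: "('s, 'r, 'm) signature_scheme \<Rightarrow> bool" where
  "is_signature \<Sigma> \<longleftrightarrow> (\<forall>R\<in>symbols \<Sigma>. set (arity \<Sigma> R) \<subseteq> sorts \<Sigma>)"

definition is_struct :: "('s, 'r, 'b) struct \<Rightarrow> bool" where
  "is_struct B \<longleftrightarrow> is_signature B \<and>
     (\<forall>R\<in>symbols B. \<forall>bs\<in>rel B R. list_all2 (\<lambda>b s. b \<in> univ B s) bs (arity B R))"

definition finite_struct :: "('s, 'r, 'b) struct \<Rightarrow> bool" where
  "finite_struct B \<longleftrightarrow>
     finite (sorts B) \<and> finite (symbols B) \<and> (\<forall>s\<in>sorts B. finite (univ B s))"

definition qcsp_instance :: "('v, 's, 'r) qc \<Rightarrow> ('s, 'r, 'b) struct \<Rightarrow> bool" where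
  "qcsp_instance \<phi> B \<longleftrightarrow> is_struct B \<and> well_sorted B \<phi> \<and> free \<phi> = {}"

text \<open>Subformula occurrences are indexed by their paths from the root of the syntax tree.\<close>

type_synonym index = "nat list"

primrec children :: "('v, 's, 'r) qc \<Rightarrow> ('v, 's, 'r) qc list" where
  "children (Atom R vs) = []"
| "children (Conj \<psi>s) = \<psi>s"
| "children (Forall y \<psi>) = [\<psi>]"
| "children (Exists y \<psi>) = [\<psi>]"

fun subformula :: "('v, 's, 'r) qc \<Rightarrow> index \<Rightarrow> ('v, 's, 'r) qc option" where
  "subformula \<phi> [] = Some \<phi>"
| "subformula \<phi> (n # i) =
     (if n < length (children \<phi>) then subformula (children \<phi> ! n) i else None)"

definition indices :: "('v, 's, 'r) qc \<Rightarrow> index set" where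
  "indices \<phi> = {i. subformula \<phi> i \<noteq> None}"

definition subf :: "('v, 's, 'r) qc \<Rightarrow> index \<Rightarrow> ('v, 's, 'r) qc" where
  "subf \<phi> i = the (subformula \<phi> i)"

definition parent :: "('v, 's, 'r) qc \<Rightarrow> index \<Rightarrow> index \<Rightarrow> bool" where
  "parent \<phi> i j \<longleftrightarrow> i \<in> indices \<phi> \<and> j \<in> indices \<phi> \<and> (\<exists>n. j = i @ [n])"


section \<open>Judgements\<close>

text \<open>A map \<open>V \<rightarrow> B\<close> is a partial function with domain exactly \<open>V\<close>; in particular
  \<open>Map.empty\<close> is the only map on the empty set. Universes may be empty.\<close>

definition maps :: "('s, 'r, 'b) struct \<Rightarrow> ('v, 's) var set \<Rightarrow> (('v, 's) var \<rightharpoonup> 'b) set" where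
  "maps B V = {f. dom f = V \<and> (\<forall>v\<in>V. the (f v) \<in> univ B (sort_of v))}"

definition restrict_maps ::
  "(('v, 's) var \<rightharpoonup> 'b) set \<Rightarrow> ('v, 's) var set \<Rightarrow> (('v, 's) var \<rightharpoonup> 'b) set" where
  "restrict_maps F U = (\<lambda>f. f |` U) ` F"

definition join_maps ::
  "('s, 'r, 'b) struct \<Rightarrow> ('v, 's) var set \<Rightarrow> (('v, 's) var \<rightharpoonup> 'b) set \<Rightarrow>
   ('v, 's) var set \<Rightarrow> (('v, 's) var \<rightharpoonup> 'b) set \<Rightarrow> (('v, 's) var \<rightharpoonup> 'b) set" where
  "join_maps B U1 F1 U2 F2 = {f \<in> maps B (U1 \<union> U2). f |` U1 \<in> F1 \<and> f |` U2 \<in> F2}"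

definition eps_maps ::
  "('s, 'r, 'b) struct \<Rightarrow> ('v, 's) var \<Rightarrow> ('v, 's) var set \<Rightarrow>
   (('v, 's) var \<rightharpoonup> 'b) set \<Rightarrow> (('v, 's) var \<rightharpoonup> 'b) set" where
  "eps_maps B y U F = {f \<in> maps B (U - {y}). \<forall>b\<in>univ B (sort_of y). f(y \<mapsto> b) \<in> F}"

type_synonym ('v, 's, 'b) judgement =
  "index \<times> ('v, 's) var set \<times> (('v, 's) var \<rightharpoonup> 'b) set"

fun is_judgement ::
  "('v, 's, 'r) qc \<Rightarrow> ('s, 'r, 'b) struct \<Rightarrow> ('v, 's, 'b) judgement \<Rightarrow> bool" where
  "is_judgement \<phi> B (i, V, F) \<longleftrightarrow> i \<in> indices \<phi> \<and> V \<subseteq> free (subf \<phi> i) \<and> F \<subseteq> maps B V"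

fun empty_judgement :: "('v, 's, 'b) judgement \<Rightarrow> bool" where
  "empty_judgement (i, V, F) \<longleftrightarrow> F = {}"

fun width :: "('v, 's, 'b) judgement \<Rightarrow> nat" where
  "width (i, V, F) = card V"

text \<open>\<open>derives \<phi> B P J\<close>: \<open>J\<close> results from one rule application with premises in \<open>P\<close>.\<close>

inductive derives ::
  "('v, 's, 'r) qc \<Rightarrow> ('s, 'r, 'b) struct \<Rightarrow> ('v, 's, 'b) judgement set \<Rightarrow>
   ('v, 's, 'b) judgement \<Rightarrow> bool"
  for \<phi> :: "('v, 's, 'r) qc" and B :: "('s, 'r, 'b) struct"
    and P :: "('v, 's, 'b) judgement set" where
  atom: "\<lbrakk>i \<in> indices \<phi>; subf \<phi> i = Atom R vs\<rbrakk> \<Longrightarrow>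
    derives \<phi> B P (i, set vs, {f \<in> maps B (set vs). map (\<lambda>v. the (f v)) vs \<in> rel B R})"
| projection: "\<lbrakk>(i, V, F) \<in> P; U \<subseteq> V\<rbrakk> \<Longrightarrow> derives \<phi> B P (i, U, restrict_maps F U)"
| join: "\<lbrakk>(i, U1, F1) \<in> P; (i, U2, F2) \<in> P\<rbrakk> \<Longrightarrow>
    derives \<phi> B P (i, U1 \<union> U2, join_maps B U1 F1 U2 F2)"
| upward_flow: "\<lbrakk>(j, V, F) \<in> P; parent \<phi> i j\<rbrakk> \<Longrightarrow> derives \<phi> B P (i, V, F)"
| forall_elim: "\<lbrakk>(j, V, F) \<in> P; y \<in> V; subf \<phi> i = Forall y (subf \<phi> j); parent \<phi> i j\<rbrakk> \<Longrightarrow>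
    derives \<phi> B P (i, V - {y}, eps_maps B y V F)"
| downward_flow: "\<lbrakk>(i, V, F) \<in> P; parent \<phi> i j\<rbrakk> \<Longrightarrow> derives \<phi> B P (j, V, F)"

definition judgement_proof ::
  "('v, 's, 'r) qc \<Rightarrow> ('s, 'r, 'b) struct \<Rightarrow> ('v, 's, 'b) judgement list \<Rightarrow> bool" where
  "judgement_proof \<phi> B Js \<longleftrightarrow>
     (\<forall>n<length Js. is_judgement \<phi> B (Js ! n) \<and> derives \<phi> B (set (take n Js)) (Js ! n))"

definition proof_width :: "('v, 's, 'b) judgement list \<Rightarrow> nat" where
  "proof_width Js = Max (insert 0 (width ` set Js))"

definition judge_consistent :: "nat \<Rightarrow> ('v, 's, 'r) qc \<Rightarrow> ('s, 'r, 'b) struct \<Rightarrow> bool" where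
  "judge_consistent k \<phi> B \<longleftrightarrow>
     \<not> (\<exists>Js. judgement_proof \<phi> B Js \<and> proof_width Js \<le> k \<and> (\<exists>J\<in>set Js. empty_judgement J))"


section \<open>Algorithms and running time\<close>

text \<open>Algorithms are programs of a WHILE language over binary trees, in the style of N. D. Jones,
  \<^emph>\<open>Computability and Complexity from a Programming Perspective\<close>. Evaluating an expression is
  charged at least the size of the resulting tree, so reading, copying and comparing data is paid
  for in full. Hence a run of cost \<open>t\<close> can be simulated by a Turing machine in time polynomial
  in \<open>t\<close> and the input size, and conversely a Turing machine step is simulated with overhead
  polynomial in the tape length: polynomial time here is the usual polynomial time.\<close>

datatype tree = Leaf | Node tree tree

primrec tsize :: "tree \<Rightarrow> nat" where
  "tsize Leaf = 1"
| "tsize (Node l r) = tsize l + tsize r + 1"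

primrec left :: "tree \<Rightarrow> tree" where
  "left Leaf = Leaf"
| "left (Node l r) = l"

primrec right :: "tree \<Rightarrow> tree" where
  "right Leaf = Leaf"
| "right (Node l r) = r"

primrec enc_bool :: "bool \<Rightarrow> tree" where
  "enc_bool False = Leaf"
| "enc_bool True = Node Leaf Leaf"

datatype expr = Var nat | LeafE | NodeE expr expr | LeftE expr | RightE expr | EqE expr expr

type_synonym store = "nat \<Rightarrow> tree"

primrec eval :: "expr \<Rightarrow> store \<Rightarrow> tree" where
  "eval (Var x) s = s x"
| "eval LeafE s = Leaf"
| "eval (NodeE a b) s = Node (eval a s) (eval b s)"
| "eval (LeftE a) s = left (eval a s)"
| "eval (RightE a) s = right (eval a s)"
| "eval (EqE a b) s = enc_bool (eval a s = eval b s)"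

primrec eval_cost :: "expr \<Rightarrow> store \<Rightarrow> nat" where
  "eval_cost (Var x) s = tsize (s x)"
| "eval_cost LeafE s = 1"
| "eval_cost (NodeE a b) s = eval_cost a s + eval_cost b s + 1"
| "eval_cost (LeftE a) s = eval_cost a s + 1"
| "eval_cost (RightE a) s = eval_cost a s + 1"
| "eval_cost (EqE a b) s = eval_cost a s + eval_cost b s + 1"

datatype prog =
    Skip
  | Assign nat expr
  | Seq prog prog
  | If expr prog prog
  | While expr prog

text \<open>\<open>exec c s t s'\<close>: started in \<open>s\<close>, the program \<open>c\<close> halts in \<open>s'\<close> with running time \<open>t\<close>.
  A test succeeds if its value is not \<open>Leaf\<close>.\<close>

inductive exec :: "prog \<Rightarrow> store \<Rightarrow> nat \<Rightarrow> store \<Rightarrow> bool" where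
  Skip: "exec Skip s 1 s"
| Assign: "exec (Assign x e) s (eval_cost e s + 1) (s(x := eval e s))"
| Seq: "\<lbrakk>exec c s t s'; exec d s' t' s''\<rbrakk> \<Longrightarrow> exec (Seq c d) s (t + t') s''"
| IfTrue: "\<lbrakk>eval e s \<noteq> Leaf; exec c s t s'\<rbrakk> \<Longrightarrow>
    exec (If e c d) s (eval_cost e s + 1 + t) s'"
| IfFalse: "\<lbrakk>eval e s = Leaf; exec d s t s'\<rbrakk> \<Longrightarrow>
    exec (If e c d) s (eval_cost e s + 1 + t) s'"
| WhileFalse: "eval e s = Leaf \<Longrightarrow> exec (While e c) s (eval_cost e s + 1) s"
| WhileTrue: "\<lbrakk>eval e s \<noteq> Leaf; exec c s t s'; exec (While e c) s' t' s''\<rbrakk> \<Longrightarrow>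
    exec (While e c) s (eval_cost e s + 1 + t + t') s''"

lemma tsize_eval_le_cost: "tsize (eval e s) \<le> eval_cost e s"
proof -
  have pos: "1 \<le> tsize u" for u by (cases u) auto
  have l: "tsize (left u) \<le> tsize u" for u by (cases u) auto
  have r: "tsize (right u) \<le> tsize u" for u by (cases u) auto
  show ?thesis
  proof (induction e)
    case (LeftE e)
    then show ?case using l[of "eval e s"] by simp
  next
    case (RightE e)
    then show ?case using r[of "eval e s"] by simp
  next
    case (EqE a b)
    then show ?case using pos[of "eval a s"] pos[of "eval b s"]
      by (cases "eval a s = eval b s") auto
  qed auto
qed

lemma exec_deterministic:
  assumes "exec c s t1 s1" and "exec c s t2 s2"
  shows "t1 = t2 \<and> s1 = s2"
  using assms
proof (induction arbitrary: t2 s2 rule: exec.induct)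
  case (Seq c s t s' d t' s'')
  from Seq.prems show ?case
    by cases (use Seq.IH in blast)
next
  case (WhileTrue e s c t s' t' s'')
  from WhileTrue.prems show ?case
    by cases (use WhileTrue.IH WhileTrue.hyps in blast)+
qed (erule exec.cases; fastforce)+

definition init_store :: "tree \<Rightarrow> store" where
  "init_store x = (\<lambda>_. Leaf)(0 := x)"

definition outputs_within :: "prog \<Rightarrow> tree \<Rightarrow> nat \<Rightarrow> tree \<Rightarrow> bool" where
  "outputs_within c x n z \<longleftrightarrow> (\<exists>t s. exec c (init_store x) t s \<and> t \<le> n \<and> s 0 = z)"


section \<open>Presentation of finite instances as input\<close>

text \<open>As input, all names (of variables, sorts, symbols and elements) are bit strings.\<close>

type_synonym name = "bool list"

definition enc_list :: "('a \<Rightarrow> tree) \<Rightarrow> 'a list \<Rightarrow> tree" where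
  "enc_list enc xs = foldr (\<lambda>x t. Node (enc x) t) xs Leaf"

definition enc_pair :: "('a \<Rightarrow> tree) \<Rightarrow> ('b \<Rightarrow> tree) \<Rightarrow> 'a \<times> 'b \<Rightarrow> tree" where
  "enc_pair enc1 enc2 p = Node (enc1 (fst p)) (enc2 (snd p))"

definition enc_name :: "name \<Rightarrow> tree" where
  "enc_name = enc_list enc_bool"

definition enc_var :: "(name, name) var \<Rightarrow> tree" where
  "enc_var = enc_pair enc_name enc_name"

definition enc_tag :: "bool \<Rightarrow> bool \<Rightarrow> tree" where
  "enc_tag p q = Node (enc_bool p) (enc_bool q)"

primrec enc_qc :: "(name, name, name) qc \<Rightarrow> tree" where
  "enc_qc (Atom R vs) = Node (enc_tag False False) (Node (enc_name R) (enc_list enc_var vs))"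
| "enc_qc (Conj \<psi>s) = Node (enc_tag False True) (enc_list id (map enc_qc \<psi>s))"
| "enc_qc (Forall y \<psi>) = Node (enc_tag True False) (Node (enc_var y) (enc_qc \<psi>))"
| "enc_qc (Exists y \<psi>) = Node (enc_tag True True) (Node (enc_var y) (enc_qc \<psi>))"

text \<open>A finite structure is presented by listing, in any order and without repetition, its sorts
  with their elements and its relation symbols with their arities and tuples.\<close>

type_synonym sort_table = "(name \<times> name list) list"
type_synonym symbol_table = "(name \<times> name list \<times> name list list) list"

definition lists_struct ::
  "sort_table \<Rightarrow> symbol_table \<Rightarrow> (name, name, name) struct \<Rightarrow> bool" where
  "lists_struct us rs B \<longleftrightarrow>
     distinct (map fst us) \<and> set (map fst us) = sorts B \<and>
     (\<forall>(s, bs)\<in>set us. distinct bs \<and> set bs = univ B s) \<and>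
     distinct (map fst rs) \<and> set (map fst rs) = symbols B \<and>
     (\<forall>(R, ss, ts)\<in>set rs. ss = arity B R \<and> distinct ts \<and> set ts = rel B R)"

definition encodes_instance ::
  "tree \<Rightarrow> (name, name, name) qc \<Rightarrow> (name, name, name) struct \<Rightarrow> bool" where
  "encodes_instance x \<phi> B \<longleftrightarrow> (\<exists>us rs. lists_struct us rs B \<and>
     x = Node (enc_qc \<phi>)
           (Node (enc_list (enc_pair enc_name (enc_list enc_name)) us)
                 (enc_list (enc_pair enc_name
                     (enc_pair (enc_list enc_name) (enc_list (enc_list enc_name)))) rs)))"

end

theory Submission
  imports Defs
begin

text \<open>By joining and projecting one variable at a time, a judgement proof of width \<open>k\<close> amounts to a least
  fixed point over two kinds of facts: \<open>avail i V\<close> (some judgement on \<open>V\<close> is derivable at \<open>i\<close>) and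
  \<open>out i f\<close> (some derivable judgement at \<open>i\<close> excludes the map \<open>f\<close>). The instance is inconsistent iff
  the empty map is \<open>out\<close> at the root. Availability cannot be dropped: if a universe is empty, a
  judgement on all maps would already be an empty judgement. For fixed \<open>k\<close> there are polynomially
  many facts, and a round of rule applications is a formula with quantifiers bounded by lists that are
  computable in polynomial time, so as many rounds as there are facts reach the fixed point. Free
  variables enter the side conditions of the flow rules and are computed in the same fixed point.\<close>

section \<open>Polynomial-time computable functions on trees\<close>

text \<open>The obstacle is the sets \<open>F\<close>: over one variable set there are exponentially
  many of them, so judgements cannot be enumerated. But joining two judgements on the same
  \<open>V\<close> at the same \<open>i\<close> intersects their sets, so in a finite structure each
  available \<open>(i, V)\<close> has a strongest derivable judgement, and it is determined by the
  maps that some derivable judgement excludes. Every rule can be rephrased for single excluded maps.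
  Projection excludes \<open>f\<close> when all one-variable extensions of \<open>f\<close> are
  excluded, and \<forall>-elimination when one of them is. For projection the extensions may be
  excluded by different judgements; finiteness of the universe lets these be intersected into one.

  On the machine side, polynomial time is required on every tree, not only on encodings. Hence the
  decoding functions are total, and their size estimates are proved for arbitrary trees.\<close>

lemma tsize_pos: "1 \<le> tsize t"
  by (cases t) auto

lemma poly_nat_mono: "m \<le> n \<Longrightarrow> poly (p :: nat poly) m \<le> poly p n"
  by (induction p) (auto intro!: add_mono mult_le_mono)

section \<open>Polynomial bounds in the size of the input tree\<close>

definition poly_bounded :: "(tree \<Rightarrow> nat) \<Rightarrow> bool" where
  "poly_bounded f \<longleftrightarrow> (\<exists>p :: nat poly. \<forall>x. f x \<le> poly p (tsize x))"

lemma poly_bounded_const: "poly_bounded (\<lambda>x. n)"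
  unfolding poly_bounded_def by (rule exI[of _ "[:n:]"]) simp

lemma poly_bounded_tsize: "poly_bounded (\<lambda>x. tsize x)"
  unfolding poly_bounded_def by (rule exI[of _ "[:0, 1:]"]) simp

lemma poly_bounded_add:
  "poly_bounded f \<Longrightarrow> poly_bounded g \<Longrightarrow> poly_bounded (\<lambda>x. f x + g x)"
  unfolding poly_bounded_def by (metis add_mono poly_add)

lemma poly_bounded_mult:
  "poly_bounded f \<Longrightarrow> poly_bounded g \<Longrightarrow> poly_bounded (\<lambda>x. f x * g x)"
  unfolding poly_bounded_def by (metis mult_le_mono poly_mult)

lemma poly_bounded_Suc: "poly_bounded f \<Longrightarrow> poly_bounded (\<lambda>x. Suc (f x))"
  using poly_bounded_add[OF poly_bounded_const[of 1]] by simp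

lemma poly_bounded_le: "poly_bounded g \<Longrightarrow> (\<And>x. f x \<le> g x) \<Longrightarrow> poly_bounded f"
  unfolding poly_bounded_def by (meson order_trans)

lemma poly_bounded_poly:
  assumes "poly_bounded f"
  shows "poly_bounded (\<lambda>x. poly p (f x))"
proof -
  obtain q where q: "\<And>x. f x \<le> poly q (tsize x)"
    using assms unfolding poly_bounded_def by blast
  have "poly p (f x) \<le> poly (pcompose p q) (tsize x)" for x
    using poly_nat_mono[OF q] by (simp add: poly_pcompose)
  then show ?thesis
    unfolding poly_bounded_def by blast
qed

lemma poly_bounded_comp:
  assumes "poly_bounded T" and "poly_bounded (\<lambda>x. tsize (f x))"
  shows "poly_bounded (\<lambda>x. T (f x))"
proof -
  obtain p where "\<And>x. T x \<le> poly p (tsize x)"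
    using assms(1) unfolding poly_bounded_def by blast
  then show ?thesis
    by (intro poly_bounded_le[OF poly_bounded_poly[OF assms(2), of p]])
qed

lemmas poly_bounded_intros = poly_bounded_const poly_bounded_tsize poly_bounded_add
  poly_bounded_mult poly_bounded_Suc

section \<open>Runs with an upper bound on time, and polynomial-time functions\<close>

definition run :: "prog \<Rightarrow> store \<Rightarrow> nat \<Rightarrow> store \<Rightarrow> bool" where
  "run c s n s' \<longleftrightarrow> (\<exists>t\<le>n. exec c s t s')"

lemma run_Assign: "run (Assign v e) s (eval_cost e s + 1) (s(v := eval e s))"
  unfolding run_def using exec.Assign by blast

lemma run_Seq: "run c s n s' \<Longrightarrow> run d s' n' s'' \<Longrightarrow> run (Seq c d) s (n + n') s''"
  unfolding run_def by (metis add_mono exec.Seq)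

lemma run_IfTrue:
  "eval e s \<noteq> Leaf \<Longrightarrow> run c s n s' \<Longrightarrow> run (If e c d) s (eval_cost e s + 1 + n) s'"
  unfolding run_def by (meson add_left_mono exec.IfTrue)

lemma run_IfFalse:
  "eval e s = Leaf \<Longrightarrow> run d s n s' \<Longrightarrow> run (If e c d) s (eval_cost e s + 1 + n) s'"
  unfolding run_def by (meson add_left_mono exec.IfFalse)

lemma run_WhileFalse: "eval e s = Leaf \<Longrightarrow> run (While e c) s (eval_cost e s + 1) s"
  unfolding run_def using exec.WhileFalse by blast

lemma run_WhileTrue:
  "eval e s \<noteq> Leaf \<Longrightarrow> run c s n s' \<Longrightarrow> run (While e c) s' n' s'' \<Longrightarrow>
   run (While e c) s (eval_cost e s + 1 + n + n') s''"
  unfolding run_def by (metis (no_types, lifting) add_le_mono add_left_mono exec.WhileTrue)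

lemma run_mono: "run c s n s' \<Longrightarrow> n \<le> m \<Longrightarrow> run c s m s'"
  unfolding run_def by (meson order_trans)

text \<open>Evaluating an expression is charged at least the size of its value, so a variable grows
  by no more than the time spent. A time bound is therefore also an output size bound, which is what
  \<open>poly_bounded_pt\<close> extracts.\<close>

lemma exec_tsize_le: "exec c s t s' \<Longrightarrow> tsize (s' v) \<le> tsize (s v) + t"
  by (induction rule: exec.induct) (use tsize_eval_le_cost in \<open>auto simp: trans_le_add2 le_SucI\<close>)

text \<open>The program has to work from every store, whatever its scratch variables below \<open>n\<close> contain,
  and must leave the variables from \<open>n\<close> on alone. This makes programs compose without renaming
  variables.\<close>

definition computes :: "prog \<Rightarrow> nat \<Rightarrow> (tree \<Rightarrow> nat) \<Rightarrow> (tree \<Rightarrow> tree) \<Rightarrow> bool" where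
  "computes c n T f \<longleftrightarrow>
     (\<forall>s. \<exists>s'. run c s (T (s 0)) s' \<and> s' 0 = f (s 0) \<and> (\<forall>m\<ge>n. s' m = s m))"

definition pt :: "(tree \<Rightarrow> tree) \<Rightarrow> bool" where
  "pt f \<longleftrightarrow> (\<exists>c n T. n \<ge> 1 \<and> poly_bounded T \<and> computes c n T f)"

lemma ptI: "computes c n T f \<Longrightarrow> 1 \<le> n \<Longrightarrow> poly_bounded T \<Longrightarrow> pt f"
  unfolding pt_def by blast

lemma ptE:
  assumes "pt f"
  obtains c n T where "poly_bounded T" "computes c n T f" "1 \<le> n"
  using assms unfolding pt_def by blast

lemma computes_mono: "computes c n T f \<Longrightarrow> n \<le> m \<Longrightarrow> computes c m T f"
  unfolding computes_def by (meson order_trans)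

lemma poly_bounded_pt:
  assumes "pt f"
  shows "poly_bounded (\<lambda>x. tsize (f x))"
proof -
  obtain c n T where T: "poly_bounded T" and c: "computes c n T f"
    using assms unfolding pt_def by blast
  have "tsize (f x) \<le> tsize x + T x" for x
  proof -
    obtain s' where "run c (\<lambda>_. x) (T x) s'" "s' 0 = f x"
      using c unfolding computes_def by blast
    then show ?thesis
      unfolding run_def using exec_tsize_le[of c "\<lambda>_. x" _ s' 0] by fastforce
  qed
  then show ?thesis
    by (intro poly_bounded_le[OF poly_bounded_add[OF poly_bounded_tsize T]])
qed

lemma pt_expr:
  assumes "\<And>s. eval e s = f (s 0)" and "\<And>s. eval_cost e s \<le> T (s 0)" and "poly_bounded T"
  shows "pt f"
  unfolding pt_def computes_def
proof (intro exI conjI allI)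
  fix s
  show "run (Assign 0 e) s (T (s 0) + 1) (s(0 := eval e s))"
    by (rule run_mono[OF run_Assign]) (use assms(2) in auto)
  show "poly_bounded (\<lambda>x. T x + 1)"
    using assms(3) by (intro poly_bounded_intros)
  show "1 \<le> (1::nat)" by simp
qed (use assms(1) in auto)

section \<open>Closure under composition, pairing, branching and loops\<close>

lemma pt_id: "pt (\<lambda>x. x)"
  by (rule pt_expr[of "Var 0" _ tsize]) (auto intro: poly_bounded_intros)

lemma pt_const: "pt (\<lambda>x. t)"
proof -
  have "\<exists>e. \<forall>s. eval e s = t \<and> eval_cost e s = tsize t"
  proof (induction t)
    case Leaf
    show ?case by (rule exI[of _ LeafE]) simp
  next
    case (Node l r)
    then obtain a b where "\<forall>s. eval a s = l \<and> eval_cost a s = tsize l"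
      "\<forall>s. eval b s = r \<and> eval_cost b s = tsize r" by blast
    then show ?case by (intro exI[of _ "NodeE a b"]) simp
  qed
  then obtain e where "\<forall>s. eval e s = t \<and> eval_cost e s = tsize t" by blast
  then show ?thesis
    by (intro pt_expr[of e _ "\<lambda>x. tsize t"]) (auto intro: poly_bounded_intros)
qed

lemma pt_comp:
  assumes "pt g" and "pt f"
  shows "pt (\<lambda>x. g (f x))"
proof -
  obtain c n T where T: "poly_bounded T" and c: "computes c n T f" "n \<ge> 1"
    using ptE[OF \<open>pt f\<close>] .
  obtain d m U where U: "poly_bounded U" and d: "computes d m U g" "m \<ge> 1"
    using ptE[OF \<open>pt g\<close>] .
  have "computes (Seq c d) (max n m) (\<lambda>x. T x + U (f x)) (\<lambda>x. g (f x))"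
    unfolding computes_def
  proof
    fix s
    obtain s' where s': "run c s (T (s 0)) s'" "s' 0 = f (s 0)" "\<forall>m\<ge>n. s' m = s m"
      using c unfolding computes_def by blast
    obtain s'' where s'': "run d s' (U (s' 0)) s''" "s'' 0 = g (s' 0)" "\<forall>k\<ge>m. s'' k = s' k"
      using d unfolding computes_def by blast
    show "\<exists>s'. run (Seq c d) s (T (s 0) + U (f (s 0))) s' \<and> s' 0 = g (f (s 0)) \<and>
        (\<forall>k\<ge>max n m. s' k = s k)"
      using run_Seq[OF s'(1) s''(1)] s'(2,3) s''(2,3) by auto
  qed
  moreover have "poly_bounded (\<lambda>x. T x + U (f x))"
    using T U assms by (intro poly_bounded_add poly_bounded_comp[OF U] poly_bounded_pt)
  ultimately show ?thesis
    using c(2) by (intro ptI[of _ "max n m"]) auto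
qed

lemma pt_left: "pt f \<Longrightarrow> pt (\<lambda>x. left (f x))"
  by (rule pt_comp[of left], rule pt_expr[of "LeftE (Var 0)" _ "\<lambda>x. tsize x + 1"])
    (auto intro: poly_bounded_intros)

lemma pt_right: "pt f \<Longrightarrow> pt (\<lambda>x. right (f x))"
  by (rule pt_comp[of right], rule pt_expr[of "RightE (Var 0)" _ "\<lambda>x. tsize x + 1"])
    (auto intro: poly_bounded_intros)

lemma pt_Node:
  assumes "pt f" and "pt g"
  shows "pt (\<lambda>x. Node (f x) (g x))"
proof -
  obtain c n T where T: "poly_bounded T" and c: "computes c n T f" "n \<ge> 1"
    using ptE[OF \<open>pt f\<close>] .
  obtain d m U where U: "poly_bounded U" and d: "computes d m U g" "m \<ge> 1"
    using ptE[OF \<open>pt g\<close>] .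
  define k where "k = max n m"
  have c': "computes c k T f" and d': "computes d k U g" and k: "k \<ge> 1"
    using c d computes_mono unfolding k_def by auto
  \<comment> \<open>The variables \<open>k\<close> and \<open>k + 1\<close> lie above the scratch
    space of both programs: \<open>k\<close> keeps the input for the second run,
    \<open>k + 1\<close> keeps the result of the first.\<close>
  let ?p = "Seq (Assign k (Var 0)) (Seq c (Seq (Assign (k + 1) (Var 0))
    (Seq (Assign 0 (Var k)) (Seq d (Assign 0 (NodeE (Var (k + 1)) (Var 0)))))))"
  let ?T = "\<lambda>x. (tsize x + 1) + (T x + ((tsize (f x) + 1) + ((tsize x + 1) + (U x +
    (tsize (f x) + tsize (g x) + 1 + 1)))))"
  have "computes ?p (k + 2) ?T (\<lambda>x. Node (f x) (g x))"
    unfolding computes_def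
  proof
    fix s :: store
    let ?x = "s 0"
    let ?s1 = "s(k := ?x)"
    obtain s2 where s2: "run c ?s1 (T (?s1 0)) s2" "s2 0 = f (?s1 0)" "\<forall>m\<ge>k. s2 m = ?s1 m"
      using c' unfolding computes_def by blast
    let ?s3 = "s2(k + 1 := s2 0)"
    let ?s4 = "?s3(0 := ?s3 k)"
    obtain s5 where s5: "run d ?s4 (U (?s4 0)) s5" "s5 0 = g (?s4 0)" "\<forall>m\<ge>k. s5 m = ?s4 m"
      using d' unfolding computes_def by blast
    let ?s6 = "s5(0 := Node (s5 (k + 1)) (s5 0))"
    have v: "?s1 0 = ?x" "s2 0 = f ?x" "?s4 0 = ?x" "s5 0 = g ?x" "s5 (k + 1) = f ?x"
      using k s2 s5 by auto
    have "run ?p s (?T ?x) ?s6"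
    proof -
      have a1: "run (Assign k (Var 0)) s (tsize ?x + 1) ?s1"
        using run_Assign[of k "Var 0" s] by simp
      have a2: "run c ?s1 (T ?x) s2" using s2(1) v by simp
      have a3: "run (Assign (k + 1) (Var 0)) s2 (tsize (f ?x) + 1) ?s3"
        using run_Assign[of "k + 1" "Var 0" s2] v by simp
      have a4: "run (Assign 0 (Var k)) ?s3 (tsize ?x + 1) ?s4"
        using run_Assign[of 0 "Var k" ?s3] v k s2(3) by simp
      have a5: "run d ?s4 (U ?x) s5" using s5(1) v(3) by simp
      have a6: "run (Assign 0 (NodeE (Var (k + 1)) (Var 0))) s5
          (tsize (f ?x) + tsize (g ?x) + 1 + 1) ?s6"
        using run_Assign[of 0 "NodeE (Var (k + 1)) (Var 0)" s5] v(4,5) by simp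
      show ?thesis
        by (intro run_Seq[OF a1] run_Seq[OF a2] run_Seq[OF a3] run_Seq[OF a4]
          run_Seq[OF a5] a6)
    qed
    moreover have "?s6 0 = Node (f ?x) (g ?x)" using v by simp
    moreover have "\<forall>m\<ge>k + 2. ?s6 m = s m" using s2(3) s5(3) by auto
    ultimately show "\<exists>s'. run ?p s (?T ?x) s' \<and> s' 0 = Node (f ?x) (g ?x) \<and> (\<forall>m\<ge>k + 2. s' m = s m)"
      by blast
  qed
  moreover have "poly_bounded ?T"
    using T U assms by (intro poly_bounded_intros poly_bounded_pt)
  ultimately show ?thesis
    by (intro ptI[of _ "k + 2"]) auto
qed

lemma pt_If:
  assumes "pt b" and "pt f" and "pt g"
  shows "pt (\<lambda>x. if b x \<noteq> Leaf then f x else g x)"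
proof -
  obtain c n T where T: "poly_bounded T" and c: "computes c n T f" "n \<ge> 1"
    using ptE[OF \<open>pt f\<close>] .
  obtain d m U where U: "poly_bounded U" and d: "computes d m U g" "m \<ge> 1"
    using ptE[OF \<open>pt g\<close>] .
  define k where "k = max n m"
  have k: "k \<ge> 1" and cd: "computes c k T f" "computes d k U g"
    using c d computes_mono unfolding k_def by auto
  \<comment> \<open>This program expects the pair of test value and input, which
    \<open>pt_comp\<close> and \<open>pt_Node\<close> supply at the end. The test value waits in
    \<open>k\<close> while variable \<open>0\<close> receives the input for the chosen
    branch.\<close>
  let ?p = "Seq (Assign k (LeftE (Var 0))) (Seq (Assign 0 (RightE (Var 0))) (If (Var k) c d))"
  let ?h = "\<lambda>x. if left x \<noteq> Leaf then f (right x) else g (right x)"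
  let ?T = "\<lambda>x. (tsize x + 1 + 1) + ((tsize x + 1 + 1) +
    (tsize (left x) + 1 + (T (right x) + U (right x))))"
  have "computes ?p (k + 1) ?T ?h"
    unfolding computes_def
  proof
    fix s :: store
    let ?x = "s 0"
    let ?s1 = "s(k := left ?x)"
    let ?s2 = "?s1(0 := right ?x)"
    have a1: "run (Assign k (LeftE (Var 0))) s (tsize ?x + 1 + 1) ?s1"
      using run_Assign[of k "LeftE (Var 0)" s] by simp
    have a2: "run (Assign 0 (RightE (Var 0))) ?s1 (tsize ?x + 1 + 1) ?s2"
      using run_Assign[of 0 "RightE (Var 0)" ?s1] k by simp
    have "\<exists>s'. run (If (Var k) c d) ?s2 (tsize (left ?x) + 1 + (T (right ?x) + U (right ?x))) s' \<and>
        s' 0 = ?h ?x \<and> (\<forall>m\<ge>k + 1. s' m = s m)"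
    proof (cases "left ?x = Leaf")
      case True
      obtain s' where s': "run d ?s2 (U (?s2 0)) s'" "s' 0 = g (?s2 0)" "\<forall>m\<ge>k. s' m = ?s2 m"
        using cd unfolding computes_def by blast
      then show ?thesis
        using run_mono[OF run_IfFalse[of "Var k" ?s2 d "U (?s2 0)" s' c]] True k
        by (intro exI[of _ s']) auto
    next
      case False
      obtain s' where s': "run c ?s2 (T (?s2 0)) s'" "s' 0 = f (?s2 0)" "\<forall>m\<ge>k. s' m = ?s2 m"
        using cd unfolding computes_def by blast
      then show ?thesis
        using run_mono[OF run_IfTrue[of "Var k" ?s2 c "T (?s2 0)" s' d]] False k
        by (intro exI[of _ s']) auto
    qed
    then show "\<exists>s'. run ?p s (?T ?x) s' \<and> s' 0 = ?h ?x \<and> (\<forall>m\<ge>k + 1. s' m = s m)"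
      using run_Seq[OF a1 run_Seq[OF a2]] by blast
  qed
  moreover have "poly_bounded ?T"
    using T U by (intro poly_bounded_intros poly_bounded_comp[OF T] poly_bounded_comp[OF U]
        poly_bounded_pt pt_left pt_right pt_id)
  ultimately have "pt ?h"
    by (intro ptI[of _ "k + 1"]) auto
  from pt_comp[OF \<open>pt ?h\<close> pt_Node[OF assms(1) pt_id]] show ?thesis by (simp cong: if_cong)
qed

text \<open>Iterating a polynomial-time function may blow up its argument exponentially, hence the
  bound \<open>size\<close> on all intermediate states. The left half of the state is the loop
  guard; \<open>cont\<close> and \<open>stop\<close> say that it fails after exactly
  \<open>N x\<close> rounds.\<close>

lemma pt_while:
  assumes "pt f" and "pt i" and "poly_bounded Q"
    and N: "\<And>x. N x \<le> Q x"
    and size: "\<And>x n. n \<le> N x \<Longrightarrow> tsize ((f ^^ n) (i x)) \<le> Q x"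
    and cont: "\<And>x n. n < N x \<Longrightarrow> left ((f ^^ n) (i x)) \<noteq> Leaf"
    and stop: "\<And>x. left ((f ^^ N x) (i x)) = Leaf"
  shows "pt (\<lambda>x. (f ^^ N x) (i x))"
proof -
  obtain c n T where T: "poly_bounded T" and c: "computes c n T f" "n \<ge> 1"
    using ptE[OF \<open>pt f\<close>] .
  obtain d m U where U: "poly_bounded U" and d: "computes d m U i" "m \<ge> 1"
    using ptE[OF \<open>pt i\<close>] .
  define k where "k = max n m"
  have k: "k \<ge> 1" and cd: "computes c k T f" "computes d k U i"
    using c d computes_mono unfolding k_def by auto
  obtain p where p: "\<And>x. T x \<le> poly p (tsize x)"
    using T unfolding poly_bounded_def by blast
  let ?w = "While (LeftE (Var 0)) c"
  \<comment> \<open>\<open>?K x\<close> covers one round: the test of a state of size at most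
    \<open>Q x\<close> costs at most \<open>Q x + 2\<close>, the body at most
    \<open>poly p (Q x)\<close>. With \<open>j\<close> rounds left there is one more test at the
    end, hence the factor \<open>j + 1\<close> below.\<close>
  let ?K = "\<lambda>x. Q x + 2 + poly p (Q x)"
  have loop: "\<exists>s'. run ?w s ((j + 1) * ?K x) s' \<and> s' 0 = (f ^^ N x) (i x) \<and> (\<forall>m\<ge>k. s' m = s m)"
    if "j \<le> N x" "s 0 = (f ^^ (N x - j)) (i x)" for j s x
    using that
  proof (induction j arbitrary: s)
    case 0
    then have "run ?w s (eval_cost (LeftE (Var 0)) s + 1) s"
      using stop[of x] by (intro run_WhileFalse) simp
    moreover have "eval_cost (LeftE (Var 0)) s + 1 \<le> (0 + 1) * ?K x"
      using size[of "N x" x] 0 by simp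
    ultimately show ?case
      using run_mono 0 by (metis diff_zero)
  next
    case (Suc j)
    let ?n = "N x - Suc j"
    have n: "?n < N x" "N x - j = Suc ?n" using Suc.prems by auto
    have test: "eval (LeftE (Var 0)) s \<noteq> Leaf" using cont[OF n(1)] Suc.prems by simp
    obtain s1 where s1: "run c s (T (s 0)) s1" "s1 0 = f (s 0)" "\<forall>m\<ge>k. s1 m = s m"
      using cd unfolding computes_def by blast
    have "s1 0 = (f ^^ (N x - j)) (i x)" using s1(2) Suc.prems(2) n(2) by simp
    then obtain s2 where s2: "run ?w s1 ((j + 1) * ?K x) s2" "s2 0 = (f ^^ N x) (i x)"
      "\<forall>m\<ge>k. s2 m = s1 m"
      using Suc.IH[of s1] Suc.prems(1) by auto
    have sz: "tsize (s 0) \<le> Q x" using size[of ?n x] n Suc.prems by simp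
    have "T (s 0) \<le> poly p (Q x)" using p[of "s 0"] poly_nat_mono[OF sz, of p] by linarith
    then have "eval_cost (LeftE (Var 0)) s + 1 + T (s 0) + (j + 1) * ?K x \<le> (Suc j + 1) * ?K x"
      using sz by simp
    then have "run ?w s ((Suc j + 1) * ?K x) s2"
      using run_mono[OF run_WhileTrue[OF test s1(1) s2(1)]] by blast
    then show ?case using s1(3) s2 by auto
  qed
  let ?T = "\<lambda>x. U x + (Q x + 1) * ?K x"
  have "computes (Seq d ?w) k ?T (\<lambda>x. (f ^^ N x) (i x))"
    unfolding computes_def
  proof
    fix s :: store
    let ?x = "s 0"
    obtain s1 where s1: "run d s (U ?x) s1" "s1 0 = i ?x" "\<forall>m\<ge>k. s1 m = s m"
      using cd unfolding computes_def by blast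
    obtain s2 where s2: "run ?w s1 ((N ?x + 1) * ?K ?x) s2" "s2 0 = (f ^^ N ?x) (i ?x)"
      "\<forall>m\<ge>k. s2 m = s1 m"
      using loop[of "N ?x" ?x s1] s1 by auto
    have "(N ?x + 1) * ?K ?x \<le> (Q ?x + 1) * ?K ?x"
      using N[of ?x] by (intro mult_le_mono) auto
    then have "run (Seq d ?w) s (?T ?x) s2"
      using run_mono[OF run_Seq[OF s1(1) s2(1)]] by simp
    then show "\<exists>s'. run (Seq d ?w) s (?T ?x) s' \<and> s' 0 = (f ^^ N ?x) (i ?x) \<and> (\<forall>m\<ge>k. s' m = s m)"
      using s1(3) s2 by auto
  qed
  moreover have "poly_bounded ?T"
    using T U assms(3) by (intro poly_bounded_intros poly_bounded_poly)
  ultimately show ?thesis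
    using k by (intro ptI[of _ k])
qed

text \<open>A tree is read as the list of the left subtrees along its right spine.\<close>

primrec tlist :: "tree \<Rightarrow> tree list" where
  "tlist Leaf = []"
| "tlist (Node l r) = l # tlist r"

primrec ttree :: "tree list \<Rightarrow> tree" where
  "ttree [] = Leaf"
| "ttree (x # xs) = Node x (ttree xs)"

lemma tlist_ttree [simp]: "tlist (ttree xs) = xs"
  by (induction xs) auto

lemma ttree_tlist [simp]: "ttree (tlist t) = t"
  by (induction t) auto

lemma ttree_eq_iff [simp]: "ttree xs = ttree ys \<longleftrightarrow> xs = ys"
  by (metis tlist_ttree)

lemma length_tlist_le: "length (tlist t) \<le> tsize t"
  by (induction t) auto

lemma tsize_in_tlist: "e \<in> set (tlist t) \<Longrightarrow> tsize e \<le> tsize t"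
  by (induction t) auto

lemma tsize_ttree: "tsize (ttree xs) = 1 + (\<Sum>x\<leftarrow>xs. tsize x + 1)"
  by (induction xs) auto

lemma tsize_drop_le: "tsize (ttree (drop n xs)) \<le> tsize (ttree xs)"
proof -
  have "tsize (ttree xs) = tsize (ttree (take n xs @ drop n xs))" by simp
  then show ?thesis unfolding tsize_ttree by (simp del: append_take_drop_id)
qed

section \<open>Polynomial-time predicates, lists and bounded quantifiers\<close>

definition ptb :: "(tree \<Rightarrow> bool) \<Rightarrow> bool" where
  "ptb P \<longleftrightarrow> pt (\<lambda>x. enc_bool (P x))"

definition ptl :: "(tree \<Rightarrow> tree list) \<Rightarrow> bool" where
  "ptl L \<longleftrightarrow> pt (\<lambda>x. ttree (L x))"

lemma pt_ttree: "ptl L \<Longrightarrow> pt (\<lambda>x. ttree (L x))"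
  by (simp add: ptl_def)

lemma ptl_tlist: "pt f \<Longrightarrow> ptl (\<lambda>x. tlist (f x))"
  by (simp add: ptl_def)

lemma enc_bool_neq_Leaf [simp]: "enc_bool b \<noteq> Leaf \<longleftrightarrow> b" "enc_bool b = Leaf \<longleftrightarrow> \<not> b"
  by (cases b; simp)+

lemma pt_if: "ptb P \<Longrightarrow> pt f \<Longrightarrow> pt g \<Longrightarrow> pt (\<lambda>x. if P x then f x else g x)"
  using pt_If[of "\<lambda>x. enc_bool (P x)" f g] by (simp add: ptb_def)

lemma ptl_if: "ptb P \<Longrightarrow> ptl f \<Longrightarrow> ptl g \<Longrightarrow> ptl (\<lambda>x. if P x then f x else g x)"
  using pt_if[of P "\<lambda>x. ttree (f x)" "\<lambda>x. ttree (g x)"] by (simp add: ptl_def if_distrib[of ttree])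

lemma ptb_const: "ptb (\<lambda>x. b)"
  by (simp add: ptb_def pt_const)

lemma ptb_not:
  assumes "ptb P"
  shows "ptb (\<lambda>x. \<not> P x)"
proof -
  have "(\<lambda>x. enc_bool (\<not> P x)) = (\<lambda>x. if P x then Leaf else Node Leaf Leaf)"
    by auto
  then show ?thesis
    using pt_if[OF assms pt_const[of Leaf] pt_const[of "Node Leaf Leaf"]] by (simp add: ptb_def)
qed

lemma ptb_conj: "ptb P \<Longrightarrow> ptb Q \<Longrightarrow> ptb (\<lambda>x. P x \<and> Q x)"
proof -
  assume "ptb P" "ptb Q"
  then have "pt (\<lambda>x. if P x then enc_bool (Q x) else enc_bool False)"
    using pt_if[of P "\<lambda>x. enc_bool (Q x)" "\<lambda>x. enc_bool False"] pt_const unfolding ptb_def by simp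
  moreover have "(if P x then enc_bool (Q x) else enc_bool False) = enc_bool (P x \<and> Q x)" for x
    by simp
  ultimately show ?thesis by (simp add: ptb_def)
qed

lemma ptb_disj: "ptb P \<Longrightarrow> ptb Q \<Longrightarrow> ptb (\<lambda>x. P x \<or> Q x)"
  using ptb_not[OF ptb_conj[OF ptb_not[of P] ptb_not[of Q]]] by simp

lemma ptb_imp: "ptb P \<Longrightarrow> ptb Q \<Longrightarrow> ptb (\<lambda>x. P x \<longrightarrow> Q x)"
  unfolding imp_conv_disj by (intro ptb_disj ptb_not)

lemma ptb_eq:
  assumes "pt f" "pt g"
  shows "ptb (\<lambda>x. f x = g x)"
proof -
  have "pt (\<lambda>x. enc_bool (left x = right x))"
    by (rule pt_expr[of "EqE (LeftE (Var 0)) (RightE (Var 0))" _ "\<lambda>x. (tsize x + 1) + (tsize x + 1) + 1"])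
      (auto intro!: poly_bounded_intros)
  from pt_comp[OF this pt_Node[OF assms]] show ?thesis by (simp add: ptb_def)
qed

lemma poly_bounded_length: "ptl L \<Longrightarrow> poly_bounded (\<lambda>x. length (L x))"
  by (rule poly_bounded_le[OF poly_bounded_pt[of "\<lambda>x. ttree (L x)"]])
    (use length_tlist_le[of "ttree _"] in \<open>auto simp: ptl_def\<close>)

text \<open>The loop state is \<open>Node rest (Node x acc)\<close>. Its left half, the remaining
  list, is \<open>Leaf\<close> exactly at the end, and \<open>x\<close> is carried along because
  \<open>g\<close> depends on it. Several arguments are passed as nested pairs:
  \<open>g x a e\<close> is computed from \<open>Node (Node x a) e\<close>.\<close>

lemma pt_foldl:
  assumes L: "ptl L" and i: "pt i" and Q: "poly_bounded Q"
    and g: "pt (\<lambda>z. g (left (left z)) (right (left z)) (right z))"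
    and size: "\<And>x n. n \<le> length (L x) \<Longrightarrow> tsize (foldl (g x) (i x) (take n (L x))) \<le> Q x"
  shows "pt (\<lambda>x. foldl (g x) (i x) (L x))"
proof -
  let ?i = "\<lambda>x. Node (ttree (L x)) (Node x (i x))"
  let ?f = "\<lambda>st. Node (right (left st)) (Node (left (right st))
    (g (left (right st)) (right (right st)) (left (left st))))"
  have f: "pt ?f"
  proof -
    have "pt (\<lambda>st. (\<lambda>z. g (left (left z)) (right (left z)) (right z))
      (Node (Node (left (right st)) (right (right st))) (left (left st))))"
      by (rule pt_comp[OF g]) (intro pt_Node pt_left pt_right pt_id)
    then show ?thesis by (intro pt_Node pt_left pt_right pt_id) simp
  qed
  have st: "(?f ^^ n) (?i x) = Node (ttree (drop n (L x))) (Node x (foldl (g x) (i x) (take n (L x))))"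
    if "n \<le> length (L x)" for n x
    using that
  proof (induction n)
    case (Suc n)
    then have n: "n < length (L x)" by simp
    show ?case
      using Suc n by (simp add: take_Suc_conv_app_nth Cons_nth_drop_Suc[symmetric])
  qed simp
  let ?Q = "\<lambda>x. (tsize (ttree (L x)) + (tsize x + Q x + 1) + 1)"
  have "pt (\<lambda>x. (?f ^^ length (L x)) (?i x))"
  proof (rule pt_while[where Q = ?Q])
    show "pt ?i" using L i by (intro pt_Node pt_id) (auto simp: ptl_def)
    show "poly_bounded ?Q"
      using L Q unfolding ptl_def by (intro poly_bounded_intros poly_bounded_pt)
    show "length (L x) \<le> ?Q x" for x
      using length_tlist_le[of "ttree (L x)"] by simp
    show "tsize ((?f ^^ n) (?i x)) \<le> ?Q x" if "n \<le> length (L x)" for x n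
      using st[OF that] size[OF that] tsize_drop_le[of n "L x"] by simp
    show "left ((?f ^^ n) (?i x)) \<noteq> Leaf" if "n < length (L x)" for x n
      using st[of n x] that by (simp add: Cons_nth_drop_Suc[symmetric])
    show "left ((?f ^^ length (L x)) (?i x)) = Leaf" for x
      using st[of "length (L x)" x] by simp
  qed (rule f)
  then have "pt (\<lambda>x. right (right ((?f ^^ length (L x)) (?i x))))"
    by (intro pt_right)
  then show ?thesis using st[OF order_refl] by simp
qed

text \<open>Growth by at most \<open>Q x\<close> per round, over polynomially many rounds, stays
  polynomial; growth by a constant factor would not.\<close>

lemma pt_foldl_additive:
  assumes L: "ptl L" and i: "pt i" and Q: "poly_bounded Q"
    and g: "pt (\<lambda>z. g (left (left z)) (right (left z)) (right z))"
    and size: "\<And>x a e. e \<in> set (L x) \<Longrightarrow> tsize (g x a e) \<le> tsize a + Q x"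
  shows "pt (\<lambda>x. foldl (g x) (i x) (L x))"
proof (rule pt_foldl[OF L i _ g])
  let ?Q = "\<lambda>x. tsize (i x) + length (L x) * Q x"
  show "poly_bounded ?Q"
    using i Q L by (intro poly_bounded_intros poly_bounded_pt poly_bounded_length)
  show "tsize (foldl (g x) (i x) (take n (L x))) \<le> ?Q x" if "n \<le> length (L x)" for x n
  proof -
    have "tsize (foldl (g x) a es) \<le> tsize a + length es * Q x" if "set es \<subseteq> set (L x)" for a es
      using that
    proof (induction es arbitrary: a)
      case (Cons e es)
      have "tsize (foldl (g x) (g x a e) es) \<le> tsize (g x a e) + length es * Q x"
        using Cons by simp
      then show ?case using size[of e x a] Cons.prems by simp
    qed simp
    from this[of "take n (L x)" "i x"] have
      "tsize (foldl (g x) (i x) (take n (L x))) \<le> tsize (i x) + n * Q x"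
      using that set_take_subset[of n "L x"] by (simp add: min_absorb2)
    also have "\<dots> \<le> ?Q x" using that by simp
    finally show ?thesis .
  qed
qed

lemma ptl_comp: "ptl L \<Longrightarrow> pt f \<Longrightarrow> ptl (\<lambda>x. L (f x))"
  unfolding ptl_def by (rule pt_comp)

lemma ptb_comp: "ptb P \<Longrightarrow> pt f \<Longrightarrow> ptb (\<lambda>x. P (f x))"
  unfolding ptb_def by (rule pt_comp[of "\<lambda>x. enc_bool (P x)"])

text \<open>Consing onto an accumulator reverses the list; \<open>ptl_map\<close> repairs this by a
  second reversal. The body of the map is a function of the pair \<open>Node x e\<close>, so nested
  binders see nested pairs as their input.\<close>

lemma ptl_rev_map:
  assumes L: "ptl L" and f: "pt (\<lambda>z. f (left z) (right z))"
  shows "ptl (\<lambda>x. rev (map (f x) (L x)))"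
proof -
  let ?f = "\<lambda>z. f (left z) (right z)"
  obtain p where p: "\<And>x e. tsize (f x e) \<le> poly p (tsize x + tsize e + 1)"
    using poly_bounded_pt[OF f] unfolding poly_bounded_def
    by (metis left.simps(2) right.simps(2) tsize.simps(2))
  let ?Q = "\<lambda>x. poly p (tsize x + tsize (ttree (L x)) + 1) + 1"
  have "pt (\<lambda>x. foldl (\<lambda>a e. Node (f x e) a) Leaf (L x))"
  proof (rule pt_foldl_additive[OF L, where Q = ?Q])
    show "poly_bounded ?Q"
      using L unfolding ptl_def by (intro poly_bounded_intros poly_bounded_poly poly_bounded_pt)
    have "pt (\<lambda>z. ?f (Node (left (left z)) (right z)))"
      by (rule pt_comp[OF f]) (intro pt_Node pt_left pt_right pt_id)
    then show "pt (\<lambda>z. Node (f (left (left z)) (right z)) (right (left z)))"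
      by (intro pt_Node pt_left pt_right pt_id) simp
    show "tsize (Node (f x e) a) \<le> tsize a + ?Q x" if "e \<in> set (L x)" for x a e
    proof -
      have "tsize e \<le> tsize (ttree (L x))" using that tsize_in_tlist[of e "ttree (L x)"] by simp
      then have "poly p (tsize x + tsize e + 1) \<le> poly p (tsize x + tsize (ttree (L x)) + 1)"
        by (intro poly_nat_mono) simp
      then show ?thesis using p[of x e] by simp
    qed
  qed (rule pt_const)
  moreover have "foldl (\<lambda>a e. Node (h e) a) (ttree ys) xs = ttree (rev (map h xs) @ ys)" for h xs ys
  proof (induction xs arbitrary: ys)
    case (Cons a xs)
    then show ?case using Cons[of "h a # ys"] by simp
  qed simp
  from this[of _ "[]"] have "foldl (\<lambda>a e. Node (f x e) a) Leaf (L x) = ttree (rev (map (f x) (L x)))" for x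
    by simp
  ultimately show ?thesis by (simp add: ptl_def)
qed

lemma ptl_rev: "ptl L \<Longrightarrow> ptl (\<lambda>x. rev (L x))"
  using ptl_rev_map[of L "\<lambda>x e. e"] by (simp add: pt_right pt_id)

lemma ptl_map: "ptl L \<Longrightarrow> pt (\<lambda>z. f (left z) (right z)) \<Longrightarrow> ptl (\<lambda>x. map (\<lambda>e. f x e) (L x))"
  using ptl_rev[OF ptl_rev_map[of L f]] by simp

lemma ptl_append:
  assumes "ptl K" and "ptl L"
  shows "ptl (\<lambda>x. K x @ L x)"
proof -
  let ?Q = "\<lambda>x. tsize (ttree (K x)) + 1"
  have "pt (\<lambda>x. foldl (\<lambda>a e. Node e a) (ttree (L x)) (rev (K x)))"
  proof (rule pt_foldl_additive[where Q = ?Q])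
    show "ptl (\<lambda>x. rev (K x))" by (rule ptl_rev[OF assms(1)])
    show "pt (\<lambda>x. ttree (L x))" by (rule pt_ttree[OF assms(2)])
    show "poly_bounded ?Q"
      using assms unfolding ptl_def by (intro poly_bounded_intros poly_bounded_pt)
    show "pt (\<lambda>z. Node (right z) (right (left z)))" by (intro pt_Node pt_left pt_right pt_id)
    show "tsize (Node e a) \<le> tsize a + ?Q x" if "e \<in> set (rev (K x))" for x a e
      using that tsize_in_tlist[of e "ttree (K x)"] by simp
  qed
  moreover have "foldl (\<lambda>a e. Node e a) (ttree ys) xs = ttree (rev xs @ ys)" for xs ys
  proof (induction xs arbitrary: ys)
    case (Cons a xs)
    then show ?case using Cons[of "a # ys"] by simp
  qed simp
  ultimately show ?thesis by (simp add: ptl_def)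
qed

lemma ptl_Nil: "ptl (\<lambda>x. [])"
  by (simp add: ptl_def pt_const)

lemma ptl_Cons: "pt f \<Longrightarrow> ptl L \<Longrightarrow> ptl (\<lambda>x. f x # L x)"
  by (simp add: ptl_def pt_Node)

lemma ptl_concat_map:
  assumes L: "ptl L" and f: "ptl (\<lambda>z. f (left z) (right z))"
  shows "ptl (\<lambda>x. concat (map (\<lambda>e. f x e) (L x)))"
proof -
  obtain p where p: "\<And>x e. tsize (ttree (f x e)) \<le> poly p (tsize x + tsize e + 1)"
    using poly_bounded_pt[OF pt_ttree[OF f]] unfolding poly_bounded_def
    by (metis left.simps(2) right.simps(2) tsize.simps(2))
  let ?Q = "\<lambda>x. poly p (tsize x + tsize (ttree (L x)) + 1)"
  have app: "tsize (ttree (xs @ ys)) \<le> tsize (ttree xs) + tsize (ttree ys)" for xs ys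
    by (simp add: tsize_ttree)
  \<comment> \<open>Blocks are prepended while the list is traversed backwards, which leaves them in
    the original order.\<close>
  have "pt (\<lambda>x. foldl (\<lambda>a e. ttree (f x e @ tlist a)) Leaf (rev (L x)))"
  proof (rule pt_foldl_additive[where Q = ?Q])
    show "ptl (\<lambda>x. rev (L x))" by (rule ptl_rev[OF L])
    show "poly_bounded ?Q"
      using L unfolding ptl_def by (intro poly_bounded_intros poly_bounded_poly poly_bounded_pt)
    have "ptl (\<lambda>z. (\<lambda>z. f (left z) (right z)) (Node (left (left z)) (right z)))"
      by (rule ptl_comp[OF f]) (intro pt_Node pt_left pt_right pt_id)
    then show "pt (\<lambda>z. ttree (f (left (left z)) (right z) @ tlist (right (left z))))"
      by (intro pt_ttree ptl_append ptl_tlist pt_left pt_right pt_id) simp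
    show "tsize (ttree (f x e @ tlist a)) \<le> tsize a + ?Q x" if "e \<in> set (rev (L x))" for x a e
    proof -
      have "tsize e \<le> tsize (ttree (L x))" using that tsize_in_tlist[of e "ttree (L x)"] by simp
      then have "poly p (tsize x + tsize e + 1) \<le> poly p (tsize x + tsize (ttree (L x)) + 1)"
        by (intro poly_nat_mono) simp
      then show ?thesis using p[of x e] app[of "f x e" "tlist a"] by simp
    qed
  qed (rule pt_const)
  moreover have "foldl (\<lambda>a e. ttree (h e @ tlist a)) (ttree ys) xs = ttree (concat (map h (rev xs)) @ ys)"
    for h xs ys
  proof (induction xs arbitrary: ys)
    case (Cons a xs)
    then show ?case using Cons[of "h a @ ys"] by simp
  qed simp
  from this[of _ "[]"] have
    "foldl (\<lambda>a e. ttree (f x e @ tlist a)) Leaf (rev (L x)) = ttree (concat (map (f x) (L x)))" for x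
    by (metis append_Nil2 rev_rev_ident ttree.simps(1))
  ultimately show ?thesis by (simp add: ptl_def)
qed

lemma ptl_filter:
  assumes "ptl L" and "ptb (\<lambda>z. P (left z) (right z))"
  shows "ptl (\<lambda>x. filter (\<lambda>e. P x e) (L x))"
proof -
  have "ptl (\<lambda>x. concat (map (\<lambda>e. if P x e then [e] else []) (L x)))"
    by (intro ptl_concat_map ptl_if ptl_Cons ptl_Nil pt_right pt_id assms)
  moreover have "concat (map (\<lambda>e. if Q e then [e] else []) xs) = filter Q xs" for Q and xs :: "tree list"
    by (induction xs) auto
  ultimately show ?thesis by simp
qed

lemma ptb_bex:
  assumes "ptl L" and "ptb (\<lambda>z. P (left z) (right z))"
  shows "ptb (\<lambda>x. \<exists>e\<in>set (L x). P x e)"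
proof -
  have "ptb (\<lambda>x. \<not> ttree (filter (\<lambda>e. P x e) (L x)) = ttree [])"
    by (intro ptb_not ptb_eq pt_ttree ptl_filter ptl_Nil assms)
  then show ?thesis by (simp only: ttree_eq_iff filter_empty_conv) simp
qed

lemma ptb_ball:
  assumes "ptl L" and "ptb (\<lambda>z. P (left z) (right z))"
  shows "ptb (\<lambda>x. \<forall>e\<in>set (L x). P x e)"
  using ptb_not[OF ptb_bex[OF assms(1), of "\<lambda>x e. \<not> P x e"]] ptb_not[OF assms(2)] by simp

lemma ptb_mem: "pt f \<Longrightarrow> ptl L \<Longrightarrow> ptb (\<lambda>x. f x \<in> set (L x))"
proof -
  assume "pt f" "ptl L"
  then have "ptb (\<lambda>x. \<exists>e\<in>set (L x). e = f x)"
    by (intro ptb_bex ptb_eq pt_comp[OF \<open>pt f\<close>] pt_left pt_right pt_id)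
  then show ?thesis by simp
qed

lemma ptb_subset:
  assumes "ptl K" and "ptl L"
  shows "ptb (\<lambda>x. set (K x) \<subseteq> set (L x))"
  unfolding subset_eq by (intro ptb_ball ptb_mem ptl_comp[OF assms(2)] assms(1) pt_left pt_right pt_id)

lemma ptb_set_eq: "ptl K \<Longrightarrow> ptl L \<Longrightarrow> ptb (\<lambda>x. set (K x) = set (L x))"
  unfolding set_eq_subset by (intro ptb_conj ptb_subset)

text \<open>Applied backwards, these rules follow the syntax of a definition built from maps,
  filters and bounded quantifiers, so most of the functions below need no program of their
  own.\<close>

lemmas pt_intros = pt_id pt_const pt_left pt_right pt_Node pt_ttree pt_if
  ptl_tlist ptl_if ptl_append ptl_Nil ptl_Cons ptl_map ptl_filter ptl_concat_map
  ptb_const ptb_not ptb_conj ptb_disj ptb_imp ptb_eq ptb_bex ptb_ball ptb_mem ptb_subset ptb_set_eq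

text \<open>Only the length of \<open>C x\<close> matters: it is a clock, in unary. The accumulator
  is the current iterate together with all earlier ones in reverse order, and \<open>size\<close>
  again rules out growth under iteration.\<close>

lemma ptl_iterates:
  assumes f: "pt f" and i: "pt i" and C: "ptl C" and Q: "poly_bounded Q"
    and size: "\<And>x n. n \<le> length (C x) \<Longrightarrow> tsize ((f ^^ n) (i x)) \<le> Q x"
  shows "ptl (\<lambda>x. map (\<lambda>n. (f ^^ n) (i x)) [0..<length (C x)])"
proof -
  let ?g = "\<lambda>x a e. Node (f (left a)) (Node (left a) (right a))"
  have st: "foldl (?g x) (Node (i x) Leaf) es =
      Node ((f ^^ length es) (i x)) (ttree (rev (map (\<lambda>n. (f ^^ n) (i x)) [0..<length es])))" for x and es :: "tree list"
    by (induction es rule: rev_induct) auto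
  let ?Q = "\<lambda>x. (Q x + (1 + length (C x) * (Q x + 1)) + 1)"
  have "pt (\<lambda>x. foldl (?g x) (Node (i x) Leaf) (C x))"
  proof (rule pt_foldl[OF C, where Q = ?Q])
    show "poly_bounded ?Q" using C Q by (intro poly_bounded_intros poly_bounded_length)
    show "pt (\<lambda>z. Node (f (left (right (left z)))) (Node (left (right (left z))) (right (right (left z)))))"
      by (intro pt_intros pt_comp[OF f])
    show "tsize (foldl (?g x) (Node (i x) Leaf) (take n (C x))) \<le> ?Q x" if n: "n \<le> length (C x)" for x n
    proof -
      have "(\<Sum>m\<leftarrow>rev (map (\<lambda>n. (f ^^ n) (i x)) [0..<n]). tsize m + 1) \<le> n * (Q x + 1)"
        using sum_list_mono[of "[0..<n]" "\<lambda>m. tsize ((f ^^ m) (i x)) + 1" "\<lambda>m. Q x + 1"] size[of _ x] n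
        by (simp add: rev_map[symmetric] sum_list_rev sum_list_triv comp_def del: sum_list_Suc)
      also have "\<dots> \<le> length (C x) * (Q x + 1)" using n by (intro mult_le_mono) auto
      finally show ?thesis
        using size[OF n] n unfolding st by (simp add: tsize_ttree min_absorb2)
    qed
  qed (intro pt_intros i)
  then have "ptl (\<lambda>x. rev (tlist (right (foldl (?g x) (Node (i x) Leaf) (C x)))))"
    by (intro ptl_rev pt_intros)
  then show ?thesis by (simp add: st)
qed

text \<open>Traversing the tree with a stack takes exactly \<open>tsize\<close> steps.\<close>

lemma ptl_clock: "ptl (\<lambda>x. replicate (tsize x) Leaf)"
proof -
  let ?f = "\<lambda>st. Node (if left (left st) = Leaf then right (left st)
      else Node (left (left (left st))) (Node (right (left (left st))) (right (left st))))
    (Node Leaf (right st))"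
  let ?i = "\<lambda>x. Node (Node x Leaf) Leaf"
  \<comment> \<open>The weight of the stack drops by exactly one per round: popping a leaf removes
    its weight 1, and replacing a node by its two subtrees removes the 1 counted for the node
    itself.\<close>
  let ?m = "\<lambda>w. \<Sum>h\<leftarrow>tlist w. tsize h"
  have st: "?m (left ((?f ^^ n) (?i x))) + n = tsize x \<and> right ((?f ^^ n) (?i x)) = ttree (replicate n Leaf)"
    if "n \<le> tsize x" for n x
    using that
  proof (induction n)
    case (Suc n)
    let ?s = "(?f ^^ n) (?i x)"
    have IH: "?m (left ?s) + n = tsize x" "right ?s = ttree (replicate n Leaf)" using Suc by auto
    then have "left ?s \<noteq> Leaf" using Suc.prems by auto
    then obtain h r where hr: "left ?s = Node h r" by (cases "left ?s") auto
    show ?case using IH hr by (cases h) auto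
  qed simp
  have m: "tsize w \<le> 1 + 2 * ?m w" for w
  proof (induction w)
    case (Node l r)
    then show ?case using tsize_pos[of l] by simp
  qed simp
  have m0: "w = Leaf \<longleftrightarrow> ?m w = 0" for w
  proof (cases w)
    case (Node l r)
    then show ?thesis using tsize_pos[of l] by simp
  qed simp
  let ?Q = "\<lambda>x. (1 + 2 * tsize x) + (1 + 2 * tsize x) + 1"
  have "pt (\<lambda>x. (?f ^^ tsize x) (?i x))"
  proof (rule pt_while[where Q = ?Q])
    show "pt ?f" by (intro pt_intros)
    show "pt ?i" by (intro pt_intros)
    show "poly_bounded ?Q" by (intro poly_bounded_intros)
    show "tsize x \<le> ?Q x" for x by simp
    show "tsize ((?f ^^ n) (?i x)) \<le> ?Q x" if "n \<le> tsize x" for x n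
    proof -
      have t: "tsize t \<le> tsize (left t) + tsize (right t) + 1" for t by (cases t) auto
      have "tsize (ttree (replicate n Leaf)) \<le> 1 + 2 * tsize x"
        using that by (simp add: tsize_ttree sum_list_replicate)
      moreover have "tsize (left ((?f ^^ n) (?i x))) \<le> 1 + 2 * tsize x"
        using m[of "left ((?f ^^ n) (?i x))"] st[OF that] by linarith
      ultimately show ?thesis using st[OF that] t[of "(?f ^^ n) (?i x)"] by simp
    qed
    show "left ((?f ^^ n) (?i x)) \<noteq> Leaf" if "n < tsize x" for x n
      using st[of n x] that m0[THEN iffD1, of "left ((?f ^^ n) (?i x))"] by linarith
    show "left ((?f ^^ tsize x) (?i x)) = Leaf" for x
      using st[of "tsize x" x] m0[THEN iffD2, of "left ((?f ^^ tsize x) (?i x))"] by linarith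
  qed
  then have "pt (\<lambda>x. right ((?f ^^ tsize x) (?i x)))" by (intro pt_right)
  then show ?thesis using st[OF order_refl] by (simp add: ptl_def)
qed

section \<open>Judgement proofs one variable at a time\<close>

text \<open>The structure does not occur here, because which variable sets carry judgements does not
  depend on the relations. \<open>avail_add\<close> is a join with a singleton.
  \<forall>-elimination needs no rule of its own: dropping the variable at the child and flowing up
  yields the same set.\<close>

inductive avail :: "nat \<Rightarrow> ('v, 's, 'r) qc \<Rightarrow> index \<Rightarrow> ('v, 's) var set \<Rightarrow> bool"
  for k :: nat and \<phi> :: "('v, 's, 'r) qc" where
  avail_atom: "\<lbrakk>i \<in> indices \<phi>; subf \<phi> i = Atom R vs; card (set vs) \<le> k\<rbrakk> \<Longrightarrow> avail k \<phi> i (set vs)"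
| avail_drop: "avail k \<phi> i (insert y V) \<Longrightarrow> avail k \<phi> i V"
| avail_add: "\<lbrakk>avail k \<phi> i V; avail k \<phi> i {y}; card (insert y V) \<le> k\<rbrakk> \<Longrightarrow> avail k \<phi> i (insert y V)"
| avail_up: "\<lbrakk>avail k \<phi> j V; parent \<phi> i j; V \<subseteq> free (subf \<phi> i)\<rbrakk> \<Longrightarrow> avail k \<phi> i V"
| avail_down: "\<lbrakk>avail k \<phi> i V; parent \<phi> i j; V \<subseteq> free (subf \<phi> j)\<rbrakk> \<Longrightarrow> avail k \<phi> j V"

text \<open>The rules are those for judgements, read on complements. In \<open>out_proj\<close> the
  quantifier over values may be vacuous, so that \<open>f\<close> is a map has to be demanded
  separately; in the other non-atomic rules it is inherited. \<open>out_ext\<close> is a join with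
  any judgement on the larger set.\<close>

inductive out ::
  "nat \<Rightarrow> ('v, 's, 'r) qc \<Rightarrow> ('s, 'r, 'b) struct \<Rightarrow> index \<Rightarrow> (('v, 's) var \<rightharpoonup> 'b) \<Rightarrow> bool"
  for k :: nat and \<phi> :: "('v, 's, 'r) qc" and B :: "('s, 'r, 'b) struct" where
  out_atom: "\<lbrakk>i \<in> indices \<phi>; subf \<phi> i = Atom R vs; card (set vs) \<le> k; f \<in> maps B (set vs);
    map (\<lambda>v. the (f v)) vs \<notin> rel B R\<rbrakk> \<Longrightarrow> out k \<phi> B i f"
| out_proj: "\<lbrakk>avail k \<phi> i (insert y (dom f)); y \<notin> dom f; f \<in> maps B (dom f);
    \<forall>b\<in>univ B (sort_of y). out k \<phi> B i (f(y \<mapsto> b))\<rbrakk> \<Longrightarrow> out k \<phi> B i f"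
| out_ext: "\<lbrakk>out k \<phi> B i f; avail k \<phi> i (insert y (dom f)); y \<notin> dom f; b \<in> univ B (sort_of y)\<rbrakk> \<Longrightarrow>
    out k \<phi> B i (f(y \<mapsto> b))"
| out_up: "\<lbrakk>out k \<phi> B j f; parent \<phi> i j; dom f \<subseteq> free (subf \<phi> i)\<rbrakk> \<Longrightarrow> out k \<phi> B i f"
| out_all: "\<lbrakk>out k \<phi> B j (f(y \<mapsto> b)); y \<notin> dom f; subf \<phi> i = Forall y (subf \<phi> j); parent \<phi> i j\<rbrakk> \<Longrightarrow>
    out k \<phi> B i f"
| out_down: "\<lbrakk>out k \<phi> B i f; parent \<phi> i j; dom f \<subseteq> free (subf \<phi> j)\<rbrakk> \<Longrightarrow> out k \<phi> B j f"

text \<open>\<open>subformula\<close> consumes a path from the front, while \<open>parent\<close>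
  extends it at the end; this equation connects the two.\<close>

lemma subformula_snoc:
  "subformula \<phi> (i @ [n]) = (case subformula \<phi> i of None \<Rightarrow> None
     | Some \<psi> \<Rightarrow> if n < length (children \<psi>) then Some (children \<psi> ! n) else None)"
  by (induction \<phi> i rule: subformula.induct) auto

lemma indices_snoc:
  "i @ [n] \<in> indices \<phi> \<longleftrightarrow> i \<in> indices \<phi> \<and> n < length (children (subf \<phi> i))"
  unfolding indices_def subf_def by (auto simp: subformula_snoc split: option.splits if_splits)

lemma subf_snoc: "i @ [n] \<in> indices \<phi> \<Longrightarrow> subf \<phi> (i @ [n]) = children (subf \<phi> i) ! n"
  unfolding indices_def subf_def by (auto simp: subformula_snoc split: option.splits if_splits)

lemma Nil_in_indices [simp]: "[] \<in> indices \<phi>"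
  by (simp add: indices_def)

lemma subf_Nil [simp]: "subf \<phi> [] = \<phi>"
  by (simp add: subf_def)

lemma parent_snoc: "i @ [n] \<in> indices \<phi> \<Longrightarrow> parent \<phi> i (i @ [n])"
  unfolding parent_def using indices_snoc by blast

lemma parent_child: "parent \<phi> i j \<Longrightarrow> subf \<phi> j \<in> set (children (subf \<phi> i))"
  unfolding parent_def by (metis indices_snoc nth_mem subf_snoc)

lemma finite_free: "finite (free \<psi>)"
  by (induction \<psi>) auto

lemma finite_subset_free: "V \<subseteq> free \<psi> \<Longrightarrow> finite V"
  using finite_free finite_subset by metis

lemma avail_facts:
  "avail k \<phi> i V \<Longrightarrow> i \<in> indices \<phi> \<and> V \<subseteq> free (subf \<phi> i) \<and> card V \<le> k"
proof (induction rule: avail.induct)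
  case (avail_drop i y V)
  \<comment> \<open>Since \<open>card\<close> is 0 on infinite sets, the width bound passes to
    subsets only by way of finiteness, which comes from the free variables.\<close>
  have "finite (insert y V)" by (rule finite_subset_free) (use avail_drop in blast)
  then have "card V \<le> card (insert y V)" by (intro card_mono) auto
  then show ?case using avail_drop by auto
next
  case (avail_atom i R vs)
  then show ?case by simp
next
  case (avail_add i V y)
  then show ?case by simp
qed (simp_all add: parent_def)

lemma avail_finite: "avail k \<phi> i V \<Longrightarrow> finite V"
  by (rule finite_subset_free[where \<psi> = "subf \<phi> i"]) (simp add: avail_facts)

lemma maps_updI: "f \<in> maps B V \<Longrightarrow> b \<in> univ B (sort_of y) \<Longrightarrow> f(y \<mapsto> b) \<in> maps B (insert y V)"
  unfolding maps_def by auto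

lemma maps_upd_iff:
  "y \<notin> dom f \<Longrightarrow>
   f(y \<mapsto> b) \<in> maps B (insert y (dom f)) \<longleftrightarrow> f \<in> maps B (dom f) \<and> b \<in> univ B (sort_of y)"
  unfolding maps_def by (auto split: if_splits)

lemma maps_dom: "f \<in> maps B V \<Longrightarrow> dom f = V"
  by (simp add: maps_def)

lemma maps_restrict: "f \<in> maps B V \<Longrightarrow> U \<subseteq> V \<Longrightarrow> f |` U \<in> maps B U"
  unfolding maps_def by (auto simp: dom_def restrict_map_def subset_iff split: if_splits)

lemma avail_subset:
  assumes "avail k \<phi> i V" and "U \<subseteq> V"
  shows "avail k \<phi> i U"
proof -
  have "finite (V - U)" using avail_finite[OF assms(1)] by simp
  moreover have "avail k \<phi> i (U \<union> D) \<Longrightarrow> avail k \<phi> i U" if "finite D" for D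
    using that by (induction D) (auto dest: avail_drop)
  ultimately show ?thesis using assms by (simp add: Un_absorb1)
qed

text \<open>The members of \<open>W\<close> are added one at a time. Each intermediate set lies
  inside \<open>V \<union> W\<close>, so the width bound is never exceeded on the way.\<close>

lemma avail_union:
  assumes "avail k \<phi> i V" and "avail k \<phi> i W" and "card (V \<union> W) \<le> k"
  shows "avail k \<phi> i (V \<union> W)"
proof -
  have fin: "finite V" "finite W" using avail_finite assms by blast+
  have "avail k \<phi> i (V \<union> D)" if "D \<subseteq> W" for D
    using finite_subset[OF that fin(2)] that
  proof (induction D)
    case (insert y D)
    have "avail k \<phi> i {y}" using avail_subset[OF assms(2)] insert.prems by simp
    moreover have "card (insert y (V \<union> D)) \<le> k"
      using card_mono[of "V \<union> W" "insert y (V \<union> D)"] fin insert.prems assms(3) by (auto simp: le_supI2)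
    ultimately show ?case using avail_add insert by simp
  qed (simp add: assms(1))
  then show ?thesis by blast
qed

lemma out_facts: "out k \<phi> B i f \<Longrightarrow> avail k \<phi> i (dom f) \<and> f \<in> maps B (dom f)"
proof (induction rule: out.induct)
  case (out_atom i R vs f)
  then show ?case using avail_atom maps_dom by metis
next
  case (out_proj i y f)
  then show ?case using avail_subset by blast
next
  case (out_ext i f y b)
  then show ?case using maps_updI[of f B "dom f" b y] by (simp del: fun_upd_apply)
next
  case (out_all j f y b i)
  then have "avail k \<phi> j (insert y (dom f))" "f(y \<mapsto> b) \<in> maps B (insert y (dom f))"
    by (simp_all del: fun_upd_apply)
  then have a: "avail k \<phi> j (dom f)" "f \<in> maps B (dom f)"
    using avail_subset[of k \<phi> j "insert y (dom f)"] maps_upd_iff[of y f b B] out_all.hyps by auto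
  then have "dom f \<subseteq> free (subf \<phi> i)"
    using out_all.hyps avail_facts[OF a(1)] by auto
  then show ?case using a avail_up out_all.hyps by blast
qed (auto intro: avail_up avail_down)

text \<open>\<open>D\<close> is the set of variables projected away. The induction generalises
  \<open>f\<close>: \<open>out_proj\<close> reduces \<open>f\<close> to its extensions by one
  variable, and the induction hypothesis treats each of these with one variable fewer to
  remove.\<close>

lemma out_projection:
  assumes "finite D" and "D \<inter> dom f = {}" and "avail k \<phi> i (dom f \<union> D)" and "f \<in> maps B (dom f)"
    and "\<And>g. g \<in> maps B (dom f \<union> D) \<Longrightarrow> g |` dom f = f \<Longrightarrow> out k \<phi> B i g"
  shows "out k \<phi> B i f"
  using assms
proof (induction D arbitrary: f)
  case empty
  have "f |` dom f = f" by (auto simp: restrict_map_def dom_def)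
  then show ?case using empty by simp
next
  case (insert y D)
  have y: "y \<notin> dom f" using insert.prems by auto
  show ?case
  proof (rule out_proj)
    show "avail k \<phi> i (insert y (dom f))"
      by (rule avail_subset[OF insert.prems(2)]) auto
    show "\<forall>b\<in>univ B (sort_of y). out k \<phi> B i (f(y \<mapsto> b))"
    proof
      fix b assume b: "b \<in> univ B (sort_of y)"
      show "out k \<phi> B i (f(y \<mapsto> b))"
      proof (rule insert.IH)
        show "D \<inter> dom (f(y \<mapsto> b)) = {}" using insert by auto
        show "avail k \<phi> i (dom (f(y \<mapsto> b)) \<union> D)" using insert.prems(2) by simp
        show "f(y \<mapsto> b) \<in> maps B (dom (f(y \<mapsto> b)))" using maps_updI[OF insert.prems(3) b] by simp
        fix g assume g: "g \<in> maps B (dom (f(y \<mapsto> b)) \<union> D)" "g |` dom (f(y \<mapsto> b)) = f(y \<mapsto> b)"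
        have "g |` dom f = (g |` dom (f(y \<mapsto> b))) |` dom f" by (simp add: inf.absorb2 subset_insertI)
        also have "\<dots> = f" using y unfolding g(2) by (auto simp: restrict_map_def fun_eq_iff dom_def)
        finally have "g |` dom f = f" .
        then show "out k \<phi> B i g" using insert.prems(4) g(1) by simp
      qed
    qed
  qed (use insert.prems y in auto)
qed

text \<open>A judgement that excludes a restriction of \<open>f\<close> excludes \<open>f\<close>
  after a join. The missing variables are put back one by one with \<open>out_ext\<close>, and
  availability of the intermediate domains follows from that of \<open>dom f\<close>.\<close>

lemma out_restrict:
  assumes "out k \<phi> B i (f |` U)" and "avail k \<phi> i (dom f)" and "f \<in> maps B (dom f)"
  shows "out k \<phi> B i f"
proof -
  have "out k \<phi> B i (f |` (dom f \<inter> U \<union> D))" if "finite D" "D \<subseteq> dom f - U" for D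
    using that
  proof (induction D)
    case empty
    have "f |` (dom f \<inter> U) = f |` U" by (auto simp: restrict_map_def dom_def)
    then show ?case using assms(1) by simp
  next
    case (insert y D)
    let ?g = "f |` (dom f \<inter> U \<union> D)"
    have dom: "dom ?g = dom f \<inter> U \<union> D" using insert.prems by auto
    obtain b where b: "f y = Some b" using insert.prems by blast
    have "out k \<phi> B i (?g(y \<mapsto> b))"
    proof (rule out_ext)
      show "out k \<phi> B i ?g" using insert by simp
      show "avail k \<phi> i (insert y (dom ?g))"
        unfolding dom using insert.prems by (intro avail_subset[OF assms(2)]) auto
      show "y \<notin> dom ?g" using dom insert by auto
      show "b \<in> univ B (sort_of y)" using assms(3) b unfolding maps_def by force
    qed
    moreover have "?g(y \<mapsto> b) = f |` (dom f \<inter> U \<union> insert y D)"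
      using b by (auto simp: restrict_map_def fun_eq_iff)
    ultimately show ?case by simp
  qed
  from this[of "dom f - U"] have "out k \<phi> B i (f |` dom f)"
    using avail_finite[OF assms(2)] by (simp add: Int_Diff_Un)
  moreover have "f |` dom f = f" by (auto simp: restrict_map_def dom_def)
  ultimately show ?thesis by simp
qed

text \<open>The empty domain is contained in every set of free variables, so nothing blocks the
  upward flow.\<close>

lemma out_root: "out k \<phi> B i Map.empty \<Longrightarrow> out k \<phi> B [] Map.empty"
proof (induction i rule: rev_induct)
  case (snoc n i)
  then have "i @ [n] \<in> indices \<phi>" using out_facts avail_facts by blast
  then have "out k \<phi> B i Map.empty" using snoc.prems out_up[OF _ parent_snoc] by fastforce
  then show ?case by (rule snoc.IH)
qed

section \<open>Proofs of bounded width yield only available sets and excluded maps\<close>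

lemma width_le_proof_width: "J \<in> set Js \<Longrightarrow> width J \<le> proof_width Js"
  unfolding proof_width_def by (intro Max_ge) auto

lemma judgement_proof_out:
  assumes "judgement_proof \<phi> B Js" and "proof_width Js \<le> k" and "(i, V, F) \<in> set Js"
  shows "avail k \<phi> i V \<and> (\<forall>f\<in>maps B V - F. out k \<phi> B i f)"
proof -
  have "avail k \<phi> i V \<and> (\<forall>f\<in>maps B V - F. out k \<phi> B i f)"
    if "n < length Js" "Js ! n = (i, V, F)" for n i V F
    using that
  proof (induction n arbitrary: i V F rule: less_induct)
    case (less n)
    have IH: "avail k \<phi> j W \<and> (\<forall>f\<in>maps B W - G. out k \<phi> B j f)" if "(j, W, G) \<in> set (take n Js)" for j W G
      using that less.IH less.prems by (auto simp: in_set_conv_nth)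
    have judg: "i \<in> indices \<phi>" "V \<subseteq> free (subf \<phi> i)" "F \<subseteq> maps B V"
      using assms(1) less.prems unfolding judgement_proof_def by (metis is_judgement.simps)+
    have w: "card V \<le> k"
      using width_le_proof_width[of "(i, V, F)" Js] less.prems assms(2) nth_mem by fastforce
    have "derives \<phi> B (set (take n Js)) (i, V, F)"
      using assms(1) less.prems unfolding judgement_proof_def by metis
    then show ?case
    proof cases
      case (atom R vs)
      then show ?thesis using avail_atom out_atom w by fastforce
    next
      case (projection W G)
      note IHW = IH[OF projection(2)]
      have av: "avail k \<phi> i V" using IHW avail_subset projection by blast
      have "finite W" using avail_finite IHW by blast
      moreover have "out k \<phi> B i f" if f: "f \<in> maps B V - F" for f
      proof (rule out_projection[of "W - V"])
        have d: "dom f = V" using f maps_dom by blast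
        have VW: "V \<union> (W - V) = W" using projection by blast
        show "avail k \<phi> i (dom f \<union> (W - V))" using IHW d VW by simp
        show "f \<in> maps B (dom f)" using f d by simp
        fix g assume g: "g \<in> maps B (dom f \<union> (W - V))" "g |` dom f = f"
        \<comment> \<open>A map outside the projection is the restriction of no map in
          \<open>G\<close>, so all of its extensions are outside \<open>G\<close>.\<close>
        then have "g \<notin> G" using f projection d unfolding restrict_maps_def by auto
        then show "out k \<phi> B i g" using IHW g d VW by auto
      qed (use \<open>finite W\<close> f maps_dom in auto)
      ultimately show ?thesis using av by blast
    next
      case (join U1 F1 U2 F2)
      have av: "avail k \<phi> i V" using IH join avail_union w by metis
      moreover have "out k \<phi> B i f" if f: "f \<in> maps B V - F" for f
      proof -
        have d: "dom f = V" using f maps_dom by blast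
        have "f |` U1 \<in> maps B U1" "f |` U2 \<in> maps B U2"
          using maps_restrict f join by blast+
        moreover have "f |` U1 \<notin> F1 \<or> f |` U2 \<notin> F2"
          using f join unfolding join_maps_def by auto
        ultimately have "out k \<phi> B i (f |` U1) \<or> out k \<phi> B i (f |` U2)"
          using IH join by blast
        then show ?thesis using out_restrict av f d by blast
      qed
      ultimately show ?thesis by blast
    next
      case (upward_flow j)
      then show ?thesis using IH judg avail_up out_up maps_dom by (metis Diff_iff)
    next
      case (forall_elim j W G y)
      note IHW = IH[OF forall_elim(3)]
      \<comment> \<open>The variable \<open>y\<close> is dropped at the child; the smaller set then
        flows up.\<close>
      have "avail k \<phi> j V" using IHW avail_subset forall_elim by blast
      then have "avail k \<phi> i V" using avail_up judg forall_elim by blast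
      moreover have "out k \<phi> B i f" if f: "f \<in> maps B V - F" for f
      proof -
        have d: "dom f = V" using f maps_dom by blast
        then obtain b where b: "b \<in> univ B (sort_of y)" "f(y \<mapsto> b) \<notin> G"
          using f forall_elim unfolding eps_maps_def by auto
        have "f(y \<mapsto> b) \<in> maps B W"
          using maps_updI[of f B V b y] f b(1) forall_elim by (simp add: insert_absorb)
        then have "out k \<phi> B j (f(y \<mapsto> b))" using IHW b by blast
        then show ?thesis by (rule out_all) (use d forall_elim in simp_all)
      qed
      ultimately show ?thesis by blast
    next
      case (downward_flow j)
      then show ?thesis using IH judg avail_down out_down maps_dom by (metis Diff_iff)
    qed
  qed
  then show ?thesis using assms(3) by (metis in_set_conv_nth)
qed

section \<open>Every available set and every excluded map is witnessed by a proof\<close>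

definition provable ::
  "nat \<Rightarrow> ('v, 's, 'r) qc \<Rightarrow> ('s, 'r, 'b) struct \<Rightarrow> ('v, 's, 'b) judgement set" where
  "provable k \<phi> B = {J. \<exists>Js. judgement_proof \<phi> B Js \<and> proof_width Js \<le> k \<and> J \<in> set Js}"

lemma derives_mono: "derives \<phi> B P J \<Longrightarrow> P \<subseteq> Q \<Longrightarrow> derives \<phi> B Q J"
  by (induction rule: derives.induct) (auto intro: derives.intros)

lemma judgement_proof_append:
  assumes "judgement_proof \<phi> B Js" and "judgement_proof \<phi> B Ks"
  shows "judgement_proof \<phi> B (Js @ Ks)"
  unfolding judgement_proof_def
proof (intro allI impI)
  fix n assume n: "n < length (Js @ Ks)"
  show "is_judgement \<phi> B ((Js @ Ks) ! n) \<and> derives \<phi> B (set (take n (Js @ Ks))) ((Js @ Ks) ! n)"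
  proof (cases "n < length Js")
    case True
    then show ?thesis using assms(1) unfolding judgement_proof_def by (simp add: nth_append)
  next
    case False
    then have "n - length Js < length Ks" using n by auto
    then show ?thesis using assms(2) False unfolding judgement_proof_def
      by (auto simp: nth_append intro: derives_mono)
  qed
qed

lemma proof_width_le_iff: "proof_width Js \<le> k \<longleftrightarrow> (\<forall>J\<in>set Js. width J \<le> k)"
  unfolding proof_width_def by simp

text \<open>Rules stay applicable when more judgements precede them, so proofs can be concatenated.
  This brings the premises of a rule, given by separate proofs, into a single proof.\<close>

lemma provable_finite:
  assumes "finite P" and "P \<subseteq> provable k \<phi> B"
  shows "\<exists>Js. judgement_proof \<phi> B Js \<and> proof_width Js \<le> k \<and> P \<subseteq> set Js"
  using assms
proof (induction P)
  case empty
  show ?case by (rule exI[of _ "[]"]) (simp add: judgement_proof_def proof_width_def)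
next
  case (insert J P)
  then obtain Js Ks where "judgement_proof \<phi> B Js" "proof_width Js \<le> k" "P \<subseteq> set Js"
    "judgement_proof \<phi> B Ks" "proof_width Ks \<le> k" "J \<in> set Ks"
    unfolding provable_def by auto
  then show ?case
    by (intro exI[of _ "Js @ Ks"]) (auto simp: proof_width_le_iff judgement_proof_append)
qed

lemma provable_derives:
  assumes "derives \<phi> B P J" and "finite P" and "P \<subseteq> provable k \<phi> B"
    and "is_judgement \<phi> B J" and "width J \<le> k"
  shows "J \<in> provable k \<phi> B"
proof -
  obtain Js where Js: "judgement_proof \<phi> B Js" "proof_width Js \<le> k" "P \<subseteq> set Js"
    using provable_finite assms by blast
  have "judgement_proof \<phi> B (Js @ [J])"
    using Js assms(4) derives_mono[OF assms(1)] unfolding judgement_proof_def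
    by (auto simp: nth_append less_Suc_eq)
  then show ?thesis
    unfolding provable_def using Js assms(5)
    by (auto simp: proof_width_le_iff intro!: exI[of _ "Js @ [J]"])
qed

lemma provable_is_judgement:
  assumes "J \<in> provable k \<phi> B"
  shows "is_judgement \<phi> B J \<and> width J \<le> k"
proof -
  obtain Js where Js: "judgement_proof \<phi> B Js" "proof_width Js \<le> k" "J \<in> set Js"
    using assms unfolding provable_def by blast
  then obtain n where "n < length Js" "J = Js ! n" by (auto simp: in_set_conv_nth)
  then show ?thesis using Js unfolding judgement_proof_def proof_width_le_iff by blast
qed

text \<open>A join over the same variable set is an intersection. Maps excluded by different
  judgements are thereby excluded by a single one.\<close>

lemma provable_Int:
  assumes "(i, V, F) \<in> provable k \<phi> B" and "(i, V, G) \<in> provable k \<phi> B"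
  shows "(i, V, F \<inter> G) \<in> provable k \<phi> B"
proof (rule provable_derives)
  have j: "F \<subseteq> maps B V" "G \<subseteq> maps B V" "i \<in> indices \<phi>" "V \<subseteq> free (subf \<phi> i)" "card V \<le> k"
    using provable_is_judgement assms by fastforce+
  have r: "f |` V = f" if "f \<in> maps B V" for f
    using maps_dom[OF that] by (auto simp: restrict_map_def dom_def)
  have "join_maps B V F V G = F \<inter> G"
    unfolding join_maps_def using j r by (auto simp: subset_iff)
  then show "derives \<phi> B {(i, V, F), (i, V, G)} (i, V, F \<inter> G)"
    using derives.join[of i V F "{(i, V, F), (i, V, G)}" V G \<phi> B] by simp
  show "is_judgement \<phi> B (i, V, F \<inter> G)" "width (i, V, F \<inter> G) \<le> k" using j by auto
qed (use assms in auto)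

lemma restrict_maps_subset: "F \<subseteq> maps B V \<Longrightarrow> U \<subseteq> V \<Longrightarrow> restrict_maps F U \<subseteq> maps B U"
  unfolding restrict_maps_def using maps_restrict by blast

lemma provable_projection:
  assumes "(i, V, F) \<in> provable k \<phi> B" and "U \<subseteq> V"
  shows "(i, U, restrict_maps F U) \<in> provable k \<phi> B"
proof (rule provable_derives)
  have j: "F \<subseteq> maps B V" "i \<in> indices \<phi>" "V \<subseteq> free (subf \<phi> i)" "card V \<le> k"
    using provable_is_judgement assms by fastforce+
  show "derives \<phi> B {(i, V, F)} (i, U, restrict_maps F U)"
    using assms(2) by (intro derives.projection) auto
  show "is_judgement \<phi> B (i, U, restrict_maps F U)"
    using j restrict_maps_subset[OF j(1) assms(2)] assms(2) by auto
  have "finite V" by (rule finite_subset_free[OF j(3)])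
  then show "width (i, U, restrict_maps F U) \<le> k"
    using j(4) card_mono[OF _ assms(2)] by simp
qed (use assms in auto)

lemma provable_flow:
  assumes "(i, V, F) \<in> provable k \<phi> B" and "parent \<phi> i j \<or> parent \<phi> j i" and "V \<subseteq> free (subf \<phi> j)"
  shows "(j, V, F) \<in> provable k \<phi> B"
proof (rule provable_derives)
  show "derives \<phi> B {(i, V, F)} (j, V, F)"
    using assms(2) derives.upward_flow[of i V F _ \<phi> j B] derives.downward_flow[of i V F _ \<phi> j B] by auto
  show "is_judgement \<phi> B (j, V, F)"
    using assms provable_is_judgement[OF assms(1)] by (auto simp: parent_def)
  show "width (j, V, F) \<le> k" using provable_is_judgement[OF assms(1)] by simp
qed (use assms in auto)

lemma provable_atom:
  assumes "i \<in> indices \<phi>" and "subf \<phi> i = Atom R vs" and "card (set vs) \<le> k"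
  shows "(i, set vs, {f \<in> maps B (set vs). map (\<lambda>v. the (f v)) vs \<in> rel B R}) \<in> provable k \<phi> B"
  using assms by (intro provable_derives[OF derives.atom[where P = "{}"]]) auto

lemma provable_join:
  assumes "(i, U1, F1) \<in> provable k \<phi> B" and "(i, U2, F2) \<in> provable k \<phi> B" and "card (U1 \<union> U2) \<le> k"
  shows "(i, U1 \<union> U2, join_maps B U1 F1 U2 F2) \<in> provable k \<phi> B"
  using assms provable_is_judgement[OF assms(1)] provable_is_judgement[OF assms(2)]
  by (intro provable_derives[OF derives.join[where P = "{(i, U1, F1), (i, U2, F2)}"]])
    (auto simp: join_maps_def)

lemma avail_provable: "avail k \<phi> i V \<Longrightarrow> \<exists>F. (i, V, F) \<in> provable k \<phi> B"
proof (induction rule: avail.induct)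
  case (avail_atom i R vs)
  show ?case by (rule exI, rule provable_atom[OF avail_atom])
next
  case (avail_drop i y V)
  then show ?case using provable_projection by blast
next
  case (avail_add i V y)
  then show ?case using provable_join[of i "{y}" _ k \<phi> B V] by auto
qed (use provable_flow in blast)+

text \<open>Each excluded map gets one judgement that excludes it. The case \<open>out_proj\<close>
  is the critical one: all extensions must be excluded by the same judgement before projecting, and
  \<open>fin\<close> allows the judgements for the individual values to be intersected.\<close>

lemma out_provable:
  assumes fin: "\<And>i V y. avail k \<phi> i V \<Longrightarrow> y \<in> V \<Longrightarrow> finite (univ B (sort_of y))"
  shows "out k \<phi> B i f \<Longrightarrow> \<exists>F. (i, dom f, F) \<in> provable k \<phi> B \<and> f \<notin> F"
proof (induction rule: out.induct)
  case (out_atom i R vs f)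
  show ?case
    unfolding maps_dom[OF out_atom(4)]
    by (rule exI, rule conjI[OF provable_atom[OF out_atom(1-3)]]) (simp add: out_atom(5))
next
  case (out_proj i y f)
  let ?W = "insert y (dom f)"
  have IH: "\<exists>F. (i, ?W, F) \<in> provable k \<phi> B \<and> f(y \<mapsto> b) \<notin> F" if "b \<in> univ B (sort_of y)" for b
    using out_proj.IH that by (simp del: fun_upd_apply)
  have "finite (univ B (sort_of y))" using fin out_proj by blast
  then have "\<exists>F. (i, ?W, F) \<in> provable k \<phi> B \<and> (\<forall>b\<in>C. f(y \<mapsto> b) \<notin> F)"
    if "C \<subseteq> univ B (sort_of y)" for C
    using finite_subset[OF that] that
  proof (induction C rule: infinite_finite_induct)
    case empty
    \<comment> \<open>With no value to exclude, any judgement on \<open>?W\<close> will do, and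
      availability supplies one. This base case is all there is when the universe is empty.\<close>
    show ?case using avail_provable[OF out_proj.hyps(1)] by blast
  next
    case (insert b C)
    then obtain F where F: "(i, ?W, F) \<in> provable k \<phi> B" "\<forall>b\<in>C. f(y \<mapsto> b) \<notin> F"
      by (auto simp del: fun_upd_apply)
    obtain G where G: "(i, ?W, G) \<in> provable k \<phi> B" "f(y \<mapsto> b) \<notin> G"
      using IH[of b] insert.prems by auto
    show ?case
      using provable_Int[OF F(1) G(1)] F(2) G(2)
      by (intro exI[of _ "F \<inter> G"]) (auto simp del: fun_upd_apply)
  qed simp
  then obtain F where F: "(i, ?W, F) \<in> provable k \<phi> B" "\<forall>b\<in>univ B (sort_of y). f(y \<mapsto> b) \<notin> F"
    by blast
  \<comment> \<open>A map of \<open>F\<close> that restricts to \<open>f\<close> would be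
    \<open>f(y \<mapsto> b)\<close> for some \<open>b\<close> of the universe, and \<open>F\<close>
    contains none of these.\<close>
  have "f \<notin> restrict_maps F (dom f)"
  proof
    assume "f \<in> restrict_maps F (dom f)"
    then obtain g where g: "g \<in> F" "f = g |` dom f" unfolding restrict_maps_def by blast
    have gm: "g \<in> maps B ?W" using provable_is_judgement[OF F(1)] g(1) by auto
    then obtain b where b: "g y = Some b" "b \<in> univ B (sort_of y)"
      unfolding maps_def by force
    have "g x = (f(y \<mapsto> b)) x" for x
    proof (cases "x \<in> dom f")
      case True
      then show ?thesis using g(2) out_proj.hyps(2) by (metis fun_upd_other restrict_in)
    next
      case False
      then have "x = y \<or> g x = None" using maps_dom[OF gm] by blast
      then show ?thesis using b False by (auto simp: dom_def)
    qed
    then have "g = f(y \<mapsto> b)" by blast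
    then show False using F(2) b g by blast
  qed
  then show ?case using provable_projection[OF F(1), of "dom f"] by blast
next
  case (out_ext i f y b)
  obtain F where F: "(i, dom f, F) \<in> provable k \<phi> B" "f \<notin> F" using out_ext by blast
  obtain G where G: "(i, insert y (dom f), G) \<in> provable k \<phi> B"
    using avail_provable out_ext by blast
  have "card (dom f \<union> insert y (dom f)) \<le> k" using avail_facts[OF out_ext.hyps(2)] by simp
  from provable_join[OF F(1) G this]
  have "(i, insert y (dom f), join_maps B (dom f) F (insert y (dom f)) G) \<in> provable k \<phi> B"
    by simp
  moreover have "(f(y \<mapsto> b)) |` dom f = f"
    using out_ext.hyps(3) by (auto simp: restrict_map_def fun_eq_iff dom_def)
  then have "f(y \<mapsto> b) \<notin> join_maps B (dom f) F (insert y (dom f)) G"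
    using F(2) unfolding join_maps_def by simp
  ultimately show ?case by (auto simp del: fun_upd_apply)
next
  case (out_up j f i)
  then show ?case using provable_flow by blast
next
  case (out_all j f y b i)
  obtain F where F: "(j, insert y (dom f), F) \<in> provable k \<phi> B" "f(y \<mapsto> b) \<notin> F"
    using out_all.IH by (auto simp del: fun_upd_apply)
  have dom: "insert y (dom f) - {y} = dom f" using out_all by auto
  have b: "b \<in> univ B (sort_of y)"
    using out_facts[OF out_all.hyps(1)] maps_upd_iff[OF out_all.hyps(2), of b B] by (simp del: fun_upd_apply)
  have "(i, dom f, eps_maps B y (insert y (dom f)) F) \<in> provable k \<phi> B"
  proof (rule provable_derives)
    show "derives \<phi> B {(j, insert y (dom f), F)} (i, dom f, eps_maps B y (insert y (dom f)) F)"
      using derives.forall_elim[of j "insert y (dom f)" F _ y \<phi> i B] out_all.hyps dom by simp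
    have "dom f \<subseteq> free (subf \<phi> i)" "i \<in> indices \<phi>"
      using provable_is_judgement[OF F(1)] out_all.hyps by (auto simp: parent_def)
    then show "is_judgement \<phi> B (i, dom f, eps_maps B y (insert y (dom f)) F)"
      unfolding eps_maps_def dom by auto
    have "card (dom f) \<le> card (insert y (dom f))"
      by (rule card_insert_le)
    then show "width (i, dom f, eps_maps B y (insert y (dom f)) F) \<le> k"
      using provable_is_judgement[OF F(1)] by simp
  qed (use F in auto)
  moreover have "f \<notin> eps_maps B y (insert y (dom f)) F"
    using F(2) b unfolding eps_maps_def by blast
  ultimately show ?case by blast
next
  case (out_down i f j)
  then show ?case using provable_flow by blast
qed

text \<open>There is only one map on the empty set, so a judgement on it that excludes this map is
  empty. Conversely, an empty judgement excludes all maps on its variables; projecting all of these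
  away excludes the empty map, which then rises to the root.\<close>

lemma judge_consistent_iff_not_out:
  assumes fin: "\<And>i V y. avail k \<phi> i V \<Longrightarrow> y \<in> V \<Longrightarrow> finite (univ B (sort_of y))"
  shows "judge_consistent k \<phi> B \<longleftrightarrow> \<not> out k \<phi> B [] Map.empty"
proof
  assume con: "judge_consistent k \<phi> B"
  show "\<not> out k \<phi> B [] Map.empty"
  proof
    assume "out k \<phi> B [] Map.empty"
    then obtain F where F: "([], {}, F) \<in> provable k \<phi> B" "Map.empty \<notin> F"
      using out_provable[OF fin] by fastforce
    have "F \<subseteq> {Map.empty}" using provable_is_judgement[OF F(1)] by (auto simp: maps_def)
    then have "F = {}" using F(2) by auto
    then have "empty_judgement ([], {}, F)" by simp
    with F(1) con show False unfolding judge_consistent_def provable_def by blast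
  qed
next
  assume nout: "\<not> out k \<phi> B [] Map.empty"
  show "judge_consistent k \<phi> B"
    unfolding judge_consistent_def
  proof
    assume "\<exists>Js. judgement_proof \<phi> B Js \<and> proof_width Js \<le> k \<and> (\<exists>J\<in>set Js. empty_judgement J)"
    then obtain Js J where Js: "judgement_proof \<phi> B Js" "proof_width Js \<le> k" "J \<in> set Js" "empty_judgement J"
      by blast
    obtain i V where J: "J = (i, V, {})" using Js(4) by (cases J) auto
    have o: "avail k \<phi> i V" "\<forall>f\<in>maps B V. out k \<phi> B i f"
      using judgement_proof_out[OF Js(1,2)] Js(3) J by auto
    have "finite V" by (rule avail_finite[OF o(1)])
    \<comment> \<open>If a universe is empty there may be no maps on \<open>V\<close> at all; the
      projection then rests on availability alone.\<close>
    then have "out k \<phi> B i Map.empty"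
      by (rule out_projection) (use o in \<open>simp_all add: maps_def\<close>)
    then show False using out_root nout by blast
  qed
qed

section \<open>The saturation algorithm\<close>

definition unary :: "nat \<Rightarrow> tree" where
  "unary n = ttree (replicate n Leaf)"

text \<open>Paths are stored from the leaf to the root, so that the parent of a path is its right subtree.\<close>

definition path_tree :: "index \<Rightarrow> tree" where
  "path_tree i = ttree (map unary (rev i))"

definition kids :: "tree \<Rightarrow> tree list" where
  "kids t = (if left t = enc_tag False True then tlist (right t)
     else if left t = enc_tag True False \<or> left t = enc_tag True True then [right (right t)] else [])"

definition enum :: "tree list \<Rightarrow> tree list" where
  "enum cs = map (\<lambda>n. Node (unary n) (cs ! n)) [0..<length cs]"

definition next_level :: "tree \<Rightarrow> tree" where
  "next_level L = ttree (concat (map (\<lambda>e. map (\<lambda>c. Node (Node (left c) (left e)) (right c))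
     (enum (kids (right e)))) (tlist L)))"

text \<open>Breadth-first search by levels. Each step down shrinks the encoded formula strictly
  (\<open>tsize_child\<close>), so \<open>tsize\<close> many levels reach every occurrence.\<close>

definition occs :: "tree \<Rightarrow> tree list" where
  "occs x = concat (map tlist (map (\<lambda>n. (next_level ^^ n) (Node (Node Leaf (left x)) Leaf))
     [0..<tsize (left x)]))"

text \<open>Atoms suffice as a source: every free variable of a subformula occurs in an atom
  (\<open>free_atom_vars\<close>).\<close>

definition vars :: "tree \<Rightarrow> tree list" where
  "vars x = concat (map (\<lambda>e. if left (right e) = enc_tag False False
     then tlist (right (right (right e))) else []) (occs x))"

definition elems :: "tree \<Rightarrow> tree \<Rightarrow> tree list" where
  "elems x v = concat (map (\<lambda>u. if left u = right v then tlist (right u) else [])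
     (tlist (left (right x))))"

definition pairs :: "tree \<Rightarrow> tree list" where
  "pairs x = concat (map (\<lambda>v. map (\<lambda>b. Node v b) (elems x v)) (vars x))"

text \<open>Every set of at most \<open>k\<close> members is the set of entries of such a list
  (\<open>tuples_complete\<close>). Since \<open>k\<close> is a constant of the program and not part
  of its input, the recursion unfolds into a fixed nesting of loops.\<close>

primrec tuples :: "nat \<Rightarrow> tree list \<Rightarrow> tree list" where
  "tuples 0 L = [Leaf]"
| "tuples (Suc k) L = Leaf # concat (map (\<lambda>e. map (\<lambda>l. Node e l) (tuples k L)) L)"

definition FreeT :: tree where "FreeT = Leaf"
definition AvailT :: tree where "AvailT = Node Leaf Leaf"
definition OutT :: tree where "OutT = Node Leaf (Node Leaf Leaf)"

text \<open>A fact is \<open>Node tag (Node path list)\<close>; the list stands for the set of its members, which are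
  variables for the tags \<open>FreeT\<close> and \<open>AvailT\<close>, and variable-value pairs for \<open>OutT\<close>.\<close>

definition candidates :: "nat \<Rightarrow> tree \<Rightarrow> tree list" where
  "candidates k x = concat (map (\<lambda>e.
     map (\<lambda>l. Node FreeT (Node (left e) l)) (tuples k (vars x)) @
     map (\<lambda>l. Node AvailT (Node (left e) l)) (tuples k (vars x)) @
     map (\<lambda>l. Node OutT (Node (left e) l)) (tuples k (pairs x))) (occs x))"

definition known :: "tree \<Rightarrow> tree \<Rightarrow> tree \<Rightarrow> tree list \<Rightarrow> bool" where
  "known S tag p L \<longleftrightarrow> (\<exists>w\<in>set (tlist S). left w = tag \<and> left (right w) = p \<and>
     set (tlist (right (right w))) = set L)"

text \<open>The test goes through singletons because \<open>free_rule\<close> lifts a set from a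
  single child, while a conjunction may spread the variables of a set over several children.\<close>

definition all_free :: "tree \<Rightarrow> tree \<Rightarrow> tree list \<Rightarrow> bool" where
  "all_free S p L \<longleftrightarrow> (\<forall>v\<in>set L. known S FreeT p [v])"

text \<open>The first bit of the tag is set exactly for quantifiers;
  \<open>left (right (right e))\<close> is then the bound variable.\<close>

definition free_rule :: "tree \<Rightarrow> tree \<Rightarrow> tree \<Rightarrow> tree \<Rightarrow> bool" where
  "free_rule x S p l \<longleftrightarrow> (\<exists>e\<in>set (occs x). left e = p \<and>
     (left (right e) = enc_tag False False \<and> set (tlist l) \<subseteq> set (tlist (right (right (right e)))) \<or>
      (\<exists>d\<in>set (occs x). left d \<noteq> Leaf \<and> right (left d) = p \<and> known S FreeT (left d) (tlist l) \<and>
        (left (left (right e)) \<noteq> Leaf \<longrightarrow> left (right (right e)) \<notin> set (tlist l)))))"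

text \<open>\<open>right Leaf\<close> is \<open>Leaf\<close>, so without the tests against
  \<open>Leaf\<close> the root would count as its own child and its own parent.\<close>

definition flow_rule :: "tree \<Rightarrow> tree \<Rightarrow> tree \<Rightarrow> tree \<Rightarrow> tree \<Rightarrow> bool" where
  "flow_rule x S tag p l \<longleftrightarrow>
     (\<exists>d\<in>set (occs x). left d \<noteq> Leaf \<and> right (left d) = p \<and> known S tag (left d) (tlist l)) \<or>
     p \<noteq> Leaf \<and> known S tag (right p) (tlist l)"

text \<open>The disjuncts mirror the rules of \<open>avail\<close>, with both flows in the last one.
  The width bound is implicit: candidate lists have at most \<open>k\<close> entries.\<close>

definition avail_rule :: "tree \<Rightarrow> tree \<Rightarrow> tree \<Rightarrow> tree \<Rightarrow> bool" where
  "avail_rule x S p l \<longleftrightarrow>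
     (\<exists>e\<in>set (occs x). left e = p \<and> left (right e) = enc_tag False False \<and>
        set (tlist l) = set (tlist (right (right (right e))))) \<or>
     (\<exists>y\<in>set (vars x). known S AvailT p (y # tlist l)) \<or>
     (\<exists>w\<in>set (tlist S). left w = AvailT \<and> left (right w) = p \<and>
        (\<exists>y\<in>set (vars x). known S AvailT p [y] \<and> set (y # tlist (right (right w))) = set (tlist l))) \<or>
     all_free S p (tlist l) \<and> flow_rule x S AvailT p l"

definition consistent :: "tree \<Rightarrow> bool" where
  "consistent l \<longleftrightarrow> (\<forall>a\<in>set (tlist l). \<forall>b\<in>set (tlist l). left a = left b \<longrightarrow> a = b)"

text \<open>\<open>left\<close> of a \<open>ttree\<close> is the head of the list, and
  \<open>Leaf\<close> on the empty list; on a consistent list all entries that pass the filter are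
  equal.\<close>

definition val :: "tree \<Rightarrow> tree \<Rightarrow> tree" where
  "val l v = left (ttree (map right (filter (\<lambda>a. left a = v) (tlist l))))"

text \<open>\<open>consistent\<close> is tested only where nothing else makes the list a map, namely
  for atoms and for projections, where \<open>elems\<close> may be empty. In the other disjuncts
  functionality is inherited from a stored fact.\<close>

definition out_rule :: "tree \<Rightarrow> tree \<Rightarrow> tree \<Rightarrow> tree \<Rightarrow> bool" where
  "out_rule x S p l \<longleftrightarrow>
     consistent l \<and> (\<exists>e\<in>set (occs x). left e = p \<and> left (right e) = enc_tag False False \<and>
        set (map left (tlist l)) = set (tlist (right (right (right e)))) \<and>
        \<not> (\<exists>r\<in>set (tlist (right (right x))). left r = left (right (right e)) \<and>
          ttree (map (\<lambda>v. val l v) (tlist (right (right (right e))))) \<in> set (tlist (right (right r))))) \<or>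
     consistent l \<and> (\<exists>y\<in>set (vars x). y \<notin> set (map left (tlist l)) \<and>
        known S AvailT p (y # map left (tlist l)) \<and>
        (\<forall>b\<in>set (elems x y). known S OutT p (Node y b # tlist l))) \<or>
     (\<exists>w\<in>set (tlist S). left w = OutT \<and> left (right w) = p \<and>
        (\<exists>a\<in>set (pairs x). left a \<notin> set (map left (tlist (right (right w)))) \<and>
          known S AvailT p (left a # map left (tlist (right (right w)))) \<and>
          set (a # tlist (right (right w))) = set (tlist l))) \<or>
     all_free S p (map left (tlist l)) \<and> flow_rule x S OutT p l \<or>
     (\<exists>e\<in>set (occs x). left e = p \<and> left (right e) = enc_tag True False \<and>
        left (right (right e)) \<notin> set (map left (tlist l)) \<and>
        (\<exists>b\<in>set (elems x (left (right (right e)))). \<exists>d\<in>set (occs x).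
          left d \<noteq> Leaf \<and> right (left d) = p \<and>
          known S OutT (left d) (Node (left (right (right e))) b # tlist l)))"

definition fact_rule :: "tree \<Rightarrow> tree \<Rightarrow> tree \<Rightarrow> bool" where
  "fact_rule x S u \<longleftrightarrow>
     left u = FreeT \<and> free_rule x S (left (right u)) (right (right u)) \<or>
     left u = AvailT \<and> avail_rule x S (left (right u)) (right (right u)) \<or>
     left u = OutT \<and> out_rule x S (left (right u)) (right (right u))"

definition saturate_step :: "nat \<Rightarrow> tree \<Rightarrow> tree \<Rightarrow> tree" where
  "saturate_step k x S =
     ttree (filter (\<lambda>u. u \<in> set (tlist S) \<or> fact_rule x S u) (candidates k x))"

text \<open>The candidate list is the clock: its length bounds the number of rounds until nothing
  changes (\<open>saturate_fixpoint\<close>).\<close>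

definition saturate :: "nat \<Rightarrow> tree \<Rightarrow> tree" where
  "saturate k x = foldl (\<lambda>S e. saturate_step k x S) Leaf (candidates k x)"

section \<open>Running time of the saturation\<close>

lemma tsize_right_le: "tsize (right t) \<le> tsize t"
  by (cases t) simp_all

lemma sum_tsize_le: "(\<Sum>c\<leftarrow>tlist t. tsize c) \<le> tsize t"
  by (induction t) auto

lemma tsize_unary: "tsize (unary n) = 2 * n + 1"
  by (simp add: unary_def tsize_ttree sum_list_replicate)

lemma ptl_kids: "pt f \<Longrightarrow> ptl (\<lambda>x. kids (f x))"
  unfolding kids_def by (intro pt_intros)

lemma sum_kids_le: "(\<Sum>c\<leftarrow>kids t. tsize c) \<le> tsize t"
proof -
  have "(\<Sum>c\<leftarrow>tlist (right t). tsize c) \<le> tsize t" "tsize (right (right t)) \<le> tsize t"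
    using sum_tsize_le[of "right t"] tsize_right_le[of t] tsize_right_le[of "right t"] by linarith+
  then show ?thesis by (simp add: kids_def)
qed

lemma ptl_enum:
  assumes "ptl C"
  shows "ptl (\<lambda>x. enum (C x))"
proof -
  \<comment> \<open>The state pairs a unary counter with the remaining list, so the
    \<open>n\<close>-th iterate shows both the number \<open>n\<close> and the \<open>n\<close>-th
    element.\<close>
  let ?bump = "\<lambda>st. Node (Node Leaf (left st)) (right (right st))"
  have st: "(?bump ^^ n) (Node Leaf (ttree cs)) = Node (unary n) (ttree (drop n cs))"
    if "n \<le> length cs" for n cs
    using that
  proof (induction n)
    case (Suc n)
    then show ?case by (simp add: Cons_nth_drop_Suc[symmetric] unary_def)
  qed (simp add: unary_def)
  let ?Q = "\<lambda>x. 2 * length (C x) + 1 + tsize (ttree (C x)) + 1"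
  have "ptl (\<lambda>x. map (\<lambda>n. (?bump ^^ n) (Node Leaf (ttree (C x)))) [0..<length (C x)])"
  proof (rule ptl_iterates[where Q = ?Q])
    show "poly_bounded ?Q"
      using assms by (intro poly_bounded_intros poly_bounded_length poly_bounded_pt pt_ttree)
    show "tsize ((?bump ^^ n) (Node Leaf (ttree (C x)))) \<le> ?Q x" if "n \<le> length (C x)" for x n
      using st[OF that] that tsize_drop_le[of n "C x"] by (simp add: tsize_unary)
  qed (intro pt_intros assms)+
  then have "ptl (\<lambda>x. map (\<lambda>e. Node (left e) (left (right e)))
      (map (\<lambda>n. (?bump ^^ n) (Node Leaf (ttree (C x)))) [0..<length (C x)]))"
    by (intro ptl_map pt_intros)
  moreover have "map (\<lambda>e. Node (left e) (left (right e)))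
      (map (\<lambda>n. (?bump ^^ n) (Node Leaf (ttree cs))) [0..<length cs]) = enum cs" for cs
    unfolding enum_def map_map
    by (intro map_cong) (auto simp: st Cons_nth_drop_Suc[symmetric])
  ultimately show ?thesis by simp
qed

lemma pt_next_level: "pt next_level"
  unfolding next_level_def by (intro pt_intros ptl_enum ptl_kids)

lemma map_right_enum: "map right (enum cs) = cs"
  unfolding enum_def by (intro nth_equalityI) auto

text \<open>The kids of a tree are disjoint subtrees of it, so passing to the next level never
  increases the total size of the formulas. This keeps the levels from growing exponentially, on
  malformed inputs too.\<close>

lemma next_level_weight:
  "(\<Sum>e\<leftarrow>tlist (next_level L). tsize (right e)) \<le> (\<Sum>e\<leftarrow>tlist L. tsize (right e))"
proof -
  have s: "(\<Sum>c\<leftarrow>enum cs. tsize (right c)) = (\<Sum>c\<leftarrow>cs. tsize c)" for cs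
    using arg_cong[OF map_right_enum[of cs], of "\<lambda>l. sum_list (map tsize l)"] by (simp add: comp_def)
  have "(\<Sum>e\<leftarrow>tlist (next_level L). tsize (right e)) =
      (\<Sum>e\<leftarrow>tlist L. \<Sum>c\<leftarrow>enum (kids (right e)). tsize (right c))"
    unfolding next_level_def tlist_ttree
    by (induction L) (simp_all add: comp_def)
  also have "\<dots> \<le> (\<Sum>e\<leftarrow>tlist L. tsize (right e))"
    unfolding s by (intro sum_list_mono sum_kids_le)
  finally show ?thesis .
qed

text \<open>A child number is below the size of its parent, hence below \<open>W\<close>. In unary
  it has size at most \<open>2 * W + 1\<close>, and one more node attaches it to the path.\<close>

lemma next_level_path:
  assumes "\<And>e. e \<in> set (tlist L) \<Longrightarrow> tsize (left e) \<le> M"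
    and "(\<Sum>e\<leftarrow>tlist L. tsize (right e)) \<le> W" and "d \<in> set (tlist (next_level L))"
  shows "tsize (left d) \<le> M + (2 * W + 2)"
proof -
  obtain e n where e: "e \<in> set (tlist L)" "n < length (kids (right e))" "left d = Node (unary n) (left e)"
    using assms(3) unfolding next_level_def by (auto simp: enum_def)
  have "length cs \<le> (\<Sum>c\<leftarrow>cs. tsize c)" for cs
  proof (induction cs)
    case (Cons c cs)
    then show ?case using tsize_pos[of c] by simp
  qed simp
  then have "n < tsize (right e)"
    using e(2) sum_kids_le[of "right e"] by (meson less_le_trans)
  also have "\<dots> \<le> W"
    using e(1) assms(2) member_le_sum_list[of "tsize (right e)" "map (\<lambda>e. tsize (right e)) (tlist L)"]
    by fastforce
  finally show ?thesis using assms(1)[OF e(1)] e(3) by (simp add: tsize_unary)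
qed

lemma ptl_occs: "ptl occs"
proof -
  let ?i = "\<lambda>x. Node (Node Leaf x) Leaf"
  let ?L = "\<lambda>x n. (next_level ^^ n) (?i x)"
  let ?M = "\<lambda>x n. 1 + n * (2 * tsize x + 2)"
  let ?Q = "\<lambda>x. 1 + tsize x * (?M x (tsize x) + 2) + tsize x"
  have weight: "(\<Sum>e\<leftarrow>tlist (?L x n). tsize (right e)) \<le> tsize x" for x n
  proof (induction n)
    case (Suc n)
    then show ?case using next_level_weight[of "?L x n"] by simp
  qed simp
  have path: "tsize (left e) \<le> ?M x n" if "e \<in> set (tlist (?L x n))" for x n e
    using that
  proof (induction n arbitrary: e)
    case (Suc n)
    show ?case
      using next_level_path[of "?L x n" "?M x n" "tsize x" e] Suc.IH Suc.prems weight[where x = x and n = n]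
      by simp
  qed simp
  \<comment> \<open>Each entry has weight at least 1, so there are at most \<open>W\<close> entries.
    Besides its weight an entry costs its path, its pair node and one spine node, which is at most
    \<open>M + 2\<close>.\<close>
  have size: "tsize L \<le> 1 + W * (M + 2) + W"
    if "(\<Sum>e\<leftarrow>tlist L. tsize (right e)) \<le> W" "\<And>e. e \<in> set (tlist L) \<Longrightarrow> tsize (left e) \<le> M" for L M W
    using that
  proof (induction L arbitrary: W)
    case (Node e L)
    let ?w = "tsize (right e)"
    have "tsize L \<le> 1 + (W - ?w) * (M + 2) + (W - ?w)"
      using Node.prems by (intro Node.IH(2)) auto
    moreover have "tsize e \<le> M + ?w + 1" using Node.prems(2)[of e] by (cases e) auto
    moreover obtain W' where W: "W = ?w + W'" using Node.prems(1) le_Suc_ex by fastforce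
    moreover have "?w * (M + 2) \<ge> M + 2" using mult_le_mono1[OF tsize_pos[of "right e"], of "M + 2"] by simp
    ultimately show ?case by (simp add: algebra_simps)
  qed simp
  have "ptl (\<lambda>x. map (\<lambda>n. ?L x n) [0..<length (replicate (tsize x) Leaf)])"
  proof (rule ptl_iterates[where Q = ?Q])
    show "poly_bounded ?Q" by (intro poly_bounded_intros)
    show "tsize (?L x n) \<le> ?Q x" if "n \<le> length (replicate (tsize x) Leaf)" for x n
    proof (rule size[OF weight])
      fix e assume "e \<in> set (tlist (?L x n))"
      then have "tsize (left e) \<le> ?M x n" by (rule path)
      also have "\<dots> \<le> ?M x (tsize x)" using mult_le_mono1[of n "tsize x" "2 * tsize x + 2"] that by simp
      finally show "tsize (left e) \<le> ?M x (tsize x)" .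
    qed
  qed (intro pt_intros pt_next_level ptl_clock)+
  then have "ptl (\<lambda>x. concat (map (\<lambda>e. tlist e) (map (\<lambda>n. ?L x n) [0..<length (replicate (tsize x) Leaf)])))"
    by (intro ptl_concat_map pt_intros)
  from ptl_comp[OF this, of left] show ?thesis
    unfolding occs_def by (simp add: pt_intros)
qed

lemmas ptl_occs' = ptl_comp[OF ptl_occs]

lemma ptl_vars: "pt f \<Longrightarrow> ptl (\<lambda>z. vars (f z))"
proof -
  have "ptl vars" unfolding vars_def by (intro pt_intros ptl_occs')
  then show "pt f \<Longrightarrow> ptl (\<lambda>z. vars (f z))" by (rule ptl_comp)
qed

lemma ptl_elems:
  assumes "pt f" and "pt g"
  shows "ptl (\<lambda>z. elems (f z) (g z))"
  unfolding elems_def by (intro pt_intros pt_comp[OF assms(1)] pt_comp[OF assms(2)])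

lemma ptl_pairs: "pt f \<Longrightarrow> ptl (\<lambda>z. pairs (f z))"
proof -
  have "ptl pairs" unfolding pairs_def by (intro pt_intros ptl_vars ptl_elems)
  then show "pt f \<Longrightarrow> ptl (\<lambda>z. pairs (f z))" by (rule ptl_comp)
qed

lemma ptl_tuples: "ptl L \<Longrightarrow> ptl (\<lambda>x. tuples k (L x))"
proof (induction k)
  case 0
  then show ?case by (simp add: pt_intros)
next
  case (Suc k)
  then show ?case
    unfolding tuples.simps by (intro pt_intros ptl_comp[OF Suc.IH[OF Suc.prems]])
qed

lemma ptl_candidates: "pt f \<Longrightarrow> ptl (\<lambda>z. candidates k (f z))"
proof -
  have "ptl (candidates k)"
    unfolding candidates_def by (intro pt_intros ptl_occs' ptl_vars ptl_pairs ptl_tuples)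
  then show "pt f \<Longrightarrow> ptl (\<lambda>z. candidates k (f z))" by (rule ptl_comp)
qed

text \<open>Under a quantifier the input becomes a pair, and the parameters are read off its left
  half. This shift is what \<open>THEN pt_comp\<close> and \<open>THEN ptl_comp\<close> perform here
  and in the following lemmas.\<close>

lemma ptb_known:
  assumes "pt S" and "pt t" and "pt p" and "ptl L"
  shows "ptb (\<lambda>z. known (S z) (t z) (p z) (L z))"
  unfolding known_def
  by (intro pt_intros assms assms(1-3)[THEN pt_comp] assms(4)[THEN ptl_comp])

lemma ptb_all_free:
  assumes "pt S" and "pt p" and "ptl L"
  shows "ptb (\<lambda>z. all_free (S z) (p z) (L z))"
  unfolding all_free_def
  by (intro pt_intros ptb_known assms(1,2)[THEN pt_comp] assms(3))

lemmas pt_alg_intros = pt_intros ptl_occs' ptl_vars ptl_elems ptl_pairs ptb_known ptb_all_free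

lemma ptb_free_rule:
  assumes "pt x" and "pt S" and "pt p" and "pt l"
  shows "ptb (\<lambda>z. free_rule (x z) (S z) (p z) (l z))"
  unfolding free_rule_def by (intro pt_alg_intros assms[THEN pt_comp])

lemma ptb_flow_rule:
  assumes "pt x" and "pt S" and "pt t" and "pt p" and "pt l"
  shows "ptb (\<lambda>z. flow_rule (x z) (S z) (t z) (p z) (l z))"
  unfolding flow_rule_def by (intro pt_alg_intros assms[THEN pt_comp])

lemma ptb_avail_rule:
  assumes "pt x" and "pt S" and "pt p" and "pt l"
  shows "ptb (\<lambda>z. avail_rule (x z) (S z) (p z) (l z))"
  unfolding avail_rule_def by (intro pt_alg_intros ptb_flow_rule assms[THEN pt_comp])

lemma ptb_consistent: "pt l \<Longrightarrow> ptb (\<lambda>z. consistent (l z))"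
proof -
  have "ptb consistent" unfolding consistent_def by (intro pt_intros)
  then show "pt l \<Longrightarrow> ptb (\<lambda>z. consistent (l z))" by (rule ptb_comp)
qed

lemma pt_val:
  assumes "pt l" and "pt v"
  shows "pt (\<lambda>z. val (l z) (v z))"
  unfolding val_def by (intro pt_intros assms[THEN pt_comp])

lemma ptb_out_rule:
  assumes "pt x" and "pt S" and "pt p" and "pt l"
  shows "ptb (\<lambda>z. out_rule (x z) (S z) (p z) (l z))"
  unfolding out_rule_def
  by (intro pt_alg_intros ptb_flow_rule ptb_consistent pt_val assms[THEN pt_comp])

lemma ptb_fact_rule:
  assumes "pt x" and "pt S" and "pt u"
  shows "ptb (\<lambda>z. fact_rule (x z) (S z) (u z))"
  unfolding fact_rule_def
  by (intro pt_intros ptb_free_rule ptb_avail_rule ptb_out_rule assms)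

lemma pt_saturate: "pt (saturate k)"
proof -
  let ?Q = "\<lambda>x. tsize (ttree (candidates k x))"
  \<comment> \<open>A round filters the candidates, so the size of its result is bounded
    independently of \<open>S\<close>.\<close>
  have le: "tsize (saturate_step k x S) \<le> ?Q x" for x S
    unfolding saturate_step_def tsize_ttree by (simp add: sum_list_filter_le_nat)
  show ?thesis
    unfolding saturate_def
  proof (rule pt_foldl_additive[where Q = ?Q])
    show "ptl (candidates k)" by (intro ptl_candidates pt_id)
    show "poly_bounded ?Q" by (intro poly_bounded_pt pt_ttree ptl_candidates pt_id)
    show "pt (\<lambda>z. saturate_step k (left (left z)) (right (left z)))"
      unfolding saturate_step_def by (intro pt_intros ptl_candidates ptb_fact_rule)
    show "tsize (saturate_step k x a) \<le> tsize a + ?Q x" for x a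
      using le[of x a] by simp
  qed (rule pt_const)
qed

section \<open>Correctness of the algorithm\<close>

lemma length_filter_strict:
  assumes "\<And>u. u \<in> set U \<Longrightarrow> P u \<Longrightarrow> Q u" and "filter P U \<noteq> filter Q U"
  shows "length (filter P U) < length (filter Q U)"
  using assms
proof (induction U)
  case (Cons u U)
  have "length (filter P V) \<le> length (filter Q V)" if "\<And>u. u \<in> set V \<Longrightarrow> P u \<Longrightarrow> Q u" for V
    using that by (induction V) (auto intro: le_SucI)
  then have le: "length (filter P U) \<le> length (filter Q U)" using Cons.prems(1) by simp
  show ?case
  proof (cases "filter P U = filter Q U")
    case True
    then show ?thesis using Cons.prems by (auto split: if_splits)
  next
    case False
    then have "length (filter P U) < length (filter Q U)" using Cons by simp
    then show ?thesis using Cons.prems(1)[of u] by auto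
  qed
qed simp

lemma saturate_eq_funpow: "saturate k x = (saturate_step k x ^^ length (candidates k x)) Leaf"
proof -
  have "foldl (\<lambda>S e. f S) a es = (f ^^ length es) a" for f and a :: tree and es :: "tree list"
    by (induction es arbitrary: a) (auto simp: funpow_swap1)
  then show ?thesis by (simp add: saturate_def)
qed

text \<open>Rounds only add facts, so each round before stabilisation lengthens the list. Counting
  entries of filtered candidate lists, rather than distinct facts, tolerates repeated
  candidates.\<close>

lemma saturate_fixpoint: "saturate_step k x (saturate k x) = saturate k x"
proof -
  let ?U = "candidates k x"
  let ?S = "\<lambda>n. (saturate_step k x ^^ n) Leaf"
  have flt: "\<exists>P. tlist (?S n) = filter P ?U" for n
    by (cases n) (auto simp: saturate_step_def intro: exI[of _ "\<lambda>_. False"])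
  have progress: "?S (Suc n) = ?S n \<or> n \<le> length (tlist (?S n))" for n
  proof (induction n)
    case (Suc n)
    show ?case
    proof (cases "?S (Suc n) = ?S n")
      case True
      then show ?thesis by simp
    next
      case False
      obtain P where P: "tlist (?S n) = filter P ?U" using flt by blast
      let ?Q = "\<lambda>u. u \<in> set (tlist (?S n)) \<or> fact_rule x (?S n) u"
      have Q: "tlist (?S (Suc n)) = filter ?Q ?U" by (simp add: saturate_step_def)
      have "filter P ?U \<noteq> filter ?Q ?U" using False P Q by (metis ttree_tlist)
      then have "length (filter P ?U) < length (filter ?Q ?U)"
        by (intro length_filter_strict) (auto simp: P)
      then show ?thesis using Suc False P Q by simp
    qed
  qed simp
  let ?N = "length ?U"
  have "?S (Suc ?N) = ?S ?N"
  proof (rule ccontr)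
    assume ne: "?S (Suc ?N) \<noteq> ?S ?N"
    then have len: "?N \<le> length (tlist (?S ?N))" using progress by blast
    obtain P where P: "tlist (?S ?N) = filter P ?U" using flt by blast
    \<comment> \<open>After as many strict increases as there are candidates, all of them are
      present and the next round can add nothing.\<close>
    have "filter P ?U = ?U"
      using len P by (metis filter_id_conv length_filter_less not_le)
    then have U: "tlist (?S ?N) = ?U" using P by simp
    have "tlist (?S (Suc ?N)) = filter (\<lambda>u. u \<in> set (tlist (?S ?N)) \<or> fact_rule x (?S ?N) u) ?U"
      by (simp add: saturate_step_def)
    also have "\<dots> = ?U" unfolding U by (simp add: filter_id_conv)
    finally have "?S (Suc ?N) = ?S ?N" using U by (metis ttree_tlist)
    then show False using ne by contradiction
  qed
  then show ?thesis by (simp add: saturate_eq_funpow)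
qed

section \<open>Faithfulness of the encodings\<close>

lemma enc_list_eq: "enc_list e xs = ttree (map e xs)"
  unfolding enc_list_def by (induction xs) auto

lemma enc_bool_eq_iff [simp]: "enc_bool a = enc_bool b \<longleftrightarrow> a = b"
  by (cases a; cases b) auto

lemma inj_enc_bool: "inj enc_bool"
  by (rule injI) simp

lemma enc_name_eq_iff [simp]: "enc_name a = enc_name b \<longleftrightarrow> a = b"
  unfolding enc_name_def enc_list_eq by (simp add: inj_map_eq_map inj_enc_bool)

lemma enc_var_eq_iff [simp]: "enc_var v = enc_var w \<longleftrightarrow> v = w"
  unfolding enc_var_def enc_pair_def by (auto simp: prod_eq_iff)

lemma right_enc_var [simp]: "right (enc_var v) = enc_name (snd v)"
  by (simp add: enc_var_def enc_pair_def)

lemma inj_enc_var: "inj enc_var"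
  by (rule injI) simp

lemma enc_var_image_eq_iff [simp]: "enc_var ` V = enc_var ` W \<longleftrightarrow> V = W"
  by (rule inj_image_eq_iff[OF inj_enc_var])

lemma path_tree_Nil [simp]: "path_tree [] = Leaf"
  by (simp add: path_tree_def)

lemma path_tree_snoc [simp]: "path_tree (i @ [n]) = Node (unary n) (path_tree i)"
  by (simp add: path_tree_def)

lemma unary_eq_iff [simp]: "unary m = unary n \<longleftrightarrow> m = n"
  unfolding unary_def by (metis length_replicate tlist_ttree)

lemma path_tree_eq_iff [simp]: "path_tree i = path_tree j \<longleftrightarrow> i = j"
proof -
  have "inj unary" by (rule injI) simp
  then show ?thesis unfolding path_tree_def by (simp add: inj_map_eq_map)
qed

lemma path_tree_Leaf_iff [simp]: "path_tree i = Leaf \<longleftrightarrow> i = []"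
  using path_tree_eq_iff[of i "[]"] by simp

lemma enc_tag_eq_iff [simp]: "enc_tag a b = enc_tag c d \<longleftrightarrow> a = c \<and> b = d"
  by (simp add: enc_tag_def)

lemma kids_enc_qc: "kids (enc_qc \<psi>) = map enc_qc (children \<psi>)"
  by (cases \<psi>) (auto simp: kids_def enc_list_eq)

lemma left_enc_qc_Atom: "left (enc_qc \<psi>) = enc_tag False False \<longleftrightarrow> (\<exists>R vs. \<psi> = Atom R vs)"
  by (cases \<psi>) auto

lemma left_enc_qc_Forall: "left (enc_qc \<psi>) = enc_tag True False \<longleftrightarrow> (\<exists>y \<chi>. \<psi> = Forall y \<chi>)"
  by (cases \<psi>) auto

lemma tsize_child: "\<psi> \<in> set (children \<chi>) \<Longrightarrow> tsize (enc_qc \<psi>) < tsize (enc_qc \<chi>)"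
proof (cases \<chi>)
  case (Conj \<psi>s)
  assume "\<psi> \<in> set (children \<chi>)"
  then have "enc_qc \<psi> \<in> set (tlist (right (enc_qc \<chi>)))" using Conj by (simp add: enc_list_eq)
  then have "tsize (enc_qc \<psi>) \<le> tsize (right (enc_qc \<chi>))" by (rule tsize_in_tlist)
  then show ?thesis using Conj by simp
qed auto

lemma length_index_less: "i \<in> indices \<phi> \<Longrightarrow> length i < tsize (enc_qc \<phi>)"
proof (induction \<phi> i rule: subformula.induct)
  case (1 \<phi>)
  then show ?case using tsize_pos[of "enc_qc \<phi>"] by simp
next
  case (2 \<phi> n i)
  then have n: "n < length (children \<phi>)" "i \<in> indices (children \<phi> ! n)"
    by (auto simp: indices_def split: if_splits)
  then show ?case using 2 tsize_child[of "children \<phi> ! n" \<phi>] by simp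
qed

lemma set_next_level:
  "set (tlist (next_level L)) = {Node (Node (unary n) (left e)) (kids (right e) ! n) | e n.
     e \<in> set (tlist L) \<and> n < length (kids (right e))}"
  unfolding next_level_def enum_def by fastforce

lemma set_levels:
  "set (tlist ((next_level ^^ n) (Node (Node Leaf (enc_qc \<phi>)) Leaf))) =
     {Node (path_tree i) (enc_qc (subf \<phi> i)) | i. i \<in> indices \<phi> \<and> length i = n}"
proof (induction n)
  case (Suc n)
  have "set (tlist ((next_level ^^ Suc n) (Node (Node Leaf (enc_qc \<phi>)) Leaf))) =
      {Node (Node (unary m) (path_tree i)) (kids (enc_qc (subf \<phi> i)) ! m) | i m.
        i \<in> indices \<phi> \<and> length i = n \<and> m < length (kids (enc_qc (subf \<phi> i)))}"
    unfolding funpow.simps comp_def set_next_level Suc by force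
  also have "\<dots> = {Node (path_tree (i @ [m])) (enc_qc (subf \<phi> (i @ [m]))) | i m.
        i @ [m] \<in> indices \<phi> \<and> length i = n}"
    unfolding kids_enc_qc by (fastforce simp: indices_snoc subf_snoc)
  also have "\<dots> = {Node (path_tree i) (enc_qc (subf \<phi> i)) | i. i \<in> indices \<phi> \<and> length i = Suc n}"
    unfolding length_Suc_conv_rev by blast
  finally show ?case .
qed (auto simp: subf_def)

lemma set_tuples: "l \<in> set (tuples k L) \<Longrightarrow> set (tlist l) \<subseteq> set L \<and> length (tlist l) \<le> k"
proof (induction k arbitrary: l)
  case (Suc k)
  then consider "l = Leaf" | e l' where "l = Node e l'" "e \<in> set L" "l' \<in> set (tuples k L)"
    by auto
  then show ?case using Suc.IH by cases auto
qed simp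

lemma tuples_complete:
  assumes "finite X" and "X \<subseteq> set L" and "card X \<le> k"
  shows "\<exists>l\<in>set (tuples k L). set (tlist l) = X"
  using assms
proof (induction X arbitrary: k)
  case empty
  have "Leaf \<in> set (tuples k L)" by (cases k) auto
  then show ?case by force
next
  case (insert a X)
  then obtain m where k: "k = Suc m" "card X \<le> m" by (cases k) auto
  then obtain l where "l \<in> set (tuples m L)" "set (tlist l) = X" using insert by auto
  then show ?case using insert.prems k by (intro bexI[of _ "Node a l"]) auto
qed

text \<open>The set that an \<open>OutT\<close> fact stores for \<open>f\<close>. On sets of trees
  the order and repetitions of a list are invisible, and \<open>left\<close> recovers the
  domain.\<close>

definition graph :: "((name, name) var \<rightharpoonup> name) \<Rightarrow> tree set" where
  "graph f = {Node (enc_var v) (enc_name b) | v b. f v = Some b}"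

lemma graph_mem_iff [simp]: "Node (enc_var v) (enc_name b) \<in> graph f \<longleftrightarrow> f v = Some b"
  unfolding graph_def by (simp del: split_paired_Ex)

lemma graph_leftD:
  "a \<in> graph f \<Longrightarrow> left a = enc_var v \<Longrightarrow> \<exists>b. f v = Some b \<and> a = Node (enc_var v) (enc_name b)"
  unfolding graph_def by auto

lemma graph_eq_iff [simp]: "graph f = graph g \<longleftrightarrow> f = g"
proof
  assume "graph f = graph g"
  then have "f v = Some b \<longleftrightarrow> g v = Some b" for v b
    using graph_mem_iff by metis
  then show "f = g" by (intro ext) (metis option.exhaust)
qed simp

lemma left_graph: "left ` graph f = enc_var ` dom f"
  unfolding graph_def by force

lemma graph_upd:
  "y \<notin> dom f \<Longrightarrow> graph (f(y \<mapsto> b)) = insert (Node (enc_var y) (enc_name b)) (graph f)"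
proof (intro equalityI subsetI)
  fix t assume y: "y \<notin> dom f" and "t \<in> graph (f(y \<mapsto> b))"
  then obtain v c where "t = Node (enc_var v) (enc_name c)" "(f(y \<mapsto> b)) v = Some c"
    unfolding graph_def by blast
  then show "t \<in> insert (Node (enc_var y) (enc_name b)) (graph f)" by (cases "v = y") auto
next
  fix t assume y: "y \<notin> dom f" and "t \<in> insert (Node (enc_var y) (enc_name b)) (graph f)"
  then consider "t = Node (enc_var y) (enc_name b)"
    | v c where "t = Node (enc_var v) (enc_name c)" "f v = Some c"
    unfolding graph_def by blast
  then show "t \<in> graph (f(y \<mapsto> b))" using y by cases auto
qed

lemma graph_empty [simp]: "graph Map.empty = {}"
  by (simp add: graph_def)

lemma finite_graph: "finite (dom f) \<Longrightarrow> finite (graph f) \<and> card (graph f) \<le> card (dom f)"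
proof -
  assume fin: "finite (dom f)"
  have "graph f = (\<lambda>v. Node (enc_var v) (enc_name (the (f v)))) ` dom f"
    unfolding graph_def by force
  then show ?thesis using fin card_image_le by simp
qed

lemma knownI: "Node tag (Node p l) \<in> set (tlist S) \<Longrightarrow> set (tlist l) = set L \<Longrightarrow> known S tag p L"
  unfolding known_def by (rule bexI[of _ "Node tag (Node p l)"]) simp_all

lemma tags_distinct [simp]:
  "FreeT \<noteq> AvailT" "FreeT \<noteq> OutT" "AvailT \<noteq> OutT" "AvailT \<noteq> FreeT" "OutT \<noteq> FreeT" "OutT \<noteq> AvailT"
  by (auto simp: FreeT_def AvailT_def OutT_def)

section \<open>Reading the instance off its encoding\<close>

locale encoded_instance =
  fixes k :: nat and \<phi> :: "(name, name, name) qc" and B :: "(name, name, name) struct"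
    and us :: sort_table and rs :: symbol_table and x :: tree
  assumes k_pos: "1 \<le> k" and inst: "qcsp_instance \<phi> B" and fin: "finite_struct B"
    and tables: "lists_struct us rs B"
    and x_def: "x = Node (enc_qc \<phi>)
           (Node (enc_list (enc_pair enc_name (enc_list enc_name)) us)
                 (enc_list (enc_pair enc_name
                     (enc_pair (enc_list enc_name) (enc_list (enc_list enc_name)))) rs))"
begin

lemma set_occs: "set (occs x) = {Node (path_tree i) (enc_qc (subf \<phi> i)) | i. i \<in> indices \<phi>}"
proof -
  have "set (occs x) = (\<Union>n<tsize (enc_qc \<phi>).
      set (tlist ((next_level ^^ n) (Node (Node Leaf (enc_qc \<phi>)) Leaf))))"
    unfolding occs_def x_def by (simp add: atLeast0LessThan)
  then show ?thesis unfolding set_levels using length_index_less by auto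
qed

lemma occ_right: "e \<in> set (occs x) \<Longrightarrow> left e = path_tree i \<Longrightarrow> right e = enc_qc (subf \<phi> i)"
  by (auto simp: set_occs)

definition atom_vars :: "(name, name) var set" where
  "atom_vars = {v. \<exists>i\<in>indices \<phi>. \<exists>R vs. subf \<phi> i = Atom R vs \<and> v \<in> set vs}"

lemma set_vars: "set (vars x) = enc_var ` atom_vars"
proof -
  have v: "w \<in> set (vars x) \<longleftrightarrow> (\<exists>e\<in>set (occs x). left (right e) = enc_tag False False \<and>
      w \<in> set (tlist (right (right (right e)))))" for w
    unfolding vars_def by (auto split: if_splits)
  have "w \<in> set (vars x) \<longleftrightarrow> (\<exists>i\<in>indices \<phi>. left (enc_qc (subf \<phi> i)) = enc_tag False False \<and>
      w \<in> set (tlist (right (right (enc_qc (subf \<phi> i))))))" for w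
    unfolding v set_occs by auto
  moreover have "left (enc_qc \<psi>) = enc_tag False False \<and> w \<in> set (tlist (right (right (enc_qc \<psi>)))) \<longleftrightarrow>
      (\<exists>R vs. \<psi> = Atom R vs \<and> w \<in> enc_var ` set vs)" for \<psi> w
    by (cases \<psi>) (simp_all add: enc_list_eq)
  ultimately show ?thesis unfolding atom_vars_def by blast
qed

lemma free_atom_vars: "i \<in> indices \<phi> \<Longrightarrow> free (subf \<phi> i) \<subseteq> atom_vars"
proof (induction "subf \<phi> i" arbitrary: i)
  case (Atom R vs)
  then show ?case unfolding atom_vars_def by (metis (mono_tags, lifting) free.simps(1) mem_Collect_eq subsetI)
next
  case (Conj \<psi>s)
  have "free \<psi> \<subseteq> atom_vars" if mem: "\<psi> \<in> set \<psi>s" for \<psi>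
  proof -
    obtain n where n: "n < length \<psi>s" "\<psi> = \<psi>s ! n" using mem by (auto simp: in_set_conv_nth)
    have j: "i @ [n] \<in> indices \<phi>" using Conj.prems n by (simp add: indices_snoc flip: Conj.hyps(2))
    then have "\<psi> = subf \<phi> (i @ [n])" using n by (simp add: subf_snoc flip: Conj.hyps(2))
    then show ?thesis using Conj.hyps(1)[OF _ j] mem by simp
  qed
  then show ?case by (auto simp flip: Conj.hyps(2))
next
  case (Forall y \<psi>)
  have j: "i @ [0] \<in> indices \<phi>" using Forall.prems by (simp add: indices_snoc flip: Forall.hyps(2))
  then have "\<psi> = subf \<phi> (i @ [0])" by (simp add: subf_snoc flip: Forall.hyps(2))
  then show ?case using Forall.hyps(1)[OF _ j] by (auto simp flip: Forall.hyps(2))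
next
  case (Exists y \<psi>)
  have j: "i @ [0] \<in> indices \<phi>" using Exists.prems by (simp add: indices_snoc flip: Exists.hyps(2))
  then have "\<psi> = subf \<phi> (i @ [0])" by (simp add: subf_snoc flip: Exists.hyps(2))
  then show ?case using Exists.hyps(1)[OF _ j] by (auto simp flip: Exists.hyps(2))
qed

lemma well_sorted_subf: "i \<in> indices \<phi> \<Longrightarrow> well_sorted B (subf \<phi> i)"
proof (induction i rule: rev_induct)
  case Nil
  then show ?case using inst by (simp add: qcsp_instance_def)
next
  case (snoc n i)
  have i: "i \<in> indices \<phi>" and n: "n < length (children (subf \<phi> i))" using snoc.prems indices_snoc by blast+
  have "\<psi> \<in> set (children \<chi>) \<Longrightarrow> well_sorted B \<chi> \<Longrightarrow> well_sorted B \<psi>" for \<psi> \<chi> :: "(name, name, name) qc"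
    by (cases \<chi>) (auto simp: list_all_iff)
  then show ?case using snoc.IH[OF i] n nth_mem subf_snoc[OF snoc.prems] by metis
qed

text \<open>The arity fixes the sorts of an atom's variables, and a signature draws arities from its
  sorts. \<open>finite_struct\<close> promises finite universes for just these sorts.\<close>

lemma atom_vars_sort: "v \<in> atom_vars \<Longrightarrow> sort_of v \<in> sorts B"
proof -
  assume "v \<in> atom_vars"
  then obtain i R vs where i: "i \<in> indices \<phi>" "subf \<phi> i = Atom R vs" "v \<in> set vs"
    unfolding atom_vars_def by blast
  then have "R \<in> symbols B" "map sort_of vs = arity B R" using well_sorted_subf[OF i(1)] by auto
  moreover have "is_signature B" using inst by (simp add: qcsp_instance_def is_struct_def)
  ultimately show ?thesis using i(3) unfolding is_signature_def by (metis image_eqI list.set_map subsetD)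
qed

lemma set_elems:
  assumes "v \<in> atom_vars"
  shows "set (elems x (enc_var v)) = enc_name ` univ B (sort_of v)"
proof -
  have t: "\<And>s bs. (s, bs) \<in> set us \<Longrightarrow> set bs = univ B s" "set (map fst us) = sorts B"
    using tables unfolding lists_struct_def by fast+
  obtain bs where bs: "(sort_of v, bs) \<in> set us" using atom_vars_sort[OF assms] t(2) by fastforce
  have "set (elems x (enc_var v)) = (\<Union>(s, bs)\<in>set us. if s = sort_of v then enc_name ` set bs else {})"
    unfolding elems_def x_def by (auto simp: enc_list_eq enc_pair_def split: if_splits)
  also have "\<dots> = enc_name ` univ B (sort_of v)"
  proof (intro equalityI subsetI)
    fix w assume "w \<in> (\<Union>(s, bs)\<in>set us. if s = sort_of v then enc_name ` set bs else {})"
    then obtain cs where "(sort_of v, cs) \<in> set us" "w \<in> enc_name ` set cs" by (auto split: if_splits)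
    then show "w \<in> enc_name ` univ B (sort_of v)" using t(1) by simp
  qed (use t(1)[OF bs] bs in \<open>auto intro!: bexI[OF _ bs]\<close>)
  finally show ?thesis .
qed

lemma set_pairs:
  "set (pairs x) = {Node (enc_var v) (enc_name b) | v b. v \<in> atom_vars \<and> b \<in> univ B (sort_of v)}"
proof -
  have "set (pairs x) = (\<Union>v\<in>atom_vars. Node (enc_var v) ` set (elems x (enc_var v)))"
    unfolding pairs_def by (auto simp: set_vars)
  then show ?thesis using set_elems by auto
qed

lemma rel_table:
  assumes "R \<in> symbols B"
  shows "(\<exists>r\<in>set (tlist (right (right x))). left r = enc_name R \<and>
      ttree (map enc_name bs) \<in> set (tlist (right (right r)))) \<longleftrightarrow> bs \<in> rel B R"
proof -
  have t: "\<And>R ss ts. (R, ss, ts) \<in> set rs \<Longrightarrow> set ts = rel B R" "set (map fst rs) = symbols B"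
    using tables unfolding lists_struct_def by fast+
  obtain ss ts where r: "(R, ss, ts) \<in> set rs" using assms t(2) by fastforce
  have inj: "inj enc_name" by (rule injI) simp
  have "(\<exists>r\<in>set (tlist (right (right x))). left r = enc_name R \<and>
      ttree (map enc_name bs) \<in> set (tlist (right (right r)))) \<longleftrightarrow>
      (\<exists>(R', ss, ts)\<in>set rs. R' = R \<and> bs \<in> set ts)"
    unfolding x_def by (force simp: enc_list_eq enc_pair_def inj_map_eq_map[OF inj])
  also have "\<dots> \<longleftrightarrow> bs \<in> rel B R" using t(1) r by fastforce
  finally show ?thesis .
qed

section \<open>Soundness of the rules\<close>

definition sem :: "tree \<Rightarrow> index \<Rightarrow> tree set \<Rightarrow> bool" where
  "sem tag i X \<longleftrightarrow> tag = FreeT \<and> (\<exists>V. V \<subseteq> free (subf \<phi> i) \<and> X = enc_var ` V) \<or>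
     tag = AvailT \<and> (\<exists>V. avail k \<phi> i V \<and> X = enc_var ` V) \<or>
     tag = OutT \<and> (\<exists>f. out k \<phi> B i f \<and> X = graph f)"

lemma sem_simps [simp]:
  "sem FreeT i X \<longleftrightarrow> (\<exists>V. V \<subseteq> free (subf \<phi> i) \<and> X = enc_var ` V)"
  "sem AvailT i X \<longleftrightarrow> (\<exists>V. avail k \<phi> i V \<and> X = enc_var ` V)"
  "sem OutT i X \<longleftrightarrow> (\<exists>f. out k \<phi> B i f \<and> X = graph f)"
  by (auto simp: sem_def)

definition sound :: "tree \<Rightarrow> bool" where
  "sound S \<longleftrightarrow> (\<forall>w\<in>set (tlist S). \<exists>i\<in>indices \<phi>. left (right w) = path_tree i \<and>
     sem (left w) i (set (tlist (right (right w)))))"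

lemma known_sem: "sound S \<Longrightarrow> known S tag (path_tree i) L \<Longrightarrow> sem tag i (set L)"
  unfolding sound_def known_def by fastforce

lemma known_avail: "sound S \<Longrightarrow> known S AvailT (path_tree i) L \<Longrightarrow> set L = enc_var ` V \<Longrightarrow> avail k \<phi> i V"
  by (drule (1) known_sem) auto

lemma known_out: "sound S \<Longrightarrow> known S OutT (path_tree i) L \<Longrightarrow> set L = graph f \<Longrightarrow> out k \<phi> B i f"
  by (drule (1) known_sem) auto

lemma all_free_sem:
  assumes "sound S" and "all_free S (path_tree i) L" and "set L = enc_var ` V"
  shows "V \<subseteq> free (subf \<phi> i)"
proof
  fix v assume "v \<in> V"
  then have "known S FreeT (path_tree i) [enc_var v]"
    using assms(2,3) unfolding all_free_def by blast
  from known_sem[OF assms(1) this] obtain W where "W \<subseteq> free (subf \<phi> i)" "enc_var ` {v} = enc_var ` W"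
    by auto
  then show "v \<in> free (subf \<phi> i)" unfolding enc_var_image_eq_iff by blast
qed

lemma child_occ:
  assumes "d \<in> set (occs x)" and "left d \<noteq> Leaf" and "right (left d) = path_tree i"
  obtains j where "parent \<phi> i j" "left d = path_tree j"
proof -
  obtain j where j: "j \<in> indices \<phi>" "d = Node (path_tree j) (enc_qc (subf \<phi> j))"
    using assms(1) set_occs by auto
  have "j \<noteq> []" using assms(2) j by auto
  then obtain i' n where "j = i' @ [n]" using rev_exhaust by blast
  moreover from this have "i' = i" using assms(3) j by simp
  ultimately have "parent \<phi> i j" using parent_snoc j(1) by blast
  then show thesis using that j by simp
qed

lemma parent_occ:
  assumes "parent \<phi> i j"
  obtains d where "d \<in> set (occs x)" "left d \<noteq> Leaf" "right (left d) = path_tree i" "left d = path_tree j"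
  using that[of "Node (path_tree j) (enc_qc (subf \<phi> j))"] assms by (auto simp: parent_def set_occs)

lemma flow_rule_sound:
  assumes "sound S" and "i \<in> indices \<phi>" and "flow_rule x S tag (path_tree i) l"
  obtains j where "parent \<phi> i j \<or> parent \<phi> j i" "sem tag j (set (tlist l))"
proof -
  consider d where "d \<in> set (occs x)" "left d \<noteq> Leaf" "right (left d) = path_tree i"
      "known S tag (left d) (tlist l)"
    | "path_tree i \<noteq> Leaf" "known S tag (right (path_tree i)) (tlist l)"
    using assms(3) unfolding flow_rule_def by blast
  then show thesis
  proof cases
    case 1
    then obtain j where "parent \<phi> i j" "left d = path_tree j" using child_occ by metis
    then show thesis using that[of j] known_sem[OF assms(1)] 1(4) by simp
  next
    case 2
    then obtain j n where j: "i = j @ [n]" using path_tree_Leaf_iff rev_exhaust by metis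
    then have "parent \<phi> j i" using parent_snoc assms(2) by blast
    then show thesis using that[of j] known_sem[OF assms(1)] 2(2) j by simp
  qed
qed

lemma free_rule_sound:
  assumes S: "sound S" and i: "i \<in> indices \<phi>" and r: "free_rule x S (path_tree i) l"
  shows "sem FreeT i (set (tlist l))"
proof -
  let ?t = "enc_qc (subf \<phi> i)"
  obtain e where e: "e \<in> set (occs x)" "left e = path_tree i"
    and "left (right e) = enc_tag False False \<and> set (tlist l) \<subseteq> set (tlist (right (right (right e)))) \<or>
      (\<exists>d\<in>set (occs x). left d \<noteq> Leaf \<and> right (left d) = path_tree i \<and> known S FreeT (left d) (tlist l) \<and>
        (left (left (right e)) \<noteq> Leaf \<longrightarrow> left (right (right e)) \<notin> set (tlist l)))"
    using r unfolding free_rule_def by blast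
  then consider "left ?t = enc_tag False False" "set (tlist l) \<subseteq> set (tlist (right (right ?t)))"
    | d where "d \<in> set (occs x)" "left d \<noteq> Leaf" "right (left d) = path_tree i"
      "known S FreeT (left d) (tlist l)" "left (left ?t) \<noteq> Leaf \<longrightarrow> left (right ?t) \<notin> set (tlist l)"
    unfolding occ_right[OF e] by blast
  then show ?thesis
  proof cases
    case 1
    then obtain R vs where "subf \<phi> i = Atom R vs" using left_enc_qc_Atom by blast
    then show ?thesis using 1(2) by (simp add: enc_list_eq subset_image_iff)
  next
    case 2
    then obtain j where j: "parent \<phi> i j" "left d = path_tree j" using child_occ by metis
    have "sem FreeT j (set (tlist l))" using 2(4) unfolding j(2) by (rule known_sem[OF S])
    then obtain V where V: "V \<subseteq> free (subf \<phi> j)" "set (tlist l) = enc_var ` V" by auto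
    \<comment> \<open>A conjunction inherits the free variables of its child; for a quantifier the
      rule has checked that the bound variable is not in the list.\<close>
    have "V \<subseteq> free (subf \<phi> i)"
      using parent_child[OF j(1)] V 2(5) by (cases "subf \<phi> i") (auto simp: enc_tag_def)
    then show ?thesis using V(2) by auto
  qed
qed

lemma avail_rule_sound:
  assumes S: "sound S" and i: "i \<in> indices \<phi>" and r: "avail_rule x S (path_tree i) l"
    and l: "l \<in> set (tuples k (vars x))"
  shows "sem AvailT i (set (tlist l))"
proof -
  let ?t = "enc_qc (subf \<phi> i)"
  obtain V where V: "set (tlist l) = enc_var ` V"
    using set_tuples[OF l] set_vars by (metis subset_image_iff)
  have card: "card V \<le> k"
  proof -
    have "card V = card (set (tlist l))"
      unfolding V by (rule card_image[symmetric]) (meson inj_enc_var inj_on_subset subset_UNIV)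
    also have "\<dots> \<le> k" using set_tuples[OF l] card_length[of "tlist l"] by linarith
    finally show ?thesis .
  qed
  consider (atom) "left ?t = enc_tag False False" "set (tlist l) = set (tlist (right (right ?t)))"
    | (drop) y where "known S AvailT (path_tree i) (y # tlist l)" "y \<in> set (vars x)"
    | (add) w y where "w \<in> set (tlist S)" "left w = AvailT" "left (right w) = path_tree i"
        "y \<in> set (vars x)" "known S AvailT (path_tree i) [y]"
        "set (y # tlist (right (right w))) = set (tlist l)"
    | (flow) "all_free S (path_tree i) (tlist l)" "flow_rule x S AvailT (path_tree i) l"
    using r unfolding avail_rule_def by (auto simp: set_occs)
  then have "avail k \<phi> i V"
  proof cases
    case atom
    then obtain R vs where a: "subf \<phi> i = Atom R vs" using left_enc_qc_Atom by blast
    have "enc_var ` V = enc_var ` set vs" using atom(2) a V by (simp add: enc_list_eq)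
    then have "V = set vs" by simp
    then show ?thesis using avail_atom[OF i a] card by simp
  next
    case drop
    then obtain v where "y = enc_var v" using set_vars by auto
    then have "avail k \<phi> i (insert v V)" using known_avail[OF S drop(1), of "insert v V"] V by simp
    then show ?thesis by (rule avail_drop)
  next
    case add
    then obtain v where v: "y = enc_var v" using set_vars by auto
    have "known S AvailT (path_tree i) (tlist (right (right w)))"
      unfolding known_def using add by blast
    then have "sem AvailT i (set (tlist (right (right w))))" by (rule known_sem[OF S])
    then obtain W where W: "avail k \<phi> i W" "set (tlist (right (right w))) = enc_var ` W" by auto
    have "avail k \<phi> i {v}" using known_avail[OF S add(5), of "{v}"] v by simp
    moreover have "enc_var ` insert v W = enc_var ` V" using add(6) V W(2) v by simp
    then have "insert v W = V" unfolding enc_var_image_eq_iff .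
    ultimately show ?thesis using avail_add[OF W(1), of v] card by simp
  next
    case flow
    obtain j where j1: "parent \<phi> i j \<or> parent \<phi> j i" and "sem AvailT j (set (tlist l))"
      using flow_rule_sound[OF S i flow(2)] .
    then obtain W where j: "avail k \<phi> j W" "set (tlist l) = enc_var ` W"
      by auto
    have "W = V" using V j(2) by simp
    then show ?thesis
      using all_free_sem[OF S flow(1) V] j1 j(1) avail_up[of k \<phi> j V i] avail_down[of k \<phi> j V i] by auto
  qed
  then show ?thesis using V by auto
qed

text \<open>Entries taken from \<open>pairs\<close> have values in the universe of the right sort,
  and consistency makes the set of entries functional.\<close>

lemma consistent_graph:
  assumes "consistent l" and "set (tlist l) \<subseteq> set (pairs x)"
  obtains f where "set (tlist l) = graph f" "f \<in> maps B (dom f)"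
proof -
  define f where "f v = (if \<exists>b. Node (enc_var v) (enc_name b) \<in> set (tlist l)
    then Some (SOME b. Node (enc_var v) (enc_name b) \<in> set (tlist l)) else None)" for v
  have f: "f v = Some b \<longleftrightarrow> Node (enc_var v) (enc_name b) \<in> set (tlist l)" for v b
  proof
    assume "f v = Some b"
    then show "Node (enc_var v) (enc_name b) \<in> set (tlist l)"
      unfolding f_def by (metis (mono_tags, lifting) option.distinct(1) option.inject someI_ex)
  next
    assume b: "Node (enc_var v) (enc_name b) \<in> set (tlist l)"
    then have "Node (enc_var v) (enc_name (SOME b. Node (enc_var v) (enc_name b) \<in> set (tlist l))) \<in> set (tlist l)"
      by (metis (mono_tags, lifting) someI_ex)
    then have "(SOME b. Node (enc_var v) (enc_name b) \<in> set (tlist l)) = b"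
      using assms(1) b unfolding consistent_def by fastforce
    then show "f v = Some b" unfolding f_def using b by auto
  qed
  have "set (tlist l) = graph f"
    unfolding graph_def f using assms(2) unfolding set_pairs by blast
  moreover have "f \<in> maps B (dom f)"
    unfolding maps_def using f assms(2) unfolding set_pairs by force
  ultimately show thesis by (rule that)
qed

lemma val_graph:
  assumes "set (tlist l) = graph f" and "v \<in> dom f"
  shows "val l (enc_var v) = enc_name (the (f v))"
proof -
  obtain b where b: "f v = Some b" using assms(2) by blast
  let ?F = "filter (\<lambda>a. left a = enc_var v) (tlist l)"
  have F: "set ?F = {Node (enc_var v) (enc_name b)}"
    using assms(1) b graph_leftD[of _ f v] by auto
  then obtain a F' where "?F = a # F'" by (cases ?F) auto
  moreover from this have "a = Node (enc_var v) (enc_name b)" using F by auto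
  ultimately show ?thesis using b by (simp add: val_def)
qed

lemma map_val_graph:
  "set (tlist l) = graph f \<Longrightarrow> dom f = set vs \<Longrightarrow>
   map (\<lambda>v. val l v) (map enc_var vs) = map enc_name (map (\<lambda>v. the (f v)) vs)"
  using val_graph by simp

lemma card_dom_le:
  assumes "l \<in> set (tuples k L)" and "set (tlist l) = graph f"
  shows "card (dom f) \<le> k"
proof -
  have "card (dom f) = card (enc_var ` dom f)"
    by (rule card_image[symmetric]) (meson inj_enc_var inj_on_subset subset_UNIV)
  also have "\<dots> = card (left ` set (tlist l))" unfolding assms(2) left_graph ..
  also have "\<dots> \<le> length (tlist l)" by (meson card_image_le card_length finite_set order_trans)
  also have "\<dots> \<le> k" using set_tuples[OF assms(1)] by blast
  finally show ?thesis .
qed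

lemma out_rule_sound:
  assumes S: "sound S" and i: "i \<in> indices \<phi>" and r: "out_rule x S (path_tree i) l"
    and l: "l \<in> set (tuples k (pairs x))"
  shows "sem OutT i (set (tlist l))"
proof -
  let ?t = "enc_qc (subf \<phi> i)"
  have lp: "set (tlist l) \<subseteq> set (pairs x)" using set_tuples[OF l] by blast
  consider (atom) "consistent l" "left ?t = enc_tag False False"
        "set (map left (tlist l)) = set (tlist (right (right ?t)))"
        "\<not> (\<exists>r\<in>set (tlist (right (right x))). left r = left (right ?t) \<and>
          ttree (map (\<lambda>v. val l v) (tlist (right (right ?t)))) \<in> set (tlist (right (right r))))"
    | (proj) y where "consistent l" "y \<in> set (vars x)" "y \<notin> set (map left (tlist l))"
        "known S AvailT (path_tree i) (y # map left (tlist l))"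
        "\<forall>b\<in>set (elems x y). known S OutT (path_tree i) (Node y b # tlist l)"
    | (ext) w a where "w \<in> set (tlist S)" "left w = OutT" "left (right w) = path_tree i"
        "a \<in> set (pairs x)" "left a \<notin> set (map left (tlist (right (right w))))"
        "known S AvailT (path_tree i) (left a # map left (tlist (right (right w))))"
        "set (a # tlist (right (right w))) = set (tlist l)"
    | (flow) "all_free S (path_tree i) (map left (tlist l))" "flow_rule x S OutT (path_tree i) l"
    | (all) b d where "left ?t = enc_tag True False" "left (right ?t) \<notin> set (map left (tlist l))"
        "b \<in> set (elems x (left (right ?t)))" "d \<in> set (occs x)" "left d \<noteq> Leaf" "right (left d) = path_tree i"
        "known S OutT (left d) (Node (left (right ?t)) b # tlist l)"
    using r unfolding out_rule_def
    apply (elim disjE conjE bexE)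
    subgoal premises p for e
    proof -
      have t: "right e = ?t" by (rule occ_right) (use p in auto)
      show thesis using p(6-) unfolding t by (intro p(1))
    qed
    subgoal premises p for y using p(2)[of y] p(6-) by blast
    subgoal premises p for w a using p(3)[of w a] p(6-) by blast
    subgoal premises p using p(4) p(6-) by blast
    subgoal premises p for e b d
    proof -
      have t: "right e = ?t" by (rule occ_right) (use p in auto)
      show thesis using p(6-) unfolding t by (intro p(5)[of b d])
    qed
    done
  then show ?thesis
  proof cases
    case atom
    then obtain R vs where a: "subf \<phi> i = Atom R vs" using left_enc_qc_Atom by blast
    obtain f where f: "set (tlist l) = graph f" "f \<in> maps B (dom f)"
      using consistent_graph[OF atom(1) lp] .
    have "enc_var ` dom f = enc_var ` set vs"
      using atom(3) a unfolding set_map f(1) left_graph by (simp add: enc_list_eq)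
    then have dom: "dom f = set vs" by simp
    have R: "R \<in> symbols B" using well_sorted_subf[OF i] a by simp
    have "map (\<lambda>v. the (f v)) vs \<notin> rel B R"
    proof -
      have "\<not> (\<exists>r\<in>set (tlist (right (right x))). left r = enc_name R \<and>
          ttree (map (\<lambda>v. val l v) (map enc_var vs)) \<in> set (tlist (right (right r))))"
        using atom(4) a by (simp add: enc_list_eq)
      then show ?thesis unfolding map_val_graph[OF f(1) dom] rel_table[OF R] .
    qed
    then have "out k \<phi> B i f"
      using out_atom[OF i a] card_dom_le[OF l f(1)] f(2) dom by simp
    then show ?thesis using f(1) by auto
  next
    case proj
    obtain f where f: "set (tlist l) = graph f" "f \<in> maps B (dom f)"
      using consistent_graph[OF proj(1) lp] .
    obtain v where v: "y = enc_var v" "v \<in> atom_vars" using proj(2) set_vars by auto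
    have vd: "v \<notin> dom f" using proj(3) v unfolding set_map f(1) left_graph by auto
    have "avail k \<phi> i (insert v (dom f))"
      using known_avail[OF S proj(4), of "insert v (dom f)"] v f(1) left_graph[of f] by simp
    moreover have "out k \<phi> B i (f(v \<mapsto> b))" if "b \<in> univ B (sort_of v)" for b
      using proj(5) v set_elems[OF v(2)] that f(1) graph_upd[OF vd, of b]
      by (intro known_out[OF S, of i "Node y (enc_name b) # tlist l"]) auto
    ultimately have "out k \<phi> B i f" using out_proj vd f(2) by blast
    then show ?thesis using f(1) by auto
  next
    case ext
    obtain v b where a: "a = Node (enc_var v) (enc_name b)" "b \<in> univ B (sort_of v)"
      using ext(4) set_pairs by auto
    have "known S OutT (path_tree i) (tlist (right (right w)))"
      unfolding known_def using ext by blast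
    then have "sem OutT i (set (tlist (right (right w))))" by (rule known_sem[OF S])
    then obtain f where f: "out k \<phi> B i f" "set (tlist (right (right w))) = graph f" by auto
    have vd: "v \<notin> dom f" using ext(5) a unfolding set_map f(2) left_graph by auto
    have "avail k \<phi> i (insert v (dom f))"
      using known_avail[OF S ext(6), of "insert v (dom f)"] a f(2) left_graph[of f] by simp
    from out_ext[OF f(1) this vd a(2)] have "out k \<phi> B i (f(v \<mapsto> b))" .
    moreover have "set (tlist l) = graph (f(v \<mapsto> b))"
      using ext(7) a f(2) graph_upd[OF vd, of b] by simp
    ultimately show ?thesis unfolding sem_simps by blast
  next
    case flow
    obtain j where j1: "parent \<phi> i j \<or> parent \<phi> j i" and "sem OutT j (set (tlist l))"
      using flow_rule_sound[OF S i flow(2)] .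
    then obtain f where j: "out k \<phi> B j f" "set (tlist l) = graph f"
      by auto
    have "dom f \<subseteq> free (subf \<phi> i)"
      using all_free_sem[OF S flow(1), of "dom f"] j(2) left_graph[of f] by simp
    then have "out k \<phi> B i f" using j1 j(1) out_up[of k \<phi> B j f i] out_down[of k \<phi> B j f i] by auto
    then show ?thesis using j(2) by auto
  next
    case all
    obtain y \<chi> where y: "subf \<phi> i = Forall y \<chi>" using all(1) left_enc_qc_Forall by blast
    obtain j where j: "parent \<phi> i j" "left d = path_tree j" using child_occ all(4-6) by metis
    have \<chi>: "\<chi> = subf \<phi> j" using parent_child[OF j(1)] y by simp
    have "sem OutT j (set (Node (left (right ?t)) b # tlist l))"
      using all(7) unfolding j(2) by (rule known_sem[OF S])
    then obtain g where g: "out k \<phi> B j g" "insert (Node (enc_var y) b) (set (tlist l)) = graph g"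
      using y by auto
    have ny: "enc_var y \<notin> left ` set (tlist l)" using all(2) y by simp
    have "Node (enc_var y) b \<in> graph g" using g(2) by blast
    then obtain c where c: "b = enc_name c" "g y = Some c" unfolding graph_def by auto
    \<comment> \<open>The stored fact concerns a map \<open>g\<close> defined at \<open>y\<close>;
      removing \<open>y\<close> gives the map excluded at the parent.\<close>
    define f where "f = g(y := None)"
    have yd: "y \<notin> dom f" and gf: "g = f(y \<mapsto> c)" unfolding f_def using c(2) by auto
    \<comment> \<open>Inserting the pair for \<open>y\<close> makes the two sets equal. As neither
      contains it beforehand, \<open>insert_ident\<close> cancels the insertion.\<close>
    have "Node (enc_var y) b \<notin> set (tlist l)" "Node (enc_var y) b \<notin> graph f"
      using ny yd left_graph[of f] by (force, force)
    moreover have "insert (Node (enc_var y) b) (set (tlist l)) = insert (Node (enc_var y) b) (graph f)"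
      using g(2) graph_upd[OF yd, of c] gf c(1) by simp
    ultimately have "set (tlist l) = graph f" by (rule iffD1[OF insert_ident])
    moreover have "out k \<phi> B i f"
      using out_all[of k \<phi> B j f y c i] g(1) gf yd y \<chi> j(1) by simp
    ultimately show ?thesis by auto
  qed
qed

lemma set_candidates:
  "u \<in> set (candidates k x) \<longleftrightarrow> (\<exists>i\<in>indices \<phi>. \<exists>tag l. u = Node tag (Node (path_tree i) l) \<and>
     (tag = FreeT \<and> l \<in> set (tuples k (vars x)) \<or> tag = AvailT \<and> l \<in> set (tuples k (vars x)) \<or>
      tag = OutT \<and> l \<in> set (tuples k (pairs x))))"
  unfolding candidates_def by (auto simp: set_occs)

lemma sound_step: "sound S \<Longrightarrow> sound (saturate_step k x S)"
proof -
  assume S: "sound S"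
  have "\<exists>i\<in>indices \<phi>. left (right u) = path_tree i \<and> sem (left u) i (set (tlist (right (right u))))"
    if u: "u \<in> set (candidates k x)" "fact_rule x S u" for u
  proof -
    obtain i tag l where i: "i \<in> indices \<phi>" "u = Node tag (Node (path_tree i) l)"
      "tag = FreeT \<and> l \<in> set (tuples k (vars x)) \<or> tag = AvailT \<and> l \<in> set (tuples k (vars x)) \<or>
       tag = OutT \<and> l \<in> set (tuples k (pairs x))"
      using u(1) set_candidates by auto
    have "sem tag i (set (tlist l))"
      using i u(2) free_rule_sound[OF S i(1), of l] avail_rule_sound[OF S i(1), of l]
        out_rule_sound[OF S i(1), of l]
      unfolding fact_rule_def by (auto simp del: sem_simps)
    then show ?thesis using i by auto
  qed
  then show ?thesis using S unfolding sound_def saturate_step_def by auto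
qed

lemma sound_saturate: "sound (saturate k x)"
proof -
  have "sound ((saturate_step k x ^^ n) Leaf)" for n
    by (induction n) (auto simp: sound_step, simp add: sound_def)
  then show ?thesis by (simp add: saturate_eq_funpow)
qed

section \<open>Completeness of the rules\<close>

lemma saturate_closed:
  "u \<in> set (candidates k x) \<Longrightarrow> fact_rule x (saturate k x) u \<Longrightarrow> u \<in> set (tlist (saturate k x))"
  by (subst saturate_fixpoint[symmetric]) (simp add: saturate_step_def)

text \<open>Here \<open>1 \<le> k\<close> enters: singletons have to be among the
  candidates.\<close>

lemma known_freeI:
  assumes "i \<in> indices \<phi>" and "v \<in> atom_vars"
    and "\<And>l. set (tlist l) = {enc_var v} \<Longrightarrow> free_rule x (saturate k x) (path_tree i) l"
  shows "known (saturate k x) FreeT (path_tree i) [enc_var v]"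
proof -
  obtain l where l: "l \<in> set (tuples k (vars x))" "set (tlist l) = {enc_var v}"
    using tuples_complete[of "{enc_var v}" "vars x" k] assms(2) k_pos set_vars by auto
  have "Node FreeT (Node (path_tree i) l) \<in> set (tlist (saturate k x))"
    using assms(1,3) l by (intro saturate_closed) (auto simp: set_candidates fact_rule_def)
  then show ?thesis by (rule knownI) (simp add: l(2))
qed

text \<open>Which list represents \<open>V\<close> among the candidates is left open, so the rule is
  required for every list \<open>l\<close> with the right set of entries. The list \<open>L\<close>
  of the conclusion is independent of it.\<close>

lemma known_availI:
  assumes "avail k \<phi> i V"
    and "\<And>l. set (tlist l) = enc_var ` V \<Longrightarrow> avail_rule x (saturate k x) (path_tree i) l"
    and "set L = enc_var ` V"
  shows "known (saturate k x) AvailT (path_tree i) L"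
proof -
  have V: "i \<in> indices \<phi>" "V \<subseteq> atom_vars" "finite V" "card V \<le> k"
    using avail_facts[OF assms(1)] avail_finite[OF assms(1)] free_atom_vars[of i] by auto
  then have "card (enc_var ` V) \<le> k" using card_image_le[of V enc_var] by linarith
  then obtain l where l: "l \<in> set (tuples k (vars x))" "set (tlist l) = enc_var ` V"
    using tuples_complete[of "enc_var ` V" "vars x" k] V set_vars by auto
  have "Node AvailT (Node (path_tree i) l) \<in> set (tlist (saturate k x))"
    using V(1) assms(2) l by (intro saturate_closed) (auto simp: set_candidates fact_rule_def)
  then show ?thesis by (rule knownI) (simp add: l(2) assms(3))
qed

lemma known_outI:
  assumes "out k \<phi> B i f"
    and "\<And>l. set (tlist l) = graph f \<Longrightarrow> out_rule x (saturate k x) (path_tree i) l"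
    and "set L = graph f"
  shows "known (saturate k x) OutT (path_tree i) L"
proof -
  have av: "avail k \<phi> i (dom f)" and f: "f \<in> maps B (dom f)" using out_facts[OF assms(1)] by auto
  have V: "i \<in> indices \<phi>" "dom f \<subseteq> atom_vars" "card (dom f) \<le> k"
    using avail_facts[OF av] free_atom_vars[of i] by auto
  have "graph f \<subseteq> set (pairs x)"
  proof
    fix t assume "t \<in> graph f"
    then obtain v b where t: "t = Node (enc_var v) (enc_name b)" "f v = Some b"
      unfolding graph_def by blast
    then have v: "v \<in> dom f" by blast
    then have "the (f v) \<in> univ B (sort_of v)" using f unfolding maps_def by blast
    then have "b \<in> univ B (sort_of v)" using t(2) by simp
    then show "t \<in> set (pairs x)" unfolding set_pairs t(1) using V(2) v by blast
  qed
  then obtain l where l: "l \<in> set (tuples k (pairs x))" "set (tlist l) = graph f"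
    using tuples_complete[of "graph f" "pairs x" k] finite_graph[OF avail_finite[OF av]] V(3) by auto
  have "Node OutT (Node (path_tree i) l) \<in> set (tlist (saturate k x))"
    using V(1) assms(2) l by (intro saturate_closed) (auto simp: set_candidates fact_rule_def)
  then show ?thesis by (rule knownI) (simp add: l(2) assms(3))
qed

lemma occ_mem: "i \<in> indices \<phi> \<Longrightarrow> Node (path_tree i) (enc_qc (subf \<phi> i)) \<in> set (occs x)"
  by (auto simp: set_occs)

lemma known_free:
  "i \<in> indices \<phi> \<Longrightarrow> v \<in> free (subf \<phi> i) \<Longrightarrow> known (saturate k x) FreeT (path_tree i) [enc_var v]"
proof (induction "subf \<phi> i" arbitrary: i)
  case (Atom R vs)
  have "v \<in> atom_vars" using free_atom_vars Atom.prems by blast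
  then show ?case
  proof (rule known_freeI[OF Atom.prems(1)])
    fix l assume "set (tlist l) = {enc_var v}"
    then show "free_rule x (saturate k x) (path_tree i) l"
      unfolding free_rule_def using Atom.prems
      by (intro bexI[OF _ occ_mem[OF Atom.prems(1)]]) (simp add: enc_list_eq flip: Atom.hyps)
  qed
next
  case (Conj \<psi>s)
  have av: "v \<in> atom_vars" using free_atom_vars Conj.prems by blast
  obtain n where n: "n < length \<psi>s" "v \<in> free (\<psi>s ! n)"
    using Conj.prems(2) unfolding Conj.hyps(2)[symmetric] by (auto simp: in_set_conv_nth)
  have j: "i @ [n] \<in> indices \<phi>" using Conj.prems n by (simp add: indices_snoc flip: Conj.hyps(2))
  then have sj: "\<psi>s ! n = subf \<phi> (i @ [n])" using n by (simp add: subf_snoc flip: Conj.hyps(2))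
  have IH: "known (saturate k x) FreeT (path_tree (i @ [n])) [enc_var v]"
    using Conj.hyps(1)[OF _ j] nth_mem[OF n(1)] n(2) sj by simp
  show ?case
  proof (rule known_freeI[OF Conj.prems(1) av])
    fix l assume l: "set (tlist l) = {enc_var v}"
    then have "known (saturate k x) FreeT (path_tree (i @ [n])) (tlist l)"
      using IH unfolding known_def by simp
    then show "free_rule x (saturate k x) (path_tree i) l"
      unfolding free_rule_def
      by (intro bexI[OF _ occ_mem[OF Conj.prems(1)]])
        (use occ_mem[OF j] in \<open>force simp: enc_tag_def simp flip: Conj.hyps(2)\<close>)
  qed
next
  case (Forall y \<psi>)
  have av: "v \<in> atom_vars" using free_atom_vars Forall.prems by blast
  have v: "v \<in> free \<psi>" "v \<noteq> y" using Forall.prems(2) unfolding Forall.hyps(2)[symmetric] by auto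
  have j: "i @ [0] \<in> indices \<phi>" using Forall.prems by (simp add: indices_snoc flip: Forall.hyps(2))
  then have sj: "\<psi> = subf \<phi> (i @ [0])" by (simp add: subf_snoc flip: Forall.hyps(2))
  have IH: "known (saturate k x) FreeT (path_tree (i @ [0])) [enc_var v]"
    using Forall.hyps(1)[OF sj j] v(1) sj by simp
  show ?case
  proof (rule known_freeI[OF Forall.prems(1) av])
    fix l assume l: "set (tlist l) = {enc_var v}"
    then have "known (saturate k x) FreeT (path_tree (i @ [0])) (tlist l)"
      using IH unfolding known_def by simp
    then show "free_rule x (saturate k x) (path_tree i) l"
      unfolding free_rule_def
      by (intro bexI[OF _ occ_mem[OF Forall.prems(1)]])
        (use occ_mem[OF j] v(2) l in \<open>force simp flip: Forall.hyps(2)\<close>)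
  qed
next
  case (Exists y \<psi>)
  have av: "v \<in> atom_vars" using free_atom_vars Exists.prems by blast
  have v: "v \<in> free \<psi>" "v \<noteq> y" using Exists.prems(2) unfolding Exists.hyps(2)[symmetric] by auto
  have j: "i @ [0] \<in> indices \<phi>" using Exists.prems by (simp add: indices_snoc flip: Exists.hyps(2))
  then have sj: "\<psi> = subf \<phi> (i @ [0])" by (simp add: subf_snoc flip: Exists.hyps(2))
  have IH: "known (saturate k x) FreeT (path_tree (i @ [0])) [enc_var v]"
    using Exists.hyps(1)[OF sj j] v(1) sj by simp
  show ?case
  proof (rule known_freeI[OF Exists.prems(1) av])
    fix l assume l: "set (tlist l) = {enc_var v}"
    then have "known (saturate k x) FreeT (path_tree (i @ [0])) (tlist l)"
      using IH unfolding known_def by simp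
    then show "free_rule x (saturate k x) (path_tree i) l"
      unfolding free_rule_def
      by (intro bexI[OF _ occ_mem[OF Exists.prems(1)]])
        (use occ_mem[OF j] v(2) l in \<open>force simp flip: Exists.hyps(2)\<close>)
  qed
qed

lemma all_freeI:
  "i \<in> indices \<phi> \<Longrightarrow> set L = enc_var ` V \<Longrightarrow> V \<subseteq> free (subf \<phi> i) \<Longrightarrow>
   all_free (saturate k x) (path_tree i) L"
  unfolding all_free_def using known_free by auto

lemma flow_ruleI:
  assumes "known S tag (path_tree j) (tlist l)" and "parent \<phi> i j \<or> parent \<phi> j i"
  shows "flow_rule x S tag (path_tree i) l"
  using assms(2)
proof
  assume "parent \<phi> i j"
  then obtain d where "d \<in> set (occs x)" "left d \<noteq> Leaf" "right (left d) = path_tree i" "left d = path_tree j"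
    by (rule parent_occ)
  moreover from this have "known S tag (left d) (tlist l)" using assms(1) by simp
  ultimately show ?thesis unfolding flow_rule_def by blast
next
  assume "parent \<phi> j i"
  then show ?thesis unfolding flow_rule_def parent_def using assms(1) by auto
qed

lemma known_avail_complete:
  "avail k \<phi> i V \<Longrightarrow> set L = enc_var ` V \<Longrightarrow> known (saturate k x) AvailT (path_tree i) L"
proof (induction arbitrary: L rule: avail.induct)
  case (avail_atom i R vs)
  show ?case
  proof (rule known_availI[OF avail.avail_atom[OF avail_atom.hyps] _ avail_atom.prems])
    fix l assume "set (tlist l) = enc_var ` set vs"
    then show "avail_rule x (saturate k x) (path_tree i) l"
      unfolding avail_rule_def using avail_atom.hyps(2)
      by (intro disjI1 bexI[OF _ occ_mem[OF avail_atom.hyps(1)]]) (simp add: enc_list_eq)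
  qed
next
  case (avail_drop i y V)
  show ?case
  proof (rule known_availI[OF avail.avail_drop[OF avail_drop.hyps] _ avail_drop.prems])
    fix l assume "set (tlist l) = enc_var ` V"
    then have "known (saturate k x) AvailT (path_tree i) (enc_var y # tlist l)"
      by (intro avail_drop.IH) simp
    moreover have "enc_var y \<in> set (vars x)"
      using avail_facts[OF avail_drop.hyps] free_atom_vars[of i] set_vars by auto
    ultimately show "avail_rule x (saturate k x) (path_tree i) l"
      unfolding avail_rule_def by blast
  qed
next
  case (avail_add i V y)
  show ?case
  proof (rule known_availI[OF avail.avail_add[OF avail_add.hyps] _ avail_add.prems])
    fix l assume l: "set (tlist l) = enc_var ` insert y V"
    \<comment> \<open>The induction hypothesis speaks about lists, so some list for \<open>V\<close>
      is chosen to find the stored fact \<open>w\<close>; the rule then uses the entries of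
      \<open>w\<close>.\<close>
    obtain L' where L': "set L' = enc_var ` V"
      using finite_list[of "enc_var ` V"] avail_finite[OF avail_add.hyps(1)] by blast
    obtain w where w: "w \<in> set (tlist (saturate k x))" "left w = AvailT" "left (right w) = path_tree i"
      "set (tlist (right (right w))) = enc_var ` V"
      using avail_add.IH(1)[OF L'] L' unfolding known_def by auto
    have "known (saturate k x) AvailT (path_tree i) [enc_var y]" by (intro avail_add.IH(2)) simp
    moreover have "enc_var y \<in> set (vars x)"
      using avail_facts[OF avail_add.hyps(2)] free_atom_vars[of i] set_vars by auto
    ultimately show "avail_rule x (saturate k x) (path_tree i) l"
      unfolding avail_rule_def using w l
      by (intro disjI2 disjI1) (intro bexI[of _ w] conjI bexI[of _ "enc_var y"], auto)
  qed
next
  case (avail_up j V i)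
  show ?case
  proof (rule known_availI[OF avail.avail_up[OF avail_up.hyps] _ avail_up.prems])
    fix l assume l: "set (tlist l) = enc_var ` V"
    have "i \<in> indices \<phi>" using avail_up.hyps by (simp add: parent_def)
    then have "all_free (saturate k x) (path_tree i) (tlist l)" using all_freeI l avail_up.hyps by blast
    then show "avail_rule x (saturate k x) (path_tree i) l"
      unfolding avail_rule_def using flow_ruleI[OF avail_up.IH[OF l]] avail_up.hyps by blast
  qed
next
  case (avail_down j V i)
  show ?case
  proof (rule known_availI[OF avail.avail_down[OF avail_down.hyps] _ avail_down.prems])
    fix l assume l: "set (tlist l) = enc_var ` V"
    have "i \<in> indices \<phi>" using avail_down.hyps by (simp add: parent_def)
    then have "all_free (saturate k x) (path_tree i) (tlist l)" using all_freeI l avail_down.hyps by blast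
    then show "avail_rule x (saturate k x) (path_tree i) l"
      unfolding avail_rule_def using flow_ruleI[OF avail_down.IH[OF l]] avail_down.hyps by blast
  qed
qed

lemma consistentI: "set (tlist l) = graph f \<Longrightarrow> consistent l"
  unfolding consistent_def graph_def by auto

lemma set_map_left: "set (tlist l) = graph f \<Longrightarrow> set (map left (tlist l)) = enc_var ` dom f"
  by (simp add: left_graph)

lemma known_out_complete:
  "out k \<phi> B i f \<Longrightarrow> set L = graph f \<Longrightarrow> known (saturate k x) OutT (path_tree i) L"
proof (induction arbitrary: L rule: out.induct)
  case (out_atom i R vs f)
  show ?case
  proof (rule known_outI[OF out.out_atom[OF out_atom.hyps] _ out_atom.prems])
    fix l assume l: "set (tlist l) = graph f"
    have dom: "dom f = set vs" by (rule maps_dom[OF out_atom.hyps(4)])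
    have R: "R \<in> symbols B" using well_sorted_subf[OF out_atom.hyps(1)] out_atom.hyps(2) by simp
    have "\<not> (\<exists>r\<in>set (tlist (right (right x))). left r = enc_name R \<and>
        ttree (map (\<lambda>v. val l v) (map enc_var vs)) \<in> set (tlist (right (right r))))"
      unfolding map_val_graph[OF l dom] rel_table[OF R] by (rule out_atom.hyps(5))
    then show "out_rule x (saturate k x) (path_tree i) l"
      unfolding out_rule_def using consistentI[OF l] set_map_left[OF l] dom out_atom.hyps(2)
      by (intro disjI1 conjI bexI[OF _ occ_mem[OF out_atom.hyps(1)]]) (simp_all add: enc_list_eq)
  qed
next
  case (out_proj i y f)
  have outs: "\<forall>b\<in>univ B (sort_of y). out k \<phi> B i (f(y \<mapsto> b))" using out_proj.IH by blast
  show ?case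
  proof (rule known_outI[OF out.out_proj[OF out_proj.hyps(1-3) outs] _ out_proj.prems])
    fix l assume l: "set (tlist l) = graph f"
    have y: "y \<in> atom_vars"
      using avail_facts[OF out_proj.hyps(1)] free_atom_vars[of i] by blast
    have "known (saturate k x) AvailT (path_tree i) (enc_var y # map left (tlist l))"
      using set_map_left[OF l] by (intro known_avail_complete[OF out_proj.hyps(1)]) simp
    moreover have "known (saturate k x) OutT (path_tree i) (Node (enc_var y) b # tlist l)"
      if b: "b \<in> set (elems x (enc_var y))" for b
    proof -
      obtain c where c: "c \<in> univ B (sort_of y)" "b = enc_name c" using b set_elems[OF y] by auto
      have "set (Node (enc_var y) b # tlist l) = graph (f(y \<mapsto> c))"
        using graph_upd[OF out_proj.hyps(2), of c] l c(2) by simp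
      then show ?thesis using out_proj.IH c(1) by blast
    qed
    moreover have "enc_var y \<notin> set (map left (tlist l))" "enc_var y \<in> set (vars x)"
      using set_map_left[OF l] out_proj.hyps(2) y set_vars by auto
    ultimately show "out_rule x (saturate k x) (path_tree i) l"
      unfolding out_rule_def using consistentI[OF l] by blast
  qed
next
  case (out_ext i f y b)
  show ?case
  proof (rule known_outI[OF out.out_ext[OF out_ext.hyps] _ out_ext.prems])
    fix l assume l: "set (tlist l) = graph (f(y \<mapsto> b))"
    have y: "y \<in> atom_vars"
      using avail_facts[OF out_ext.hyps(2)] free_atom_vars[of i] by blast
    have "finite (graph f)"
      using finite_graph[of f] avail_finite[OF out_ext.hyps(2)] by simp
    then obtain L' where L': "set L' = graph f" using finite_list by blast
    obtain w where w: "w \<in> set (tlist (saturate k x))" "left w = OutT" "left (right w) = path_tree i"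
      "set (tlist (right (right w))) = graph f"
      using out_ext.IH[OF L'] L' unfolding known_def by auto
    let ?a = "Node (enc_var y) (enc_name b)"
    have "known (saturate k x) AvailT (path_tree i) (left ?a # map left (tlist (right (right w))))"
      using set_map_left[OF w(4)] by (intro known_avail_complete[OF out_ext.hyps(2)]) simp
    moreover have "?a \<in> set (pairs x)" using y out_ext.hyps(4) unfolding set_pairs by blast
    moreover have "left ?a \<notin> set (map left (tlist (right (right w))))"
      using set_map_left[OF w(4)] out_ext.hyps(3) by auto
    moreover have "set (?a # tlist (right (right w))) = set (tlist l)"
      using l w(4) graph_upd[OF out_ext.hyps(3), of b] by simp
    ultimately show "out_rule x (saturate k x) (path_tree i) l"
      unfolding out_rule_def using w(1-3) by blast
  qed
next
  case (out_up j f i)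
  show ?case
  proof (rule known_outI[OF out.out_up[OF out_up.hyps] _ out_up.prems])
    fix l assume l: "set (tlist l) = graph f"
    have "i \<in> indices \<phi>" using out_up.hyps by (simp add: parent_def)
    then have "all_free (saturate k x) (path_tree i) (map left (tlist l))"
      using all_freeI[OF _ set_map_left[OF l]] out_up.hyps by blast
    then show "out_rule x (saturate k x) (path_tree i) l"
      unfolding out_rule_def using flow_ruleI[OF out_up.IH[OF l]] out_up.hyps by blast
  qed
next
  case (out_all j f y b i)
  show ?case
  proof (rule known_outI[OF out.out_all[OF out_all.hyps] _ out_all.prems])
    fix l assume l: "set (tlist l) = graph f"
    have i: "i \<in> indices \<phi>" using out_all.hyps by (simp add: parent_def)
    have f: "f(y \<mapsto> b) \<in> maps B (insert y (dom f))" "avail k \<phi> j (insert y (dom f))"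
      using out_facts[OF out_all.hyps(1)] by (simp_all del: fun_upd_apply)
    \<comment> \<open>The rule searches \<open>b\<close> in \<open>elems\<close>. That
      \<open>b\<close> lies in the universe is not a premise of \<open>out_all\<close>, but excluded
      assignments are always maps into the structure.\<close>
    have b: "b \<in> univ B (sort_of y)" using f(1) maps_upd_iff[OF out_all.hyps(2), of b B] by blast
    have "y \<in> atom_vars" using avail_facts[OF f(2)] free_atom_vars[of j] by blast
    then have be: "enc_name b \<in> set (elems x (enc_var y))" using b set_elems by auto
    obtain d where d: "d \<in> set (occs x)" "left d \<noteq> Leaf" "right (left d) = path_tree i" "left d = path_tree j"
      using parent_occ[OF out_all.hyps(4)] .
    have k: "known (saturate k x) OutT (left d) (Node (enc_var y) (enc_name b) # tlist l)"
      unfolding d(4) using graph_upd[OF out_all.hyps(2), of b] l by (intro out_all.IH) (simp del: fun_upd_apply)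
    have ny: "enc_var y \<notin> set (map left (tlist l))"
      using set_map_left[OF l] out_all.hyps(2) by auto
    show "out_rule x (saturate k x) (path_tree i) l"
      unfolding out_rule_def
    proof (intro disjI2 bexI[OF _ occ_mem[OF i]] conjI)
      show "\<exists>b\<in>set (elems x (left (right (right (Node (path_tree i) (enc_qc (subf \<phi> i))))))).
          \<exists>d\<in>set (occs x). left d \<noteq> Leaf \<and> right (left d) = path_tree i \<and>
            known (saturate k x) OutT (left d)
             (Node (left (right (right (Node (path_tree i) (enc_qc (subf \<phi> i)))))) b # tlist l)"
        using be d(1-3) k out_all.hyps(3) by auto
    qed (use ny out_all.hyps(3) in simp_all)
  qed
next
  case (out_down j f i)
  show ?case
  proof (rule known_outI[OF out.out_down[OF out_down.hyps] _ out_down.prems])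
    fix l assume l: "set (tlist l) = graph f"
    have "i \<in> indices \<phi>" using out_down.hyps by (simp add: parent_def)
    then have "all_free (saturate k x) (path_tree i) (map left (tlist l))"
      using all_freeI[OF _ set_map_left[OF l]] out_down.hyps by blast
    then show "out_rule x (saturate k x) (path_tree i) l"
      unfolding out_rule_def using flow_ruleI[OF out_down.IH[OF l]] out_down.hyps by blast
  qed
qed

text \<open>The root has path \<open>Leaf\<close> and the empty map has empty graph, so the queried
  fact is the exclusion of the empty map at the root.\<close>

lemma judge_consistent_iff_saturate:
  "judge_consistent k \<phi> B \<longleftrightarrow> \<not> known (saturate k x) OutT Leaf []"
proof -
  have "finite (univ B (sort_of y))" if "avail k \<phi> i V" "y \<in> V" for i V y
  proof -
    have "y \<in> atom_vars" using avail_facts[OF that(1)] free_atom_vars[of i] that(2) by blast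
    then show ?thesis using atom_vars_sort fin unfolding finite_struct_def by blast
  qed
  then have "judge_consistent k \<phi> B \<longleftrightarrow> \<not> out k \<phi> B [] Map.empty"
    by (rule judge_consistent_iff_not_out)
  moreover have "out k \<phi> B [] Map.empty \<longleftrightarrow> known (saturate k x) OutT Leaf []"
    using known_out[OF sound_saturate, of "[]" "[]" Map.empty]
      known_out_complete[of "[]" Map.empty "[]"] by auto
  ultimately show ?thesis by simp
qed

end

theorem theorem5p4:
  fixes k :: nat
  assumes "k \<ge> 1"
  shows "\<exists>(c :: prog) (p :: nat poly).
    \<forall>(\<phi> :: (name, name, name) qc) (B :: (name, name, name) struct) (x :: tree).
      qcsp_instance \<phi> B \<and> finite_struct B \<and> encodes_instance x \<phi> B \<longrightarrow>
      outputs_within c x (poly p (tsize x)) (enc_bool (judge_consistent k \<phi> B))"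
proof -
  have "ptb (\<lambda>x. \<not> known (saturate k x) OutT Leaf [])"
    by (intro ptb_not ptb_known pt_saturate pt_intros)
  then obtain c n T where T: "poly_bounded T"
    and c: "computes c n T (\<lambda>x. enc_bool (\<not> known (saturate k x) OutT Leaf []))"
    unfolding ptb_def by (rule ptE)
  obtain p where p: "\<And>x. T x \<le> poly p (tsize x)"
    using T unfolding poly_bounded_def by blast
  show ?thesis
  proof (intro exI allI impI)
    fix \<phi> :: "(name, name, name) qc" and B :: "(name, name, name) struct" and x
    assume a: "qcsp_instance \<phi> B \<and> finite_struct B \<and> encodes_instance x \<phi> B"
    then obtain us rs where "encoded_instance k \<phi> B us rs x"
      unfolding encodes_instance_def encoded_instance_def using assms by blast
    then have eq: "judge_consistent k \<phi> B \<longleftrightarrow> \<not> known (saturate k x) OutT Leaf []"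
      by (rule encoded_instance.judge_consistent_iff_saturate)
    obtain s where s: "run c (init_store x) (T (init_store x 0)) s"
      "s 0 = enc_bool (\<not> known (saturate k (init_store x 0)) OutT Leaf [])"
      using c unfolding computes_def by blast
    have x0: "init_store x 0 = x" by (simp add: init_store_def)
    obtain t where t: "exec c (init_store x) t s" "t \<le> T x"
      using s(1) unfolding run_def x0 by blast
    show "outputs_within c x (poly p (tsize x)) (enc_bool (judge_consistent k \<phi> B))"
      unfolding outputs_within_def eq using t s(2) p[of x] unfolding x0 by (meson order_trans)
  qed
qed

end
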